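(* For each $n\ge1$ let $p_n\in(0,1)$ with $p_n\to0$, $r_n:=1/p_n$, let $X_1,\dots,X_n$ be i.i.d. $\mathrm{Ber}(p_n)$, and let $\{G_n\}_{n\ge1}$ be a sequence of dense graphs, $G_n$ having $n$ vertices and adjacency matrix $(a_{uv}(G_n))$, with vertices labelled $\{1,\dots,n\}$ in non-increasing order of the degrees. Let $T_n:=\frac12\sum_{1\le u,v\le n}a_{uv}(G_n)X_uX_v$ and suppose $\mathbb E[T_n]=|E(G_n)|p_n^2=\Theta(1)$. (a) Suppose there exists $W\in\mathcal W$ such that for all $K>0$ large enough $\lim_{n\to\infty}\|W_{G_n}-W\|_{\square([0,K]^2)}=0$. Then $W$ vanishes (Lebesgue almost everywhere) outside a compact rectangle $[0,a]^2$ for some finite $a\ge0$, and $T_n$ converges in distribution to $Q_1$, where for $t_1\ge0$ $$\mathbb E\exp\{-t_1Q_1\}=\mathbb E\exp\left\{\frac12\int_0^a\int_0^a\phi_{W,t_1}(x,y)\,dN(x)\,dN(y)\right\},\qquad(\ast)$$ with $\phi_{W,t_1}(x,y):=\log(1-W(x,y)+W(x,y)e^{-t_1})$ and $\{N(t),t\ge0\}$ a homogeneous Poisson process of rate $1$. (b) Conversely, if $T_n$ converges in distribution, then the limit is necessarily of the form $Q_1$ with moment generating function $(\ast)$, for some $W\in\mathcal W$ which vanishes outside $[0,a]^2$ for some finite $a\ge0$.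
   Context: A sequence of graphs $\{G_n\}$ is dense if $|E(G_n)|\ge Cn^2$ for some constant $C>0$ and all $n$ large enough. $\Theta(1)$ means bounded above and below by positive constants for all large $n$. All graphs are simple and undirected. $\mathcal W$ is the set of symmetric measurable functions $[0,\infty)^2\to[0,1]$. $W_{G_n}(x,y)=\mathbf 1\{(\lceil xr_n\rceil,\lceil yr_n\rceil)\in E(G_n)\}$ for $x,y\in[0,n/r_n]$ and $0$ otherwise. Cut-distance: $\|W_1-W_2\|_{\square([0,K]^2)}:=\sup_{f,g:[0,K]\to[-1,1]}\left|\int_{[0,K]^2}(W_1(x,y)-W_2(x,y))f(x)g(y)\,dx\,dy\right|$. Stochastic integrals: let $N(A)$ be the number of points of the rate-1 Poisson process in the Borel set $A\subseteq[0,\infty)$. If $f=\sum_{i,j=1}^m a_{ij}\mathbf 1_{A_i\times A_j}\in L_1([0,\infty)^2)$ with $A_1,\dots,A_m$ pairwise disjoint Borel sets and $a_{ii}=0$ for all $i$, then $\int\int f\,dN(x)dN(y):=\sum a_{ij}N(A_i)N(A_j)$. For general $f\in L_1([0,\infty)^2)$ the integral is the $L_1(\Omega)$-limit of the integrals of any sequence of such elementary functions converging to $f$ in $L_1$ (the limit exists and does not depend on the sequence). Integrals over $[0,a]^2$ are integrals of the function multiplied by $\mathbf 1_{[0,a]^2}$. *)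

theory Defs
  imports "HOL-Probability.Probability" "HOL-Library.Ramsey" "HOL-Library.Landau_Symbols"
begin

section \<open>Graphs and the quadratic form\<close>

text \<open>A simple graph on the vertex set \<open>V\<close> is given by its edge set, a subset of \<open>nsets V 2\<close>;
  in particular a vertex \<open>u\<close> is never adjacent to itself, since \<open>{u, u}\<close> has one element.\<close>

definition adj :: "nat set set \<Rightarrow> nat \<Rightarrow> nat \<Rightarrow> real" where
  "adj E u v = of_bool ({u, v} \<in> E)"

definition degree :: "nat set set \<Rightarrow> nat \<Rightarrow> nat" where
  "degree E u = card {e \<in> E. u \<in> e}"

definition dense_graphs :: "(nat \<Rightarrow> nat set set) \<Rightarrow> bool" where
  "dense_graphs G \<longleftrightarrow> (\<exists>C>0. \<forall>\<^sub>F n in sequentially. real (card (G n)) \<ge> C * (real n)\<^sup>2)"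

definition T_stat :: "nat \<Rightarrow> nat set set \<Rightarrow> (nat \<Rightarrow> 'a \<Rightarrow> bool) \<Rightarrow> 'a \<Rightarrow> real" where
  "T_stat n E X \<omega> =
     1 / 2 * (\<Sum>u = 1..n. \<Sum>v = 1..n. adj E u v * of_bool (X u \<omega>) * of_bool (X v \<omega>))"


section \<open>Kernels and cut distance\<close>

abbreviation quadrant :: "(real \<times> real) set" where
  "quadrant \<equiv> {0..} \<times> {0..}"

text \<open>Kernels are total functions on the plane; only their values on the quadrant matter.\<close>

definition kernels :: "(real \<times> real \<Rightarrow> real) set" where
  "kernels = {W. set_borel_measurable borel quadrant W \<and>
     (\<forall>x\<ge>0. \<forall>y\<ge>0. W (x, y) = W (y, x) \<and> 0 \<le> W (x, y) \<and> W (x, y) \<le> 1)}"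

text \<open>For \<open>x = 0\<close> the ceiling is \<open>0\<close>, which is not a vertex, and the value is \<open>0\<close>.\<close>

definition graph_kernel :: "nat \<Rightarrow> nat set set \<Rightarrow> real \<Rightarrow> real \<times> real \<Rightarrow> real" where
  "graph_kernel n E r = (\<lambda>(x, y).
     if x \<in> {0..real n / r} \<and> y \<in> {0..real n / r}
     then of_bool ({nat \<lceil>x * r\<rceil>, nat \<lceil>y * r\<rceil>} \<in> E) else 0)"

definition cut_norm :: "real \<Rightarrow> (real \<times> real \<Rightarrow> real) \<Rightarrow> real" where
  "cut_norm K U =
     (SUP (f, g) \<in> {(f, g). set_borel_measurable borel {0..K} f \<and> set_borel_measurable borel {0..K} g \<and>
          (\<forall>x\<in>{0..K}. f x \<in> {-1..1}) \<and> (\<forall>x\<in>{0..K}. g x \<in> {-1..1})}.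
        \<bar>LINT (x, y) : {0..K} \<times> {0..K} | lborel. U (x, y) * f x * g y\<bar>)"


section \<open>The Poisson process and double stochastic integrals\<close>

text \<open>\<open>\<Xi> \<omega>\<close> is the random set of points.  If it meets \<open>A\<close> in infinitely many points, which has
  probability \<open>0\<close> when \<open>A\<close> has finite length, the value below is \<open>0\<close> by the convention for
  \<^const>\<open>card\<close>.\<close>

definition num_points :: "('b \<Rightarrow> real set) \<Rightarrow> real set \<Rightarrow> 'b \<Rightarrow> nat" where
  "num_points \<Xi> A \<omega> = card (\<Xi> \<omega> \<inter> A)"

text \<open>The Poisson probabilities are written out because \<^const>\<open>poisson_pmf\<close> is specified only for
  positive parameters, while \<open>A\<close> may be a null set.\<close>

definition rate1_poisson_process :: "'b measure \<Rightarrow> ('b \<Rightarrow> real set) \<Rightarrow> bool" where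
  "rate1_poisson_process M \<Xi> \<longleftrightarrow>
     prob_space M \<and>
     (\<forall>\<omega>\<in>space M. \<Xi> \<omega> \<subseteq> {0..} \<and> (\<forall>t. finite (\<Xi> \<omega> \<inter> {0..t}))) \<and>
     (\<forall>A\<in>sets borel. A \<subseteq> {0..} \<and> emeasure lborel A < \<infinity> \<longrightarrow>
        num_points \<Xi> A \<in> measurable M (count_space UNIV) \<and>
        (\<forall>k. measure M {\<omega>\<in>space M. num_points \<Xi> A \<omega> = k}
               = measure lborel A ^ k / fact k * exp (- measure lborel A))) \<and>
     (\<forall>A :: nat \<Rightarrow> real set.
        (\<forall>i. A i \<in> sets borel \<and> A i \<subseteq> {0..} \<and> emeasure lborel (A i) < \<infinity>) \<and> disjoint_family A \<longrightarrow>
        prob_space.indep_vars M (\<lambda>_. count_space UNIV) (\<lambda>i. num_points \<Xi> (A i)) UNIV)"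

definition elementary :: "nat \<Rightarrow> (nat \<Rightarrow> nat \<Rightarrow> real) \<Rightarrow> (nat \<Rightarrow> real set) \<Rightarrow> real \<times> real \<Rightarrow> real" where
  "elementary m c A z = (\<Sum>i<m. \<Sum>j<m. c i j * indicator (A i \<times> A j) z)"

definition elementary_data :: "nat \<Rightarrow> (nat \<Rightarrow> nat \<Rightarrow> real) \<Rightarrow> (nat \<Rightarrow> real set) \<Rightarrow> bool" where
  "elementary_data m c A \<longleftrightarrow>
     (\<forall>i<m. A i \<in> sets borel \<and> A i \<subseteq> {0..}) \<and> disjoint_family_on A {..<m} \<and> (\<forall>i<m. c i i = 0) \<and>
     set_integrable lborel quadrant (elementary m c A)"

definition elementary_integral ::
  "('b \<Rightarrow> real set) \<Rightarrow> nat \<Rightarrow> (nat \<Rightarrow> nat \<Rightarrow> real) \<Rightarrow> (nat \<Rightarrow> real set) \<Rightarrow> 'b \<Rightarrow> real" where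
  "elementary_integral \<Xi> m c A \<omega> =
     (\<Sum>i<m. \<Sum>j<m. c i j * real (num_points \<Xi> (A i) \<omega>) * real (num_points \<Xi> (A j) \<omega>))"

text \<open>\<open>Z\<close> is a version of the double integral of \<open>f\<close>: it is the \<open>L\<^sub>1\<close> limit of the integrals along every
  sequence of elementary functions tending to \<open>f\<close> in \<open>L\<^sub>1\<close>.\<close>

definition has_stoch_integral ::
  "'b measure \<Rightarrow> ('b \<Rightarrow> real set) \<Rightarrow> (real \<times> real \<Rightarrow> real) \<Rightarrow> ('b \<Rightarrow> real) \<Rightarrow> bool" where
  "has_stoch_integral M \<Xi> f Z \<longleftrightarrow>
     set_integrable lborel quadrant f \<and> integrable M Z \<and>
     (\<forall>m c A. (\<forall>k. elementary_data (m k) (c k) (A k)) \<and>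
        (\<lambda>k. LINT z : quadrant | lborel. \<bar>elementary (m k) (c k) (A k) z - f z\<bar>) \<longlonglongrightarrow> 0 \<longrightarrow>
        (\<forall>k. integrable M (elementary_integral \<Xi> (m k) (c k) (A k))) \<and>
        (\<lambda>k. LINT \<omega> | M. \<bar>elementary_integral \<Xi> (m k) (c k) (A k) \<omega> - Z \<omega>\<bar>) \<longlonglongrightarrow> 0)"

text \<open>The choice affects the integral only on a null set.\<close>

definition stoch_integral ::
  "'b measure \<Rightarrow> ('b \<Rightarrow> real set) \<Rightarrow> (real \<times> real \<Rightarrow> real) \<Rightarrow> 'b \<Rightarrow> real" where
  "stoch_integral M \<Xi> f = (SOME Z. has_stoch_integral M \<Xi> f Z)"


section \<open>The limit law\<close>

definition phi :: "(real \<times> real \<Rightarrow> real) \<Rightarrow> real \<Rightarrow> real \<times> real \<Rightarrow> real" where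
  "phi W t z = ln (1 - W z + W z * exp (- t))"

definition Q1_law ::
  "'b measure \<Rightarrow> ('b \<Rightarrow> real set) \<Rightarrow> (real \<times> real \<Rightarrow> real) \<Rightarrow> real \<Rightarrow> real measure \<Rightarrow> bool" where
  "Q1_law M \<Xi> W a \<mu> \<longleftrightarrow> real_distribution \<mu> \<and>
     (\<forall>t\<ge>0. integrable \<mu> (\<lambda>q. exp (- t * q)) \<and>
        (LINT q | \<mu>. exp (- t * q)) =
        (LINT \<omega> | M. exp (1 / 2 *
           stoch_integral M \<Xi> (\<lambda>z. indicator ({0..a} \<times> {0..a}) z * phi W t z) \<omega>)))"

end

(*
For z in the closed unit disc, E z^(T_n) is a sum over vertex sets S of Bernoulli weights times the
product of 1 - (1 - z) a_uv over the pairs in S.  Replacing the Bernoulli selection by a Poisson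
process on cells of length p_n turns this into Psi(W_n), the expectation of the product of
1 - (1 - z) W_n(x, y) over all pairs of points; the error is of order n p_n^2.  Density and the
bound on E T_n give n p_n <= a, so everything takes place on the square [0, a]^2.  Two estimates
compare different kernels.  Psi is Lipschitz in the L1 norm by Campbell's formula.  The discrete
generating function is Lipschitz in the cut norm, since its derivative along a segment is a mixture
of bilinear forms f_u g_v.  The stochastic integral of phi is the sum of phi over ordered pairs of
distinct points, so Psi at z = exp(-t) is the right-hand side of the limit formula.

(a) Averaging W over the cells of the grid preserves the cut distance to W_n and converges to W in
L1, hence E z^(T_n) tends to Psi(W); z on the unit circle gives weak convergence by tightness and
Levy's theorem, and z = exp(-t) identifies the limit.

(b) For each graph, refine a partition greedily by the best cut of the remaining matrix.  The energy
increments bound the cut norms of the errors, and along a subsequence the block densities, block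
sizes and energies converge.  The limiting step kernels form an L1 Cauchy sequence, because their
distances are controlled by energy differences, and the limit is the kernel W.
*)
theory Submission
  imports Defs
begin

section \<open>Generating functions of random induced subgraphs\<close>

text \<open>\<open>Psi\<close> is compared with other kernels only in the L1 norm, so the cut norm
  has to be exploited before the passage to the Poisson process, on finite matrices. There the
  scales match: a cut distance \<kappa> of kernels is a bound \<kappa> / p^2 for matrices, while the
  derivative of the generating function carries the weight (p / (1 - p))^2 of selecting two more
  vertices, and the diagonal costs n p^2. All z of the closed unit disc are treated at once: 1 - (1
  - z) w is a convex combination of 1 and z, so every product has modulus at most 1, and the mean is
  the only moment of T that enters. The unit circle gives characteristic functions, the interval (0,
  1] gives Laplace transforms. In (b) the generating function does not depend on the labels, so each
  graph may be sorted in the way that suits its partition. In place of a regularity lemma with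
  prescribed accuracy there is one chain of refinements, kept at all levels: scaled energies are at
  most a^2, so their limits over the graphs converge as the level grows, and the increments tend to
  0.\<close>

definition bern_weight :: "real \<Rightarrow> 'v set \<Rightarrow> 'v set \<Rightarrow> real" where
  "bern_weight q V S = (\<Prod>v\<in>V. if v \<in> S then q else 1 - q)"

text \<open>Each unordered pair of distinct elements appears once, with the smaller entry first.
  Vertices and points of the line both carry a linear order, so one product serves for graphs and
  for the Poisson process.\<close>

definition ordered_pairs :: "'v::linorder set \<Rightarrow> ('v \<times> 'v) set" where
  "ordered_pairs S = {(u, v). u \<in> S \<and> v \<in> S \<and> u < v}"

definition pair_prod :: "('v::linorder \<Rightarrow> 'v \<Rightarrow> complex) \<Rightarrow> 'v set \<Rightarrow> complex" where
  "pair_prod c S = (\<Prod>(u, v)\<in>ordered_pairs S. c u v)"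

text \<open>For a 0/1 matrix this is the expectation of \<open>z\<close> to the number of edges
  inside a Bernoulli(\<open>q\<close>) random vertex set. An entry in [0, 1] contributes the factor
  (1 - \<open>A u v\<close>) + \<open>A u v\<close> * \<open>z\<close>, the generating function of
  an edge present with that probability, so averaged matrices are covered too.\<close>

definition edge_gf :: "real \<Rightarrow> complex \<Rightarrow> 'v::linorder set \<Rightarrow> ('v \<Rightarrow> 'v \<Rightarrow> real) \<Rightarrow> complex" where
  "edge_gf q z V A =
     (\<Sum>S\<in>Pow V. of_real (bern_weight q V S) * pair_prod (\<lambda>u v. 1 - (1 - z) * of_real (A u v)) S)"

lemma finite_ordered_pairs [simp]: "finite S \<Longrightarrow> finite (ordered_pairs S)"
  unfolding ordered_pairs_def by (rule finite_subset[of _ "S \<times> S"]) auto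

lemma pair_prod_cong:
  assumes "\<And>u v. u \<in> S \<Longrightarrow> v \<in> S \<Longrightarrow> u < v \<Longrightarrow> c u v = d u v"
  shows "pair_prod c S = pair_prod d S"
  unfolding pair_prod_def using assms by (intro prod.cong) (auto simp: ordered_pairs_def)

lemma norm_pair_prod_le_1:
  assumes "\<And>u v. u \<in> S \<Longrightarrow> v \<in> S \<Longrightarrow> u < v \<Longrightarrow> norm (c u v) \<le> 1"
  shows "norm (pair_prod c S) \<le> 1"
  unfolding pair_prod_def prod_norm[symmetric] using assms
  by (intro prod_le_1) (auto simp: ordered_pairs_def)

text \<open>A bijection need not respect the two orders; a pair is turned around where it does not,
  which the symmetry of \<open>c\<close> permits. This lets points of the line stand for vertices
  whatever the arrangement of their intervals.\<close>

lemma pair_prod_reindex: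
  fixes h :: "'v::linorder \<Rightarrow> 'w::linorder"
  assumes bij: "bij_betw h S S'"
    and sym: "\<And>x y. x \<in> S' \<Longrightarrow> y \<in> S' \<Longrightarrow> c x y = c y x"
  shows "pair_prod c S' = pair_prod (\<lambda>u v. c (h u) (h v)) S"
proof -
  define g where "g = inv_into S h"
  have h: "h u \<in> S'" "g (h u) = u" if "u \<in> S" for u
    using that bij by (auto simp: g_def bij_betw_def)
  have g: "g x \<in> S" "h (g x) = x" if "x \<in> S'" for x
    using that bij by (auto simp: g_def bij_betw_def inv_into_into f_inv_into_f)
  have inj: "h u = h v \<longleftrightarrow> u = v" if "u \<in> S" "v \<in> S" for u v
    using that h by metis
  have injg: "g u = g v \<longleftrightarrow> u = v" if "u \<in> S'" "v \<in> S'" for u v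
    using that g by metis
  show ?thesis
    unfolding pair_prod_def
  proof (rule prod.reindex_bij_witness[where
        i = "\<lambda>(u, v). if h u < h v then (h u, h v) else (h v, h u)" and
        j = "\<lambda>(x, y). if g x < g y then (g x, g y) else (g y, g x)"])
  qed (auto simp: ordered_pairs_def h g inj injg neq_iff not_less split: if_splits
        dest: order.antisym intro: sym; (use inj injg h g in \<open>force simp: less_le\<close>)?)+
qed

lemma pair_prod_insert:
  assumes "finite R" "i \<notin> R" and sym: "\<And>u. u \<in> R \<Longrightarrow> c u i = c i u"
  shows "pair_prod c (insert i R) = pair_prod c R * (\<Prod>u\<in>R. c i u)"
proof -
  let ?A = "(\<lambda>u. (min i u, max i u)) ` R"
  have eq: "ordered_pairs (insert i R) = ordered_pairs R \<union> ?A"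
  proof (intro set_eqI iffI)
    fix p assume "p \<in> ordered_pairs (insert i R)"
    then show "p \<in> ordered_pairs R \<union> ?A"
      by (cases p) (force simp: ordered_pairs_def image_iff)
  next
    fix p assume "p \<in> ordered_pairs R \<union> ?A"
    moreover have "min i u < max i u" if "u \<in> R" for u
      using that assms(2) by (cases i u rule: linorder_cases) auto
    ultimately show "p \<in> ordered_pairs (insert i R)"
      by (auto simp: ordered_pairs_def min_def max_def)
  qed
  have inj: "inj_on (\<lambda>u. (min i u, max i u)) R"
    by (auto simp: inj_on_def min_def max_def split: if_splits)
  have dis: "ordered_pairs R \<inter> ?A = {}"
    using assms(2) by (auto simp: ordered_pairs_def min_def max_def split: if_splits)
  have "(\<Prod>(u, v)\<in>?A. c u v) = (\<Prod>u\<in>R. c i u)"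
    using sym by (subst prod.reindex[OF inj]) (auto simp: min_def max_def intro!: prod.cong)
  then show ?thesis
    unfolding pair_prod_def eq using assms(1) dis by (subst prod.union_disjoint) auto
qed

section \<open>Bernoulli weights of the subsets of a finite set\<close>

lemma sum_Pow_insert:
  fixes f :: "'v set \<Rightarrow> 'b::comm_monoid_add"
  assumes "finite V" "x \<notin> V"
  shows "(\<Sum>S\<in>Pow (insert x V). f S) = (\<Sum>S\<in>Pow V. f S + f (insert x S))"
proof -
  have inj: "inj_on (insert x) (Pow V)"
    using assms by (auto simp: inj_on_def)
  have "(\<Sum>S\<in>Pow (insert x V). f S) = (\<Sum>S\<in>Pow V. f S) + (\<Sum>S\<in>insert x ` Pow V. f S)"
    unfolding Pow_insert using assms by (intro sum.union_disjoint) auto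
  then show ?thesis
    by (simp add: sum.reindex[OF inj] sum.distrib)
qed

lemma bern_weight_nonneg: "0 \<le> q \<Longrightarrow> q \<le> 1 \<Longrightarrow> 0 \<le> bern_weight q V S"
  unfolding bern_weight_def by (intro prod_nonneg) auto

lemma bern_weight_insert:
  assumes "finite V" "x \<notin> V"
  shows "S \<subseteq> V \<Longrightarrow> bern_weight q (insert x V) S = (1 - q) * bern_weight q V S"
    and "bern_weight q (insert x V) (insert x S) = q * bern_weight q V S"
proof -
  show "bern_weight q (insert x V) S = (1 - q) * bern_weight q V S" if "S \<subseteq> V"
    using that assms unfolding bern_weight_def by auto
  have "(\<Prod>v\<in>V. if v \<in> insert x S then q else 1 - q) = (\<Prod>v\<in>V. if v \<in> S then q else 1 - q)"
    using assms(2) by (intro prod.cong) auto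
  then show "bern_weight q (insert x V) (insert x S) = q * bern_weight q V S"
    using assms unfolding bern_weight_def by simp
qed

lemma sum_bern_weight:
  assumes "finite V"
  shows "(\<Sum>S\<in>Pow V. bern_weight q V S) = 1"
  using assms
proof (induction V)
  case empty
  then show ?case by (simp add: bern_weight_def)
next
  case (insert x V)
  have "(\<Sum>S\<in>Pow (insert x V). bern_weight q (insert x V) S) = (\<Sum>S\<in>Pow V. bern_weight q V S)"
    using insert.hyps by (simp add: sum_Pow_insert bern_weight_insert algebra_simps)
  then show ?case using insert.IH by simp
qed

text \<open>Adding a vertex costs at most 2 * |\<open>q\<close> - \<open>q'\<close>|, the l1
  distance between the two Bernoulli laws; for product laws such distances add up.\<close>

lemma bern_weight_l1_diff:
  assumes "finite V" "0 \<le> q" "q \<le> 1" "0 \<le> q'" "q' \<le> 1"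
  shows "(\<Sum>S\<in>Pow V. \<bar>bern_weight q V S - bern_weight q' V S\<bar>) \<le> 2 * real (card V) * \<bar>q - q'\<bar>"
  using assms(1)
proof (induction V)
  case empty
  then show ?case by (simp add: bern_weight_def)
next
  case (insert x V)
  let ?w = "bern_weight q V" and ?w' = "bern_weight q' V"
  have key: "\<bar>(1 - q) * ?w S - (1 - q') * ?w' S\<bar> + \<bar>q * ?w S - q' * ?w' S\<bar>
      \<le> \<bar>?w S - ?w' S\<bar> + 2 * \<bar>q - q'\<bar> * ?w' S" for S
  proof -
    have nn: "0 \<le> ?w' S" using assms bern_weight_nonneg by blast
    have "\<bar>(1 - q) * ?w S - (1 - q') * ?w' S\<bar> = \<bar>(1 - q) * (?w S - ?w' S) + (q' - q) * ?w' S\<bar>"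
      by (simp add: algebra_simps)
    also have "\<dots> \<le> (1 - q) * \<bar>?w S - ?w' S\<bar> + \<bar>q - q'\<bar> * ?w' S"
      using assms nn by (intro order.trans[OF abs_triangle_ineq]) (simp add: abs_mult abs_minus_commute)
    finally have 1: "\<bar>(1 - q) * ?w S - (1 - q') * ?w' S\<bar> \<le> \<dots>" .
    have "\<bar>q * ?w S - q' * ?w' S\<bar> = \<bar>q * (?w S - ?w' S) + (q - q') * ?w' S\<bar>"
      by (simp add: algebra_simps)
    also have "\<dots> \<le> q * \<bar>?w S - ?w' S\<bar> + \<bar>q - q'\<bar> * ?w' S"
      using assms nn by (intro order.trans[OF abs_triangle_ineq]) (simp add: abs_mult)
    finally show ?thesis using 1 by (simp add: algebra_simps)
  qed
  have "(\<Sum>S\<in>Pow (insert x V). \<bar>bern_weight q (insert x V) S - bern_weight q' (insert x V) S\<bar>)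
      \<le> (\<Sum>S\<in>Pow V. \<bar>?w S - ?w' S\<bar> + 2 * \<bar>q - q'\<bar> * ?w' S)"
    using insert.hyps key by (subst sum_Pow_insert) (auto simp: bern_weight_insert intro!: sum_mono)
  also have "\<dots> = (\<Sum>S\<in>Pow V. \<bar>?w S - ?w' S\<bar>) + 2 * \<bar>q - q'\<bar>"
    using sum_bern_weight[OF insert.hyps(1), of q'] by (simp add: sum.distrib sum_distrib_left[symmetric])
  finally show ?case using insert by (simp add: algebra_simps)
qed

text \<open>The factor is (1 - \<open>w\<close>) * 1 + \<open>w\<close> * \<open>z\<close>, a convex
  combination of two points of the closed unit disc.\<close>

lemma norm_edge_factor_le_1:
  fixes z :: complex
  assumes "norm z \<le> 1" "0 \<le> w" "w \<le> 1"
  shows "norm (1 - (1 - z) * of_real w) \<le> 1"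
proof -
  have "norm (1 - (1 - z) * of_real w) = norm (of_real (1 - w) + z * of_real w)"
    by (simp add: algebra_simps)
  also have "\<dots> \<le> (1 - w) + norm z * w"
    using norm_triangle_ineq[of "of_real (1 - w)" "z * of_real w"] assms
    by (simp add: norm_mult del: of_real_diff)
  also have "\<dots> \<le> 1"
    using assms mult_right_mono[of "norm z" 1 w] by simp
  finally show ?thesis .
qed

lemma norm_edge_gf_diff_prob:
  assumes "finite V" "0 \<le> q" "q \<le> 1" "0 \<le> q'" "q' \<le> 1" "norm z \<le> 1"
    and A: "\<And>u v. u \<in> V \<Longrightarrow> v \<in> V \<Longrightarrow> 0 \<le> A u v \<and> A u v \<le> 1"
  shows "norm (edge_gf q z V A - edge_gf q' z V A) \<le> 2 * real (card V) * \<bar>q - q'\<bar>"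
proof -
  let ?F = "pair_prod (\<lambda>u v. 1 - (1 - z) * of_real (A u v))"
  have "edge_gf q z V A - edge_gf q' z V A
      = (\<Sum>S\<in>Pow V. of_real (bern_weight q V S - bern_weight q' V S) * ?F S)"
    unfolding edge_gf_def by (simp add: sum_subtractf[symmetric] algebra_simps)
  also have "norm \<dots> \<le> (\<Sum>S\<in>Pow V. \<bar>bern_weight q V S - bern_weight q' V S\<bar>)"
  proof (intro sum_norm_le)
    fix S assume "S \<in> Pow V"
    then have "norm (?F S) \<le> 1"
      using A assms(6) by (intro norm_pair_prod_le_1 norm_edge_factor_le_1) auto
    then show "norm (of_real (bern_weight q V S - bern_weight q' V S) * ?F S)
        \<le> \<bar>bern_weight q V S - bern_weight q' V S\<bar>"
      by (simp add: norm_mult mult_left_le del: of_real_diff)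
  qed
  finally show ?thesis
    using bern_weight_l1_diff[OF assms(1-5)] by linarith
qed

section \<open>Cut bounds for quadratic forms and for the generating function\<close>

lemma sum_square_ordered_pairs:
  fixes t :: "'v::linorder \<times> 'v \<Rightarrow> 'b::comm_monoid_add"
  assumes fin: "finite S"
  shows "(\<Sum>p\<in>S \<times> S. t p) = (\<Sum>p\<in>ordered_pairs S. t p) + (\<Sum>p\<in>ordered_pairs S. t (prod.swap p)) + (\<Sum>v\<in>S. t (v, v))"
proof -
  have "S \<times> S = (ordered_pairs S \<union> prod.swap ` ordered_pairs S) \<union> (\<lambda>v. (v, v)) ` S"
    by (auto simp: ordered_pairs_def image_iff)
  then have "sum t (S \<times> S) = sum t (ordered_pairs S \<union> prod.swap ` ordered_pairs S) + sum t ((\<lambda>v. (v, v)) ` S)"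
    using fin by (simp only:, subst sum.union_disjoint) (simp_all, auto simp: ordered_pairs_def)
  also have "sum t (ordered_pairs S \<union> prod.swap ` ordered_pairs S)
      = sum t (ordered_pairs S) + sum t (prod.swap ` ordered_pairs S)"
    using fin by (subst sum.union_disjoint) (simp_all, auto simp: ordered_pairs_def)
  also have "sum t (prod.swap ` ordered_pairs S) = (\<Sum>p\<in>ordered_pairs S. t (prod.swap p))"
    by (subst sum.reindex) auto
  also have "sum t ((\<lambda>v. (v, v)) ` S) = (\<Sum>v\<in>S. t (v, v))"
    by (subst sum.reindex) (auto simp: inj_on_def)
  finally show ?thesis .
qed

text \<open>Twice the sum over pairs u < v is the full bilinear sum without its diagonal. The
  diagonal costs \<open>card V\<close>, and splitting the complex vector into real and imaginary
  parts leaves four real forms, each at most \<kappa>.\<close>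

lemma norm_quadratic_form_le_cut:
  fixes B :: "'v::linorder \<Rightarrow> 'v \<Rightarrow> real" and e :: "'v \<Rightarrow> complex"
  assumes fin: "finite V"
    and sym: "\<And>u v. u \<in> V \<Longrightarrow> v \<in> V \<Longrightarrow> B u v = B v u"
    and diag: "\<And>v. v \<in> V \<Longrightarrow> \<bar>B v v\<bar> \<le> 1"
    and cut: "\<And>f g. (\<And>v. v \<in> V \<Longrightarrow> \<bar>f v\<bar> \<le> 1) \<Longrightarrow> (\<And>v. v \<in> V \<Longrightarrow> \<bar>g v\<bar> \<le> 1) \<Longrightarrow>
        \<bar>\<Sum>u\<in>V. \<Sum>v\<in>V. B u v * f u * g v\<bar> \<le> \<kappa>"
    and e: "\<And>v. v \<in> V \<Longrightarrow> norm (e v) \<le> 1"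
  shows "2 * norm (\<Sum>(u, v)\<in>ordered_pairs V. of_real (B u v) * e u * e v) \<le> 4 * \<kappa> + real (card V)"
proof -
  let ?t = "\<lambda>(u, v). of_real (B u v) * e u * e v"
  let ?a = "\<lambda>v. Re (e v)" and ?b = "\<lambda>v. Im (e v)"
  define s where "s f g = (\<Sum>u\<in>V. \<Sum>v\<in>V. B u v * f u * g v)" for f g
  have ab: "\<bar>?a v\<bar> \<le> 1" "\<bar>?b v\<bar> \<le> 1" if "v \<in> V" for v
    using e[OF that] abs_Re_le_cmod[of "e v"] abs_Im_le_cmod[of "e v"] by linarith+
  have "(\<Sum>p\<in>ordered_pairs V. ?t (prod.swap p)) = sum ?t (ordered_pairs V)"
    using sym by (intro sum.cong) (auto simp: ordered_pairs_def)
  then have "2 * sum ?t (ordered_pairs V) = sum ?t (V \<times> V) - (\<Sum>v\<in>V. of_real (B v v) * e v * e v)"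
    unfolding sum_square_ordered_pairs[OF fin] by simp
  also have "sum ?t (V \<times> V) = Complex (s ?a ?a - s ?b ?b) (s ?a ?b + s ?b ?a)"
  proof -
    have "?t (u, v) = of_real (B u v * ?a u * ?a v) - of_real (B u v * ?b u * ?b v)
        + \<i> * (of_real (B u v * ?a u * ?b v) + of_real (B u v * ?b u * ?a v))" for u v
      by (rule complex_eqI) (simp_all add: algebra_simps)
    then have "sum ?t (V \<times> V) = of_real (s ?a ?a) - of_real (s ?b ?b) + \<i> * (of_real (s ?a ?b) + of_real (s ?b ?a))"
      unfolding s_def sum.cartesian_product
      by (simp add: sum.distrib sum_subtractf sum_distrib_left distrib_left case_prod_beta split_def cong: sum.cong)
    then show ?thesis
      by (simp add: complex_eq_iff)
  qed
  finally have "norm (2 * sum ?t (ordered_pairs V))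
     \<le> norm (Complex (s ?a ?a - s ?b ?b) (s ?a ?b + s ?b ?a)) + norm (\<Sum>v\<in>V. of_real (B v v) * e v * e v)"
    by (simp only: norm_triangle_ineq4)
  moreover have "norm (Complex (s ?a ?a - s ?b ?b) (s ?a ?b + s ?b ?a)) \<le> 4 * \<kappa>"
  proof -
    have "\<bar>s ?a ?a\<bar> \<le> \<kappa>" "\<bar>s ?b ?b\<bar> \<le> \<kappa>" "\<bar>s ?a ?b\<bar> \<le> \<kappa>" "\<bar>s ?b ?a\<bar> \<le> \<kappa>"
      unfolding s_def using ab by (auto intro!: cut)
    then show ?thesis
      using cmod_le[of "Complex (s ?a ?a - s ?b ?b) (s ?a ?b + s ?b ?a)"] by simp
  qed
  moreover have "norm (\<Sum>v\<in>V. of_real (B v v) * e v * e v) \<le> (\<Sum>v\<in>V. 1)"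
  proof (intro sum_norm_le)
    fix v assume "v \<in> V"
    then show "norm (of_real (B v v) * e v * e v) \<le> 1"
      using mult_mono[OF mult_mono[OF diag e] e, of v v v] by (simp add: norm_mult)
  qed
  ultimately show ?thesis by (simp add: norm_mult)
qed

text \<open>The pairs are grouped by the rest \<open>R\<close> = S - {i, j} of their set, so that
  for fixed \<open>R\<close> only a quadratic form in i and j remains.\<close>

lemma sum_Pow_ordered_pairs:
  fixes h :: "'v::linorder \<Rightarrow> 'v \<Rightarrow> 'v set \<Rightarrow> 'b::comm_monoid_add"
  assumes fin: "finite V"
  shows "(\<Sum>S\<in>Pow V. \<Sum>(i, j)\<in>ordered_pairs S. h i j S) =
    (\<Sum>R\<in>Pow V. \<Sum>(i, j)\<in>ordered_pairs (V - R). h i j (insert i (insert j R)))"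
proof -
  have fin': "finite (Pow V)" "\<forall>S\<in>Pow V. finite (ordered_pairs S)" "\<forall>S\<in>Pow V. finite (ordered_pairs (V - S))"
    using fin by (auto intro: finite_ordered_pairs finite_subset)
  have "(\<Sum>S\<in>Pow V. \<Sum>(i, j)\<in>ordered_pairs S. h i j S)
      = (\<Sum>x\<in>Sigma (Pow V) ordered_pairs. h (fst (snd x)) (snd (snd x)) (fst x))"
    using sum.Sigma[OF fin'(1,2), of "\<lambda>S p. h (fst p) (snd p) S"] by (simp add: case_prod_beta)
  also have "\<dots> = (\<Sum>x\<in>(SIGMA R:Pow V. ordered_pairs (V - R)).
      h (fst (snd x)) (snd (snd x)) (insert (fst (snd x)) (insert (snd (snd x)) (fst x))))"
    by (rule sum.reindex_bij_witness[where
          i = "\<lambda>x. (insert (fst (snd x)) (insert (snd (snd x)) (fst x)), snd x)" and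
          j = "\<lambda>x. (fst x - {fst (snd x), snd (snd x)}, snd x)"])
       (auto simp: ordered_pairs_def insert_absorb intro!: arg_cong[of _ _ "h _ _"])
  also have "\<dots> = (\<Sum>R\<in>Pow V. \<Sum>(i, j)\<in>ordered_pairs (V - R). h i j (insert i (insert j R)))"
    using sum.Sigma[OF fin'(1,3), of "\<lambda>R p. h (fst p) (snd p) (insert (fst p) (insert (snd p) R))"]
    by (simp add: case_prod_beta)
  finally show ?thesis .
qed

text \<open>Each of the two vertices changes its factor from 1 - \<open>q\<close> to
  \<open>q\<close>. This ratio of order q^2 later absorbs the factor 1 / p^2 between matrices and
  kernels.\<close>

lemma bern_weight_insert_two:
  assumes "finite V" "i \<in> V" "j \<in> V" "i \<noteq> j" "i \<notin> R" "j \<notin> R" "q < 1"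
  shows "bern_weight q V (insert i (insert j R)) = (q / (1 - q))\<^sup>2 * bern_weight q V R"
proof -
  let ?U = "V - {i, j}"
  have V: "V = insert i (insert j ?U)" using assms by auto
  have "(\<Prod>v\<in>?U. if v \<in> insert i (insert j R) then q else 1 - q) = (\<Prod>v\<in>?U. if v \<in> R then q else 1 - q)"
    by (intro prod.cong) auto
  then have "(\<Prod>v\<in>V. if v \<in> insert i (insert j R) then q else 1 - q)
      = q\<^sup>2 * (\<Prod>v\<in>?U. if v \<in> R then q else 1 - q)"
    using assms by (subst V) (simp add: power2_eq_square)
  moreover have "(\<Prod>v\<in>V. if v \<in> R then q else 1 - q)
      = (1 - q)\<^sup>2 * (\<Prod>v\<in>?U. if v \<in> R then q else 1 - q)"
    using assms by (subst V) (simp add: power2_eq_square)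
  ultimately show ?thesis
    unfolding bern_weight_def using assms(7) by (simp add: power_divide)
qed

lemma pair_prod_omit:
  assumes fin: "finite R" and ij: "i < j" "i \<notin> R" "j \<notin> R"
    and sym: "\<And>u v. u \<in> insert i (insert j R) \<Longrightarrow> v \<in> insert i (insert j R) \<Longrightarrow> c u v = c v u"
  shows "(\<Prod>(u, v)\<in>ordered_pairs (insert i (insert j R)) - {(i, j)}. c u v)
     = pair_prod c R * (\<Prod>u\<in>R. c i u) * (\<Prod>u\<in>R. c j u)"
proof -
  \<comment> \<open>Setting the factor of i and j to 1 in both orders keeps the matrix symmetric and
    turns the product with one pair left out into a complete product, to which
    \<open>pair_prod_insert\<close> applies twice.\<close>
  define c' where "c' u v = (if u = i \<and> v = j \<or> u = j \<and> v = i then 1 else c u v)" for u v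
  let ?S = "insert i (insert j R)"
  have c': "c' u v = c u v" if "u \<in> R \<or> v \<in> R" for u v
    using that ij by (auto simp: c'_def)
  have sym': "c' u v = c' v u" if "u \<in> ?S" "v \<in> ?S" for u v
    using sym[OF that] by (auto simp: c'_def)
  have "(\<Prod>(u, v)\<in>ordered_pairs ?S - {(i, j)}. c u v) = (\<Prod>(u, v)\<in>ordered_pairs ?S - {(i, j)}. c' u v)"
  proof (rule prod.cong[OF refl])
    fix p assume p: "p \<in> ordered_pairs ?S - {(i, j)}"
    obtain u v where uv: "p = (u, v)" by (cases p)
    with p have "u < v" "\<not> (u = i \<and> v = j)" by (auto simp: ordered_pairs_def)
    then show "(case p of (u, v) \<Rightarrow> c u v) = (case p of (u, v) \<Rightarrow> c' u v)"
      using ij unfolding uv c'_def by auto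
  qed
  also have "\<dots> = c' i j * (\<Prod>(u, v)\<in>ordered_pairs ?S - {(i, j)}. c' u v)"
    by (simp add: c'_def)
  also have "\<dots> = pair_prod c' ?S"
    unfolding pair_prod_def using fin ij
    by (subst prod.remove[of "ordered_pairs ?S" "(i, j)"]) (simp_all, simp add: ordered_pairs_def)
  also have "\<dots> = pair_prod c' (insert j R) * (\<Prod>u\<in>insert j R. c' i u)"
    using fin ij sym' by (intro pair_prod_insert) auto
  also have "pair_prod c' (insert j R) = pair_prod c' R * (\<Prod>u\<in>R. c' j u)"
    using fin ij sym' by (intro pair_prod_insert) auto
  also have "pair_prod c' R = pair_prod c R"
    using c' by (intro pair_prod_cong) auto
  also have "(\<Prod>u\<in>R. c' j u) = (\<Prod>u\<in>R. c j u)"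
    using c' by (intro prod.cong) auto
  also have "(\<Prod>u\<in>insert j R. c' i u) = (\<Prod>u\<in>R. c i u)"
    using ij fin c' by (simp add: c'_def[of i j])
  finally show ?thesis by (simp add: mult_ac)
qed

text \<open>Along the segment from \<open>B\<close> to \<open>A\<close> the derivative of the generating function is a mixture,
  over vertex sets \<open>R\<close>, of quadratic forms of \<open>A - B\<close> in the products \<open>\<Prod>u\<in>R. c i u\<close>: deleting the
  edge \<open>ij\<close> leaves a product of a function of \<open>i\<close>, a function of \<open>j\<close>, and a term in \<open>R\<close> alone.\<close>

lemma norm_edge_gf_diff_cut:
  fixes A B :: "'v::linorder \<Rightarrow> 'v \<Rightarrow> real"
  assumes fin: "finite V" and q: "0 \<le> q" "q < 1" and z: "norm z \<le> 1"
    and symA: "\<And>u v. u \<in> V \<Longrightarrow> v \<in> V \<Longrightarrow> A u v = A v u"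
    and symB: "\<And>u v. u \<in> V \<Longrightarrow> v \<in> V \<Longrightarrow> B u v = B v u"
    and A01: "\<And>u v. u \<in> V \<Longrightarrow> v \<in> V \<Longrightarrow> 0 \<le> A u v \<and> A u v \<le> 1"
    and B01: "\<And>u v. u \<in> V \<Longrightarrow> v \<in> V \<Longrightarrow> 0 \<le> B u v \<and> B u v \<le> 1"
    and cut: "\<And>f g. (\<And>v. v \<in> V \<Longrightarrow> \<bar>f v\<bar> \<le> 1) \<Longrightarrow> (\<And>v. v \<in> V \<Longrightarrow> \<bar>g v\<bar> \<le> 1) \<Longrightarrow>
        \<bar>\<Sum>u\<in>V. \<Sum>v\<in>V. (A u v - B u v) * f u * g v\<bar> \<le> \<kappa>"
  shows "norm (edge_gf q z V A - edge_gf q z V B) \<le> (q / (1 - q))\<^sup>2 * (4 * \<kappa> + real (card V))"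
proof -
  let ?w = "bern_weight q V" and ?\<rho> = "(q / (1 - q))\<^sup>2" and ?K = "4 * \<kappa> + real (card V)"
  \<comment> \<open>The segment parameter is complex, so that the mean value inequality for complex
    differentiable functions applies; the bound on the derivative is established for real parameters
    in [0, 1].\<close>
  define c where "c \<tau> u v = 1 - (1 - z) * (of_real (B u v) + \<tau> * of_real (A u v - B u v))" for \<tau> u v
  define d where "d u v = - (1 - z) * of_real (A u v - B u v)" for u v
  define f where "f \<tau> = (\<Sum>S\<in>Pow V. of_real (?w S) * pair_prod (c \<tau>) S)" for \<tau>
  define f' where "f' \<tau> = (\<Sum>S\<in>Pow V. of_real (?w S) *
      (\<Sum>p\<in>ordered_pairs S. d (fst p) (snd p) * (\<Prod>p'\<in>ordered_pairs S - {p}. c \<tau> (fst p') (snd p'))))" for \<tau>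
  have deriv: "(f has_field_derivative f' \<tau>) (at \<tau>)" for \<tau>
  proof -
    have c: "((\<lambda>\<tau>. c \<tau> u v) has_field_derivative d u v) (at \<tau>)" for u v
      unfolding c_def d_def by (auto intro!: derivative_eq_intros) (simp add: algebra_simps)
    show ?thesis
      unfolding f_def f'_def pair_prod_def case_prod_beta
      by (intro DERIV_sum DERIV_cmult has_field_derivative_prod c)
  qed
  have bound: "norm (f' (of_real t)) \<le> ?\<rho> * ?K" if t: "0 \<le> t" "t \<le> 1" for t
  proof -
    let ?c = "c (of_real t)"
    have c1: "norm (?c u v) \<le> 1" if "u \<in> V" "v \<in> V" for u v
    proof -
      have "?c u v = 1 - (1 - z) * of_real ((1 - t) * B u v + t * A u v)"
        by (simp add: c_def algebra_simps)
      moreover have "(1 - t) * B u v + t * A u v \<le> 1" "0 \<le> (1 - t) * B u v + t * A u v"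
        using A01[OF that] B01[OF that] t convex_bound_le[of "B u v" 1 "A u v" "1 - t" t] by auto
      ultimately show ?thesis
        using norm_edge_factor_le_1[OF z] by metis
    qed
    have csym: "?c u v = ?c v u" if "u \<in> V" "v \<in> V" for u v
      using symA[OF that] symB[OF that] by (simp add: c_def)
    \<comment> \<open>On \<open>R\<close> the vector is set to 0. The sum over pairs outside
      \<open>R\<close> then extends to all pairs of \<open>V\<close>, where the cut hypothesis is
      available, without changing its value.\<close>
    define e where "e R i = (if i \<in> R then 0 else \<Prod>u\<in>R. ?c i u)" for R i
    have e1: "norm (e R i) \<le> 1" if "R \<subseteq> V" "i \<in> V" for R i
      unfolding e_def using that c1 by (auto simp: prod_norm[symmetric] intro!: prod_le_1)
    have "f' (of_real t) = (\<Sum>S\<in>Pow V. \<Sum>(i, j)\<in>ordered_pairs S.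
        of_real (?w S) * d i j * (\<Prod>(u, v)\<in>ordered_pairs S - {(i, j)}. ?c u v))"
      unfolding f'_def by (simp add: sum_distrib_left case_prod_beta mult.assoc)
    also have "\<dots> = (\<Sum>R\<in>Pow V. \<Sum>(i, j)\<in>ordered_pairs (V - R). of_real (?w (insert i (insert j R))) * d i j *
        (\<Prod>(u, v)\<in>ordered_pairs (insert i (insert j R)) - {(i, j)}. ?c u v))"
      by (rule sum_Pow_ordered_pairs[OF fin])
    also have "\<dots> = (\<Sum>R\<in>Pow V. \<Sum>(i, j)\<in>ordered_pairs (V - R). of_real (?\<rho> * ?w R) * d i j *
        (pair_prod ?c R * (\<Prod>u\<in>R. ?c i u) * (\<Prod>u\<in>R. ?c j u)))"
    proof (intro sum.cong refl, clarify)
      fix R i j assume R: "R \<subseteq> V" and "(i, j) \<in> ordered_pairs (V - R)"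
      then have ij: "i < j" "i \<in> V" "j \<in> V" "i \<notin> R" "j \<notin> R"
        by (auto simp: ordered_pairs_def)
      have "(\<Prod>(u, v)\<in>ordered_pairs (insert i (insert j R)) - {(i, j)}. ?c u v)
          = pair_prod ?c R * (\<Prod>u\<in>R. ?c i u) * (\<Prod>u\<in>R. ?c j u)"
        using fin R ij by (intro pair_prod_omit csym) (auto intro: finite_subset)
      moreover have "?w (insert i (insert j R)) = ?\<rho> * ?w R"
        using fin q ij by (intro bern_weight_insert_two) auto
      ultimately show "of_real (?w (insert i (insert j R))) * d i j *
          (\<Prod>(u, v)\<in>ordered_pairs (insert i (insert j R)) - {(i, j)}. ?c u v)
        = of_real (?\<rho> * ?w R) * d i j * (pair_prod ?c R * (\<Prod>u\<in>R. ?c i u) * (\<Prod>u\<in>R. ?c j u))"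
        by simp
    qed
    also have "\<dots> = (\<Sum>R\<in>Pow V. of_real (?\<rho> * ?w R) * (- (1 - z)) * pair_prod ?c R *
        (\<Sum>(i, j)\<in>ordered_pairs V. of_real (A i j - B i j) * e R i * e R j))"
    proof (intro sum.cong refl)
      fix R assume "R \<in> Pow V"
      have "(\<Sum>(i, j)\<in>ordered_pairs V. of_real (A i j - B i j) * e R i * e R j)
        = (\<Sum>(i, j)\<in>ordered_pairs (V - R). of_real (A i j - B i j) * (\<Prod>u\<in>R. ?c i u) * (\<Prod>u\<in>R. ?c j u))"
        using fin finite_ordered_pairs[OF fin]
        by (intro sum.mono_neutral_cong_right) (auto simp: ordered_pairs_def e_def)
      then show "(\<Sum>(i, j)\<in>ordered_pairs (V - R). of_real (?\<rho> * ?w R) * d i j *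
          (pair_prod ?c R * (\<Prod>u\<in>R. ?c i u) * (\<Prod>u\<in>R. ?c j u)))
        = of_real (?\<rho> * ?w R) * (- (1 - z)) * pair_prod ?c R *
          (\<Sum>(i, j)\<in>ordered_pairs V. of_real (A i j - B i j) * e R i * e R j)"
        by (simp add: d_def sum_distrib_left case_prod_beta mult_ac)
    qed
    also have "norm \<dots> \<le> (\<Sum>R\<in>Pow V. ?\<rho> * ?w R * ?K)"
    proof (intro sum_norm_le)
      fix R assume "R \<in> Pow V"
      then have R: "R \<subseteq> V" by auto
      let ?Q = "\<Sum>(i, j)\<in>ordered_pairs V. of_real (A i j - B i j) * e R i * e R j"
      have Q: "2 * norm ?Q \<le> ?K"
      proof (rule norm_quadratic_form_le_cut[OF fin _ _ cut])
        show "\<bar>A v v - B v v\<bar> \<le> 1" if "v \<in> V" for v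
          using A01[OF that that] B01[OF that that] by linarith
      qed (use R e1 symA symB in auto)
      have H: "norm (pair_prod ?c R) \<le> 1"
        using R c1 by (intro norm_pair_prod_le_1) auto
      \<comment> \<open>The bound 2 for |1 - z| meets the factor 2 in \<open>Q\<close>, so no
        constant is lost.\<close>
      have z2: "norm (- (1 - z)) \<le> 2"
        using z norm_triangle_ineq4[of 1 z] by (simp only: norm_minus_cancel) simp
      have rw: "0 \<le> ?\<rho> * ?w R"
        using q by (simp add: bern_weight_nonneg)
      have "norm (of_real (?\<rho> * ?w R) * (- (1 - z)) * pair_prod ?c R * ?Q)
          = (?\<rho> * ?w R) * (norm (- (1 - z)) * norm (pair_prod ?c R) * norm ?Q)"
        unfolding norm_mult norm_of_real using rw by (simp only: abs_of_nonneg mult.assoc)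
      also have "\<dots> \<le> (?\<rho> * ?w R) * (2 * 1 * norm ?Q)"
        using rw by (intro mult_left_mono mult_right_mono mult_mono z2 H) auto
      also have "\<dots> \<le> (?\<rho> * ?w R) * ?K"
        using Q rw by (intro mult_left_mono) auto
      finally show "norm (of_real (?\<rho> * ?w R) * (- (1 - z)) * pair_prod ?c R * ?Q) \<le> ?\<rho> * ?w R * ?K" .
    qed
    also have "\<dots> = ?\<rho> * ?K"
      by (simp add: sum_distrib_left[symmetric] sum_distrib_right[symmetric] sum_bern_weight[OF fin])
    finally show ?thesis .
  qed
  have "norm (f 1 - f 0) \<le> ?\<rho> * ?K * norm (1 - 0 :: complex)"
  proof (rule field_differentiable_bound[where S = "closed_segment 0 1"])
    show "(f has_field_derivative f' \<tau>) (at \<tau> within closed_segment 0 1)" for \<tau>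
      using deriv by (rule has_field_derivative_at_within)
    show "norm (f' \<tau>) \<le> ?\<rho> * ?K" if "\<tau> \<in> closed_segment 0 1" for \<tau>
      using that bound by (auto simp: closed_segment_def scaleR_conv_of_real)
  qed auto
  moreover have "f 1 = edge_gf q z V A" "f 0 = edge_gf q z V B"
    unfolding f_def edge_gf_def c_def by simp_all
  ultimately show ?thesis by simp
qed

section \<open>Independent selections\<close>

text \<open>\<open>F\<close> is arbitrary, so that one statement yields the measurability of T, its
  generating function, and the expectation over the occupied cells of the Poisson process.\<close>

lemma (in prob_space) expectation_random_subset:
  fixes Y :: "'v \<Rightarrow> 'a \<Rightarrow> bool" and F :: "'v set \<Rightarrow> complex"
  assumes fin: "finite V"
    and indep: "indep_vars (\<lambda>_. count_space UNIV) Y V"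
    and q: "\<And>v. v \<in> V \<Longrightarrow> prob {\<omega>\<in>space M. Y v \<omega>} = q"
  shows "(\<lambda>\<omega>. F {v\<in>V. Y v \<omega>}) \<in> borel_measurable M"
    and "(LINT \<omega>|M. F {v\<in>V. Y v \<omega>}) = (\<Sum>S\<in>Pow V. of_real (bern_weight q V S) * F S)"
proof -
  define E where "E S = {\<omega>\<in>space M. {v\<in>V. Y v \<omega>} = S}" for S
  have meas [measurable]: "Y v \<in> measurable M (count_space UNIV)" if "v \<in> V" for v
    using indep that by (auto simp: indep_vars_def)
  have E_eq: "E S = {\<omega>\<in>space M. \<forall>v\<in>V. Y v \<omega> = (v \<in> S)}" if "S \<subseteq> V" for S
    using that by (auto simp: E_def)
  have E [measurable]: "E S \<in> sets M" if "S \<subseteq> V" for S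
    unfolding E_eq[OF that] using fin by measurable
  have prob_E: "prob (E S) = bern_weight q V S" if S: "S \<subseteq> V" for S
  \<comment> \<open>The product rule for independent events concerns nonempty index sets, hence the
    separate case.\<close>
  proof (cases "V = {}")
    case True
    then show ?thesis using S by (simp add: E_def bern_weight_def prob_space)
  next
    case False
    have "E S = (\<Inter>v\<in>V. Y v -` {v \<in> S} \<inter> space M)"
      unfolding E_eq[OF S] using False by auto
    also have "prob \<dots> = (\<Prod>v\<in>V. prob (Y v -` {v \<in> S} \<inter> space M))"
      by (intro indep_varsD_finite[OF indep False fin]) auto
    also have "\<dots> = bern_weight q V S"
      unfolding bern_weight_def
    proof (intro prod.cong refl)
      fix v assume v: "v \<in> V"
      have "{\<omega>\<in>space M. Y v \<omega>} \<in> sets M"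
        using meas[OF v] by measurable
      from prob_compl[OF this] q[OF v] have "prob (space M - {\<omega>\<in>space M. Y v \<omega>}) = 1 - q"
        by simp
      moreover have "space M - {\<omega>\<in>space M. Y v \<omega>} = Y v -` {False} \<inter> space M"
        "{\<omega>\<in>space M. Y v \<omega>} = Y v -` {True} \<inter> space M" by auto
      ultimately show "prob (Y v -` {v \<in> S} \<inter> space M) = (if v \<in> S then q else 1 - q)"
        using q[OF v] by auto
    qed
    finally show ?thesis .
  qed
  have F_eq: "F {v\<in>V. Y v \<omega>} = (\<Sum>S\<in>Pow V. indicator (E S) \<omega> *\<^sub>R F S)" if "\<omega> \<in> space M" for \<omega>
  proof -
    have "(\<Sum>S\<in>Pow V. indicator (E S) \<omega> *\<^sub>R F S) = (\<Sum>S\<in>{{v\<in>V. Y v \<omega>}}. F S)"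
      using fin that by (intro sum.mono_neutral_cong_right) (auto simp: E_def indicator_def)
    then show ?thesis by simp
  qed
  show "(\<lambda>\<omega>. F {v\<in>V. Y v \<omega>}) \<in> borel_measurable M"
    by (subst measurable_cong[OF F_eq]) (auto intro!: borel_measurable_sum borel_measurable_scaleR borel_measurable_indicator E)
  have "(LINT \<omega>|M. F {v\<in>V. Y v \<omega>}) = (LINT \<omega>|M. (\<Sum>S\<in>Pow V. indicator (E S) \<omega> *\<^sub>R F S))"
    by (intro Bochner_Integration.integral_cong refl F_eq)
  also have "\<dots> = (\<Sum>S\<in>Pow V. (LINT \<omega>|M. indicator (E S) \<omega> *\<^sub>R F S))"
    using E by (intro Bochner_Integration.integral_sum integrable_scaleR_left) (auto simp: emeasure_eq_measure)
  also have "\<dots> = (\<Sum>S\<in>Pow V. of_real (bern_weight q V S) * F S)"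
    using E prob_E by (intro sum.cong refl) (auto simp: scaleR_conv_of_real emeasure_eq_measure)
  finally show "(LINT \<omega>|M. F {v\<in>V. Y v \<omega>}) = (\<Sum>S\<in>Pow V. of_real (bern_weight q V S) * F S)" .
qed

section \<open>Block averages and greedy refinement\<close>

definition label_class :: "'v set \<Rightarrow> ('v \<Rightarrow> nat) \<Rightarrow> nat \<Rightarrow> 'v set" where
  "label_class V l c = {v \<in> V. l v = c}"

text \<open>An empty class gives 0 / 0 = 0, so the values stay in [0, 1] for all labels, whether or
  not they occur.\<close>

definition block_density :: "'v set \<Rightarrow> ('v \<Rightarrow> 'v \<Rightarrow> real) \<Rightarrow> ('v \<Rightarrow> nat) \<Rightarrow> nat \<Rightarrow> nat \<Rightarrow> real" where
  "block_density V A l c d = (\<Sum>u\<in>label_class V l c. \<Sum>v\<in>label_class V l d. A u v)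
     / (real (card (label_class V l c)) * real (card (label_class V l d)))"

text \<open>The squared l2 norm of the matrix obtained from \<open>A\<close> by block
  averaging.\<close>

definition energy :: "'v set \<Rightarrow> ('v \<Rightarrow> 'v \<Rightarrow> real) \<Rightarrow> ('v \<Rightarrow> nat) \<Rightarrow> real" where
  "energy V A l = (\<Sum>u\<in>V. \<Sum>v\<in>V. (block_density V A l (l u) (l v))\<^sup>2)"

definition set_sign :: "'v set \<Rightarrow> 'v \<Rightarrow> real" where
  "set_sign S v = (if v \<in> S then 1 else - 1)"

definition sign_form :: "'v set \<Rightarrow> ('v \<Rightarrow> 'v \<Rightarrow> real) \<Rightarrow> 'v set \<times> 'v set \<Rightarrow> real" where
  "sign_form V B = (\<lambda>(S, T). \<bar>\<Sum>u\<in>V. \<Sum>v\<in>V. B u v * set_sign S u * set_sign T v\<bar>)"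

text \<open>Sets encode sign vectors, which makes the competition finite, so that a maximiser
  exists. The chosen pair is only required to beat all pairs of subsets of \<open>V\<close>.\<close>

definition best_signs :: "'v set \<Rightarrow> ('v \<Rightarrow> 'v \<Rightarrow> real) \<Rightarrow> 'v set \<times> 'v set" where
  "best_signs V B = (SOME p. \<forall>p'\<in>Pow V \<times> Pow V. sign_form V B p' \<le> sign_form V B p)"

text \<open>Each step appends two binary digits, which record the sides of the best cut on which a
  vertex lies. With base 4 the coarser labels are quotients by powers of 4, and level
  \<open>m\<close> has at most 4^m labels, whatever the graph.\<close>

primrec greedy_label :: "'v set \<Rightarrow> ('v \<Rightarrow> 'v \<Rightarrow> real) \<Rightarrow> nat \<Rightarrow> 'v \<Rightarrow> nat" where
  "greedy_label V A 0 = (\<lambda>_. 0)"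
| "greedy_label V A (Suc m) =
     (let p = best_signs V (\<lambda>u v. A u v - block_density V A (greedy_label V A m) (greedy_label V A m u) (greedy_label V A m v))
      in (\<lambda>v. 4 * greedy_label V A m v + 2 * of_bool (v \<in> fst p) + of_bool (v \<in> snd p)))"

lemma finite_label_class [simp]: "finite V \<Longrightarrow> finite (label_class V l c)"
  by (simp add: label_class_def)

lemma block_density_bounds:
  assumes "finite V" and A: "\<And>u v. u \<in> V \<Longrightarrow> v \<in> V \<Longrightarrow> 0 \<le> A u v \<and> A u v \<le> 1"
  shows "0 \<le> block_density V A l c d" "block_density V A l c d \<le> 1"
proof -
  let ?C = "label_class V l c" and ?D = "label_class V l d"
  have A': "0 \<le> A u v" "A u v \<le> 1" if "u \<in> ?C" "v \<in> ?D" for u v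
    using that A by (auto simp: label_class_def)
  show "0 \<le> block_density V A l c d"
    unfolding block_density_def using A' by (intro divide_nonneg_nonneg sum_nonneg mult_nonneg_nonneg) auto
  have "(\<Sum>u\<in>?C. \<Sum>v\<in>?D. A u v) \<le> (\<Sum>u\<in>?C. \<Sum>v\<in>?D. 1)"
    using A' by (intro sum_mono) auto
  then show "block_density V A l c d \<le> 1"
    unfolding block_density_def by (cases "card ?C = 0 \<or> card ?D = 0") (auto simp: divide_le_eq_1)
qed

lemma block_density_sym:
  assumes "\<And>u v. u \<in> V \<Longrightarrow> v \<in> V \<Longrightarrow> A u v = A v u"
  shows "block_density V A l c d = block_density V A l d c"
proof -
  have "(\<Sum>u\<in>label_class V l c. \<Sum>v\<in>label_class V l d. A u v)
      = (\<Sum>v\<in>label_class V l d. \<Sum>u\<in>label_class V l c. A v u)"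
    by (subst sum.swap) (intro sum.cong refl assms, auto simp: label_class_def)
  then show ?thesis
    unfolding block_density_def by (simp add: mult.commute)
qed

lemma sum_label_classes:
  assumes "finite V"
  shows "(\<Sum>u\<in>V. f u) = (\<Sum>c\<in>l ` V. \<Sum>u\<in>label_class V l c. f u)"
  unfolding label_class_def by (rule sum.image_gen[OF assms])

text \<open>Block averaging is the orthogonal projection onto functions of the two labels, so
  \<open>A\<close> and its averages have the same sums against such functions.\<close>

lemma sum_block_density:
  assumes fin: "finite V"
  shows "(\<Sum>u\<in>V. \<Sum>v\<in>V. block_density V A l (l u) (l v) * g (l u) (l v)) = (\<Sum>u\<in>V. \<Sum>v\<in>V. A u v * g (l u) (l v))"
proof -
  have split: "(\<Sum>u\<in>V. \<Sum>v\<in>V. h u v)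
      = (\<Sum>c\<in>l ` V. \<Sum>d\<in>l ` V. \<Sum>u\<in>label_class V l c. \<Sum>v\<in>label_class V l d. h u v)" for h :: "_ \<Rightarrow> _ \<Rightarrow> real"
    unfolding sum_label_classes[OF fin, of _ l] by (intro sum.cong refl sum.swap)
  show ?thesis
    unfolding split
  proof (rule sum.cong[OF refl], rule sum.cong[OF refl])
    fix c d assume c: "c \<in> l ` V" and d: "d \<in> l ` V"
    let ?C = "label_class V l c" and ?D = "label_class V l d"
    have pos: "card ?C \<noteq> 0" "card ?D \<noteq> 0"
      using c d fin by (auto simp: label_class_def)
    have "(\<Sum>u\<in>?C. \<Sum>v\<in>?D. block_density V A l (l u) (l v) * g (l u) (l v)) = (\<Sum>u\<in>?C. \<Sum>v\<in>?D. block_density V A l c d * g c d)"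
      by (intro sum.cong refl) (auto simp: label_class_def)
    also have "\<dots> = (\<Sum>u\<in>?C. \<Sum>v\<in>?D. A u v) * g c d"
      using pos by (simp add: block_density_def)
    also have "\<dots> = (\<Sum>u\<in>?C. \<Sum>v\<in>?D. A u v * g (l u) (l v))"
      unfolding sum_distrib_right by (intro sum.cong refl) (auto simp: label_class_def)
    finally show "(\<Sum>u\<in>?C. \<Sum>v\<in>?D. block_density V A l (l u) (l v) * g (l u) (l v)) = \<dots>" .
  qed
qed

text \<open>Pythagoras for two nested projections: the inner product of the finer and the coarser
  average is the energy of the coarser one.\<close>

lemma sum_block_density_diff_squared:
  assumes fin: "finite V" and coarser: "\<And>v. v \<in> V \<Longrightarrow> l v = h (l' v)"
  shows "(\<Sum>u\<in>V. \<Sum>v\<in>V. (block_density V A l' (l' u) (l' v) - block_density V A l (l u) (l v))\<^sup>2)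
     = energy V A l' - energy V A l"
proof -
  let ?d = "block_density V A l" and ?d' = "block_density V A l'"
  have "(\<Sum>u\<in>V. \<Sum>v\<in>V. ?d' (l' u) (l' v) * ?d (l u) (l v))
      = (\<Sum>u\<in>V. \<Sum>v\<in>V. ?d' (l' u) (l' v) * ?d (h (l' u)) (h (l' v)))"
    using coarser by (intro sum.cong refl) auto
  also have "\<dots> = (\<Sum>u\<in>V. \<Sum>v\<in>V. A u v * ?d (h (l' u)) (h (l' v)))"
    by (rule sum_block_density[OF fin, of A l' "\<lambda>x y. ?d (h x) (h y)"])
  also have "\<dots> = (\<Sum>u\<in>V. \<Sum>v\<in>V. A u v * ?d (l u) (l v))"
    using coarser by (intro sum.cong refl) auto
  also have "\<dots> = energy V A l"
    unfolding energy_def power2_eq_square by (rule sum_block_density[OF fin, symmetric])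
  finally have "(\<Sum>u\<in>V. \<Sum>v\<in>V. ?d' (l' u) (l' v) * ?d (l u) (l v)) = energy V A l" .
  then show ?thesis
    unfolding power2_diff energy_def
    by (simp add: sum.distrib sum_subtractf mult.assoc sum_distrib_left[symmetric])
qed

lemma sum_abs_le_sqrt_sum_squares:
  fixes h :: "'v \<Rightarrow> 'v \<Rightarrow> real"
  assumes "finite V"
  shows "(\<Sum>u\<in>V. \<Sum>v\<in>V. \<bar>h u v\<bar>) \<le> real (card V) * sqrt (\<Sum>u\<in>V. \<Sum>v\<in>V. (h u v)\<^sup>2)"
proof -
  have "(\<Sum>p\<in>V \<times> V. \<bar>h (fst p) (snd p)\<bar>)\<^sup>2 \<le> real (card (V \<times> V)) * (\<Sum>p\<in>V \<times> V. \<bar>h (fst p) (snd p)\<bar>\<^sup>2)"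
    using sum_squared_le_sum_of_squares[of "\<lambda>p. \<bar>h (fst p) (snd p)\<bar>" "V \<times> V"] by (simp only: mult.commute)
  then have "(\<Sum>u\<in>V. \<Sum>v\<in>V. \<bar>h u v\<bar>)\<^sup>2 \<le> (real (card V))\<^sup>2 * (\<Sum>u\<in>V. \<Sum>v\<in>V. (h u v)\<^sup>2)"
    unfolding sum.cartesian_product by (simp add: case_prod_beta card_cartesian_product power2_eq_square)
  then have "sqrt ((\<Sum>u\<in>V. \<Sum>v\<in>V. \<bar>h u v\<bar>)\<^sup>2) \<le> sqrt ((real (card V))\<^sup>2 * (\<Sum>u\<in>V. \<Sum>v\<in>V. (h u v)\<^sup>2))"
    by (rule real_sqrt_le_mono)
  then show ?thesis
    by (simp add: real_sqrt_mult sum_nonneg)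
qed

lemma sum_abs_block_density_diff_le:
  assumes fin: "finite V" and coarser: "\<And>v. v \<in> V \<Longrightarrow> l v = h (l' v)"
  shows "(\<Sum>u\<in>V. \<Sum>v\<in>V. \<bar>block_density V A l' (l' u) (l' v) - block_density V A l (l u) (l v)\<bar>)
     \<le> real (card V) * sqrt (energy V A l' - energy V A l)"
proof -
  have "(\<Sum>u\<in>V. \<Sum>v\<in>V. (block_density V A l' (l' u) (l' v) - block_density V A l (l u) (l v))\<^sup>2)
      = energy V A l' - energy V A l"
    by (rule sum_block_density_diff_squared[where h = h]) (use assms in auto)
  then show ?thesis
    using sum_abs_le_sqrt_sum_squares[OF fin, of "\<lambda>u v. block_density V A l' (l' u) (l' v) - block_density V A l (l u) (l v)"]
    by metis
qed

lemma energy_mono: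
  assumes "finite V" "\<And>v. v \<in> V \<Longrightarrow> l v = h (l' v)"
  shows "energy V A l \<le> energy V A l'"
proof -
  have "(\<Sum>u\<in>V. \<Sum>v\<in>V. (block_density V A l' (l' u) (l' v) - block_density V A l (l u) (l v))\<^sup>2)
      = energy V A l' - energy V A l"
    by (rule sum_block_density_diff_squared[where h = h]) (use assms in auto)
  moreover have "0 \<le> (\<Sum>u\<in>V. \<Sum>v\<in>V. (block_density V A l' (l' u) (l' v) - block_density V A l (l u) (l v))\<^sup>2)"
    by (intro sum_nonneg) auto
  ultimately show ?thesis by simp
qed

lemma energy_nonneg: "0 \<le> energy V A l"
  unfolding energy_def by (intro sum_nonneg) auto

lemma energy_le:
  assumes "finite V" and A: "\<And>u v. u \<in> V \<Longrightarrow> v \<in> V \<Longrightarrow> 0 \<le> A u v \<and> A u v \<le> 1"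
  shows "energy V A l \<le> (real (card V))\<^sup>2"
proof -
  have "energy V A l \<le> (\<Sum>u\<in>V. \<Sum>v\<in>V. 1)"
    unfolding energy_def using block_density_bounds[of V A, OF assms] by (intro sum_mono power_le_one) auto
  then show ?thesis by (simp add: power2_eq_square)
qed

text \<open>For fixed \<open>g\<close> the form is linear in \<open>f\<close>, hence largest when
  \<open>f\<close> consists of the signs of its coefficients; then the same is done for
  \<open>g\<close>.\<close>

lemma bilinear_form_le_signs:
  fixes B :: "'v \<Rightarrow> 'v \<Rightarrow> real"
  assumes "\<And>v. v \<in> V \<Longrightarrow> \<bar>f v\<bar> \<le> 1" "\<And>v. v \<in> V \<Longrightarrow> \<bar>g v\<bar> \<le> 1"
  obtains S T where "S \<subseteq> V" "T \<subseteq> V" "\<bar>\<Sum>u\<in>V. \<Sum>v\<in>V. B u v * f u * g v\<bar> \<le> sign_form V B (S, T)"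
proof -
  have row: "\<bar>\<Sum>u\<in>V. a u * x u\<bar> \<le> (\<Sum>u\<in>V. a u * set_sign {u\<in>V. 0 \<le> a u} u)"
    if "\<And>v. v \<in> V \<Longrightarrow> \<bar>x v\<bar> \<le> 1" for a x :: "'v \<Rightarrow> real"
  proof (intro order.trans[OF sum_abs] sum_mono)
    fix u assume "u \<in> V"
    then show "\<bar>a u * x u\<bar> \<le> a u * set_sign {u\<in>V. 0 \<le> a u} u"
      using mult_left_mono[OF that, of u "\<bar>a u\<bar>"] by (auto simp: set_sign_def abs_mult)
  qed
  define S where "S = {u\<in>V. 0 \<le> (\<Sum>v\<in>V. B u v * g v)}"
  define T where "T = {v\<in>V. 0 \<le> (\<Sum>u\<in>V. B u v * set_sign S u)}"
  have "\<bar>\<Sum>u\<in>V. \<Sum>v\<in>V. B u v * f u * g v\<bar> = \<bar>\<Sum>u\<in>V. (\<Sum>v\<in>V. B u v * g v) * f u\<bar>"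
    unfolding sum_distrib_right by (simp add: mult_ac)
  also have "\<dots> \<le> (\<Sum>u\<in>V. (\<Sum>v\<in>V. B u v * g v) * set_sign S u)"
    unfolding S_def by (rule row[OF assms(1)])
  also have "\<dots> = (\<Sum>v\<in>V. (\<Sum>u\<in>V. B u v * set_sign S u) * g v)"
    unfolding sum_distrib_right by (subst sum.swap) (simp add: mult_ac)
  also have "\<dots> \<le> \<bar>\<Sum>v\<in>V. (\<Sum>u\<in>V. B u v * set_sign S u) * g v\<bar>"
    by simp
  also have "\<dots> \<le> (\<Sum>v\<in>V. (\<Sum>u\<in>V. B u v * set_sign S u) * set_sign T v)"
    unfolding T_def by (rule row[OF assms(2)])
  also have "\<dots> = (\<Sum>u\<in>V. \<Sum>v\<in>V. B u v * set_sign S u * set_sign T v)"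
    unfolding sum_distrib_right by (rule sum.swap)
  also have "\<dots> \<le> sign_form V B (S, T)"
    by (simp add: sign_form_def)
  finally show ?thesis
    by (intro that[of S T]) (auto simp: S_def T_def)
qed

lemma best_signs_max:
  assumes fin: "finite V" and "S \<subseteq> V" "T \<subseteq> V"
  shows "sign_form V B (S, T) \<le> sign_form V B (best_signs V B)"
proof -
  let ?P = "Pow V \<times> Pow V"
  have fin': "finite (sign_form V B ` ?P)" "sign_form V B ` ?P \<noteq> {}" using fin by auto
  from Max_in[OF this] obtain p where "sign_form V B p = Max (sign_form V B ` ?P)" by auto
  then have "\<forall>p'\<in>?P. sign_form V B p' \<le> sign_form V B p"
    using Max_ge[OF fin'(1)] by auto
  then have "\<forall>p'\<in>?P. sign_form V B p' \<le> sign_form V B (best_signs V B)"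
    unfolding best_signs_def by (rule someI)
  then show ?thesis
    using assms by auto
qed

lemma greedy_label_div:
  "greedy_label V A m v = greedy_label V A (m + k) v div 4 ^ k"
proof (induction k)
  case (Suc k)
  have "greedy_label V A (m + Suc k) v div 4 = greedy_label V A (m + k) v"
    by (auto simp: Let_def of_bool_def)
  then show ?case using Suc by (simp add: div_mult2_eq)
qed simp

lemma greedy_label_less: "greedy_label V A m v < 4 ^ m"
proof (induction m)
  case (Suc m)
  then have "greedy_label V A m v + 1 \<le> 4 ^ m" by simp
  then show ?case by (auto simp: Let_def of_bool_def)
qed simp

text \<open>The sign vectors of the best cut are functions of the next label, so against them
  \<open>A\<close> may be replaced by its next block average. What remains is a difference of nested
  averages, bounded by Cauchy-Schwarz and Pythagoras.\<close>

lemma greedy_label_cut: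
  fixes A :: "'v \<Rightarrow> 'v \<Rightarrow> real"
  assumes fin: "finite V"
    and f: "\<And>v. v \<in> V \<Longrightarrow> \<bar>f v\<bar> \<le> 1" and g: "\<And>v. v \<in> V \<Longrightarrow> \<bar>g v\<bar> \<le> 1"
  defines "l \<equiv> greedy_label V A"
  shows "\<bar>\<Sum>u\<in>V. \<Sum>v\<in>V. (A u v - block_density V A (l m) (l m u) (l m v)) * f u * g v\<bar>
     \<le> real (card V) * sqrt (energy V A (l (Suc m)) - energy V A (l m))"
proof -
  define B where "B u v = A u v - block_density V A (l m) (l m u) (l m v)" for u v
  define S where "S = fst (best_signs V B)"
  define T where "T = snd (best_signs V B)"
  let ?l = "l (Suc m)"
  \<comment> \<open>\<open>s\<close> and \<open>t\<close> read the two binary digits that the step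
    has appended to the label.\<close>
  define s where "s c = (if (c div 2) mod 2 = 1 then 1 else -1 :: real)" for c :: nat
  define t where "t c = (if c mod 2 = 1 then 1 else -1 :: real)" for c :: nat
  have l_Suc: "?l v = 4 * l m v + 2 * of_bool (v \<in> S) + of_bool (v \<in> T)" for v
    unfolding l_def S_def T_def B_def by (simp add: Let_def)
  have s: "set_sign S v = s (?l v)" and t: "set_sign T v = t (?l v)" for v
  proof -
    have "?l v div 2 = 2 * l m v + of_bool (v \<in> S)"
      unfolding l_Suc by (auto simp: of_bool_def)
    then show "set_sign S v = s (?l v)"
      by (auto simp: set_sign_def s_def of_bool_def)
    show "set_sign T v = t (?l v)"
      unfolding l_Suc by (auto simp: set_sign_def t_def of_bool_def) presburger+
  qed
  have m_of_Suc: "l m v = ?l v div 4" for v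
    using greedy_label_div[of V A m v 1] by (simp add: l_def)
  obtain S' T' where ST: "S' \<subseteq> V" "T' \<subseteq> V" "\<bar>\<Sum>u\<in>V. \<Sum>v\<in>V. B u v * f u * g v\<bar> \<le> sign_form V B (S', T')"
    using bilinear_form_le_signs[of V f g B] f g by blast
  note ST(3)
  also have "sign_form V B (S', T') \<le> sign_form V B (best_signs V B)"
    using best_signs_max[OF fin ST(1,2)] .
  also have "\<dots> = \<bar>\<Sum>u\<in>V. \<Sum>v\<in>V. B u v * s (?l u) * t (?l v)\<bar>"
    unfolding sign_form_def S_def[symmetric] T_def[symmetric] case_prod_beta s t ..
  also have "(\<Sum>u\<in>V. \<Sum>v\<in>V. B u v * s (?l u) * t (?l v)) =
      (\<Sum>u\<in>V. \<Sum>v\<in>V. (block_density V A ?l (?l u) (?l v) - block_density V A (l m) (l m u) (l m v)) * s (?l u) * t (?l v))"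
    using sum_block_density[OF fin, of A ?l "\<lambda>c d. s c * t d"]
    by (simp add: B_def left_diff_distrib sum_subtractf mult.assoc)
  also have "\<bar>\<dots>\<bar> \<le> (\<Sum>u\<in>V. \<Sum>v\<in>V. \<bar>block_density V A ?l (?l u) (?l v) - block_density V A (l m) (l m u) (l m v)\<bar>)"
    by (intro order.trans[OF sum_abs] sum_mono) (auto simp: abs_mult s_def t_def)
  also have "\<dots> \<le> real (card V) * sqrt (energy V A ?l - energy V A (l m))"
    using m_of_Suc by (intro sum_abs_block_density_diff_le[where h = "\<lambda>c. c div 4"] fin) auto
  finally show ?thesis unfolding B_def .
qed

section \<open>Sorting the vertices\<close>

definition key_rank :: "'v set \<Rightarrow> ('v \<Rightarrow> nat) \<Rightarrow> 'v \<Rightarrow> nat" where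
  "key_rank V k v = card {u \<in> V. k u \<le> k v}"

lemma bij_betw_key_rank:
  assumes fin: "finite V" and inj: "inj_on k V"
  shows "bij_betw (key_rank V k) V {1..card V}"
proof -
  have less: "key_rank V k u < key_rank V k v" if "u \<in> V" "v \<in> V" "k u < k v" for u v
  proof -
    have "{w \<in> V. k w \<le> k u} \<subset> {w \<in> V. k w \<le> k v}"
      using that by force
    then show ?thesis unfolding key_rank_def using fin by (intro psubset_card_mono) auto
  qed
  have inj': "inj_on (key_rank V k) V"
    using less inj by (intro inj_onI) (metis inj_on_def less_irrefl linorder_neqE_nat)
  have "key_rank V k ` V \<subseteq> {1..card V}"
    using fin by (auto simp: key_rank_def Suc_le_eq card_gt_0_iff intro!: card_mono)
  then have "key_rank V k ` V = {1..card V}"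
    using inj' by (intro card_subset_eq) (auto simp: card_image)
  with inj' show ?thesis by (simp add: bij_betw_def)
qed

text \<open>Vertices with a smaller label precede \<open>v\<close> and those with a larger one
  follow it, so the ranks belonging to one label fill an interval.\<close>

lemma key_rank_between:
  assumes fin: "finite V" and v: "v \<in> V"
    and mono: "\<And>u w. u \<in> V \<Longrightarrow> w \<in> V \<Longrightarrow> l u < l w \<Longrightarrow> k u < k w"
  shows "card {u \<in> V. l u < l v} < key_rank V k v" "key_rank V k v \<le> card {u \<in> V. l u < Suc (l v)}"
proof -
  show "card {u \<in> V. l u < l v} < key_rank V k v"
    unfolding key_rank_def
  proof (intro psubset_card_mono)
    show "{u \<in> V. l u < l v} \<subset> {u \<in> V. k u \<le> k v}"
      using mono v by (auto intro: less_imp_le)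
  qed (use fin in auto)
  show "key_rank V k v \<le> card {u \<in> V. l u < Suc (l v)}"
    unfolding key_rank_def using fin mono v by (intro card_mono) (auto simp: less_Suc_eq_le not_le[symmetric])
qed

section \<open>Averages over the cells of a square grid\<close>

text \<open>Open on the left, so that the ceiling of x / \<open>p\<close> is \<open>u\<close>
  exactly on this cell; this is the rounding of \<open>graph_kernel\<close>. Vertices have the
  indices from 1 on.\<close>

definition cell :: "real \<Rightarrow> nat \<Rightarrow> real set" where
  "cell p u = {(real u - 1) * p<..real u * p}"

definition step_fn :: "('v \<Rightarrow> real set) \<Rightarrow> 'v set \<Rightarrow> ('v \<Rightarrow> 'v \<Rightarrow> real) \<Rightarrow> real \<times> real \<Rightarrow> real" where
  "step_fn I V c z = (\<Sum>u\<in>V. \<Sum>v\<in>V. c u v * indicator (I u \<times> I v) z)"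

definition same_cell :: "real \<Rightarrow> real \<times> real \<Rightarrow> real \<times> real \<Rightarrow> bool" where
  "same_cell p z w \<longleftrightarrow> \<lceil>fst z / p\<rceil> = \<lceil>fst w / p\<rceil> \<and> \<lceil>snd z / p\<rceil> = \<lceil>snd w / p\<rceil>"

text \<open>Averaging is written as an integral operator whose symmetric kernel has integral 1 in
  each variable. Bounds in L1 and in the supremum then follow as for any doubly stochastic
  kernel.\<close>

definition grid_kernel :: "real \<Rightarrow> real \<times> real \<Rightarrow> real \<times> real \<Rightarrow> real" where
  "grid_kernel p z w = of_bool (same_cell p z w) / p\<^sup>2"

definition grid_avg :: "real \<Rightarrow> (real \<times> real \<Rightarrow> real) \<Rightarrow> real \<times> real \<Rightarrow> real" where
  "grid_avg p h z = (LINT w|lborel. grid_kernel p z w * h w)"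

definition cell_avg :: "real \<Rightarrow> (real \<times> real \<Rightarrow> real) \<Rightarrow> nat \<Rightarrow> nat \<Rightarrow> real" where
  "cell_avg p h u v = (LINT w|lborel. indicator (cell p u \<times> cell p v) w * h w) / p\<^sup>2"

lemma tendsto_0_le_real:
  fixes f g :: "nat \<Rightarrow> real"
  assumes "\<And>n. 0 \<le> f n" "\<And>n. f n \<le> g n" "g \<longlonglongrightarrow> 0"
  shows "f \<longlonglongrightarrow> 0"
  by (rule tendsto_sandwich[OF _ _ tendsto_const assms(3)]) (simp_all add: assms)

section \<open>Grid averages as L1 contractions and their convergence\<close>

lemma ceiling_div_eq_iff:
  assumes "0 < p"
  shows "\<lceil>x / p\<rceil> = k \<longleftrightarrow> x \<in> {(of_int k - 1) * p<..of_int k * p}"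
  using assms by (auto simp: ceiling_eq_iff field_simps)

lemma same_cell_commute: "same_cell p z w = same_cell p w z"
  by (auto simp: same_cell_def)

lemma grid_kernel_nonneg [simp]: "0 \<le> grid_kernel p z w"
  by (simp add: grid_kernel_def)

lemma measurable_same_cell [measurable]:
  "Measurable.pred (borel \<Otimes>\<^sub>M borel) (\<lambda>x. same_cell p (fst x) (snd x))"
  unfolding same_cell_def borel_prod[symmetric] by measurable

lemma measurable_grid_kernel [measurable]:
  "(\<lambda>x. grid_kernel p (fst x) (snd x)) \<in> borel_measurable (borel \<Otimes>\<^sub>M borel)"
  unfolding grid_kernel_def by measurable

lemma measurable_grid_kernel' [measurable]: "grid_kernel p z \<in> borel_measurable borel"
proof -
  have "(\<lambda>w. (z, w)) \<in> measurable borel (borel \<Otimes>\<^sub>M borel)" by measurable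
  from measurable_compose[OF this measurable_grid_kernel] show ?thesis by simp
qed

lemma grid_kernel_commute: "grid_kernel p z w = grid_kernel p w z"
  by (simp add: grid_kernel_def same_cell_commute)

lemma same_cell_set:
  assumes "0 < p"
  shows "{w. same_cell p z w} =
    {(of_int \<lceil>fst z / p\<rceil> - 1) * p<..of_int \<lceil>fst z / p\<rceil> * p} \<times> {(of_int \<lceil>snd z / p\<rceil> - 1) * p<..of_int \<lceil>snd z / p\<rceil> * p}"
  unfolding same_cell_def using ceiling_div_eq_iff[OF assms] by (force simp: eq_commute[of "\<lceil>_\<rceil>"])

lemma emeasure_lborel_Times:
  fixes A B :: "real set"
  assumes [measurable]: "A \<in> sets borel" "B \<in> sets borel"
  shows "emeasure lborel (A \<times> B) = emeasure lborel A * emeasure lborel B"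
  unfolding lborel_prod[symmetric] by (intro lborel.emeasure_pair_measure_Times) auto

lemma nn_integral_grid_kernel:
  assumes "0 < p"
  shows "(\<integral>\<^sup>+w. ennreal (grid_kernel p z w) \<partial>lborel) = 1"
    and "(\<integral>\<^sup>+w. ennreal (grid_kernel p w z) \<partial>lborel) = 1"
proof -
  let ?S = "{w. same_cell p z w}"
  have S: "?S \<in> sets borel" unfolding same_cell_set[OF assms] borel_prod[symmetric] by measurable
  have eq: "ennreal (grid_kernel p z w) = ennreal (1 / p\<^sup>2) * indicator ?S w" for w
    by (auto simp: grid_kernel_def)
  have "(\<integral>\<^sup>+w. ennreal (grid_kernel p z w) \<partial>lborel) = ennreal (1 / p\<^sup>2) * emeasure lborel ?S"
    unfolding eq using S by (subst nn_integral_cmult_indicator) auto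
  also have "emeasure lborel ?S = ennreal p * ennreal p"
    unfolding same_cell_set[OF assms] using assms
    by (subst emeasure_lborel_Times) (auto simp: algebra_simps)
  also have "ennreal (1 / p\<^sup>2) * (ennreal p * ennreal p) = 1"
    using assms by (simp add: ennreal_mult[symmetric] power2_eq_square)
  finally show 1: "(\<integral>\<^sup>+w. ennreal (grid_kernel p z w) \<partial>lborel) = 1" .
  then show "(\<integral>\<^sup>+w. ennreal (grid_kernel p w z) \<partial>lborel) = 1"
    unfolding grid_kernel_commute[of p _ z] .
qed

lemma integrable_grid_kernel_mult:
  fixes h :: "real \<times> real \<Rightarrow> real"
  assumes p: "0 < p" and h: "integrable lborel h"
  shows "integrable lborel (\<lambda>w. grid_kernel p z w * h w)"
proof (rule Bochner_Integration.integrable_bound)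
  show "integrable lborel (\<lambda>w. (1 / p\<^sup>2) * h w)" using h by simp
  have [measurable]: "h \<in> borel_measurable borel" using h by auto
  show "(\<lambda>w. grid_kernel p z w * h w) \<in> borel_measurable lborel" by measurable
  show "AE w in lborel. norm (grid_kernel p z w * h w) \<le> norm (1 / p\<^sup>2 * h w)"
    by (auto simp: grid_kernel_def)
qed

text \<open>By Tonelli, since the kernel has integral 1 in its first variable, averaging does not
  increase the L1 norm.\<close>

lemma grid_avg_integrable:
  fixes h :: "real \<times> real \<Rightarrow> real"
  assumes p: "0 < p" and h: "integrable lborel h"
  shows "integrable lborel (grid_avg p h)"
    and "(LINT z|lborel. \<bar>grid_avg p h z\<bar>) \<le> (LINT z|lborel. \<bar>h z\<bar>)"
proof -
  have [measurable]: "h \<in> borel_measurable borel" using h by auto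
  have nn: "(\<integral>\<^sup>+z. \<integral>\<^sup>+w. ennreal \<bar>grid_kernel p z w * h w\<bar> \<partial>lborel \<partial>lborel) = (\<integral>\<^sup>+w. ennreal \<bar>h w\<bar> \<partial>lborel)"
  proof -
    have "(\<integral>\<^sup>+z. \<integral>\<^sup>+w. ennreal \<bar>grid_kernel p z w * h w\<bar> \<partial>lborel \<partial>lborel)
        = (\<integral>\<^sup>+w. \<integral>\<^sup>+z. ennreal \<bar>grid_kernel p z w * h w\<bar> \<partial>lborel \<partial>lborel)"
    proof (intro lborel_pair.Fubini')
      have "(\<lambda>x. ennreal \<bar>grid_kernel p (fst x) (snd x) * h (fst x)\<bar>) \<in> borel_measurable (borel \<Otimes>\<^sub>M borel)"
        by measurable
      moreover have "(\<lambda>(x, y). ennreal \<bar>grid_kernel p y x * h x\<bar>) = (\<lambda>x. ennreal \<bar>grid_kernel p (fst x) (snd x) * h (fst x)\<bar>)"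
        by (intro ext) (auto simp: grid_kernel_commute)
      ultimately show "(\<lambda>(x, y). ennreal \<bar>grid_kernel p y x * h x\<bar>) \<in> borel_measurable (lborel \<Otimes>\<^sub>M lborel)"
        by (simp cong: measurable_cong_sets)
    qed
    also have "\<dots> = (\<integral>\<^sup>+w. \<integral>\<^sup>+z. ennreal (grid_kernel p z w) * ennreal \<bar>h w\<bar> \<partial>lborel \<partial>lborel)"
      by (simp add: abs_mult ennreal_mult)
    also have "\<dots> = (\<integral>\<^sup>+w. ennreal \<bar>h w\<bar> \<partial>lborel)"
    proof (intro nn_integral_cong)
      fix w
      have m: "(\<lambda>z. ennreal (grid_kernel p z w)) \<in> borel_measurable lborel"
        unfolding grid_kernel_commute[of p _ w] by measurable
      show "(\<integral>\<^sup>+z. ennreal (grid_kernel p z w) * ennreal \<bar>h w\<bar> \<partial>lborel) = ennreal \<bar>h w\<bar>"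
        by (subst nn_integral_multc[OF m]) (simp add: nn_integral_grid_kernel[OF p])
    qed
    finally show ?thesis .
  qed
  have hfin: "(\<integral>\<^sup>+w. ennreal \<bar>h w\<bar> \<partial>lborel) < \<infinity>"
    using h by (simp add: integrable_iff_bounded)
  have int: "integrable (lborel \<Otimes>\<^sub>M lborel) (\<lambda>x. grid_kernel p (fst x) (snd x) * h (snd x))"
  proof (rule integrableI_bounded)
    have "(\<integral>\<^sup>+x. ennreal (norm (grid_kernel p (fst x) (snd x) * h (snd x))) \<partial>(lborel \<Otimes>\<^sub>M lborel))
        = (\<integral>\<^sup>+z. \<integral>\<^sup>+w. ennreal \<bar>grid_kernel p z w * h w\<bar> \<partial>lborel \<partial>lborel)"
      by (subst lborel.nn_integral_fst[symmetric]) auto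
    with nn hfin show "(\<integral>\<^sup>+x. ennreal (norm (grid_kernel p (fst x) (snd x) * h (snd x))) \<partial>(lborel \<Otimes>\<^sub>M lborel)) < \<infinity>"
      by simp
  qed measurable
  have "integrable lborel (\<lambda>z. LINT w|lborel. grid_kernel p (fst (z, w)) (snd (z, w)) * h (snd (z, w)))"
    using int by (rule lborel_pair.integrable_fst')
  then show ig: "integrable lborel (grid_avg p h)"
    by (simp add: grid_avg_def[abs_def])
  have "ennreal (LINT z|lborel. \<bar>grid_avg p h z\<bar>) = (\<integral>\<^sup>+z. ennreal \<bar>grid_avg p h z\<bar> \<partial>lborel)"
    using ig by (intro nn_integral_eq_integral[symmetric]) auto
  also have "\<dots> \<le> (\<integral>\<^sup>+z. \<integral>\<^sup>+w. ennreal \<bar>grid_kernel p z w * h w\<bar> \<partial>lborel \<partial>lborel)"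
    unfolding grid_avg_def
    using integral_norm_bound_ennreal[OF integrable_grid_kernel_mult[OF p h]] by (intro nn_integral_mono) simp
  also have "\<dots> = ennreal (LINT z|lborel. \<bar>h z\<bar>)"
    unfolding nn using h by (intro nn_integral_eq_integral) auto
  finally show "(LINT z|lborel. \<bar>grid_avg p h z\<bar>) \<le> (LINT z|lborel. \<bar>h z\<bar>)"
    by (simp add: integral_nonneg_AE)
qed

lemma grid_avg_add:
  assumes "0 < p" "integrable lborel f" "integrable lborel g"
  shows "grid_avg p (\<lambda>z. f z + g z) z = grid_avg p f z + grid_avg p g z"
  unfolding grid_avg_def using integrable_grid_kernel_mult[OF assms(1)] assms(2,3) by (simp add: distrib_left)

lemma grid_avg_cmult: "grid_avg p (\<lambda>z. c * f z) z = c * grid_avg p f z"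
  unfolding grid_avg_def by (simp add: mult.left_commute)

lemma integrable_grid_avg_diff:
  assumes "0 < p" "integrable lborel f"
  shows "integrable lborel (\<lambda>z. \<bar>grid_avg p f z - f z\<bar>)"
  using grid_avg_integrable(1)[OF assms] assms(2) by auto

text \<open>The difference \<open>f\<close> - \<open>g\<close> enters twice, once averaged and once
  as it is, and averaging contracts the L1 norm.\<close>

lemma grid_avg_approx_triangle:
  assumes p: "0 < p" and f: "integrable lborel f" and g: "integrable lborel g"
  shows "(LINT z|lborel. \<bar>grid_avg p f z - f z\<bar>)
     \<le> (LINT z|lborel. \<bar>grid_avg p g z - g z\<bar>) + 2 * (LINT z|lborel. \<bar>f z - g z\<bar>)"
proof -
  let ?d = "\<lambda>z. f z - g z"
  have d: "integrable lborel ?d" using f g by auto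
  have "(LINT z|lborel. \<bar>grid_avg p f z - f z\<bar>)
      \<le> (LINT z|lborel. \<bar>grid_avg p g z - g z\<bar> + (\<bar>grid_avg p ?d z\<bar> + \<bar>?d z\<bar>))"
  proof (intro integral_mono)
    fix z
    have "grid_avg p f z = grid_avg p g z + grid_avg p ?d z"
      using grid_avg_add[OF p g d, of z] by simp
    then show "\<bar>grid_avg p f z - f z\<bar> \<le> \<bar>grid_avg p g z - g z\<bar> + (\<bar>grid_avg p ?d z\<bar> + \<bar>?d z\<bar>)"
      by linarith
  qed (use integrable_grid_avg_diff grid_avg_integrable p f g d in auto)
  also have "\<dots> = (LINT z|lborel. \<bar>grid_avg p g z - g z\<bar>) + ((LINT z|lborel. \<bar>grid_avg p ?d z\<bar>) + (LINT z|lborel. \<bar>?d z\<bar>))"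
    using integrable_grid_avg_diff[OF p g] grid_avg_integrable(1)[OF p d] d by simp
  finally show ?thesis
    using grid_avg_integrable(2)[OF p d] by linarith
qed

lemma grid_avg_eventually_indicator_open:
  assumes U: "open U" "z \<in> U" and p: "\<And>n. 0 < p n" "p \<longlonglongrightarrow> 0"
  shows "\<forall>\<^sub>F n in sequentially. grid_avg (p n) (indicator U) z = 1"
proof -
  obtain e where e: "0 < e" "ball z e \<subseteq> U" using U open_contains_ball by blast
  \<comment> \<open>Points of one cell differ by less than \<open>p n\<close> in each coordinate,
    hence have distance less than 2 * \<open>p n\<close>.\<close>
  have "\<forall>\<^sub>F n in sequentially. p n < e / 2"
    using order_tendstoD(2)[OF p(2), of "e / 2"] e by simp
  then show ?thesis
  proof eventually_elim
    case (elim n)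
    have "w \<in> U" if "same_cell (p n) z w" for w
    proof -
      have "\<bar>x - y\<bar> < p n" if "\<lceil>x / p n\<rceil> = \<lceil>y / p n\<rceil>" for x y
      proof -
        have "\<bar>x / p n - y / p n\<bar> < 1" using that by linarith
        then have "\<bar>(x - y) / p n\<bar> < 1" by (simp add: diff_divide_distrib)
        then show ?thesis using p(1)[of n] by (simp add: abs_divide divide_less_eq)
      qed
      then have "\<bar>fst z - fst w\<bar> < p n" "\<bar>snd z - snd w\<bar> < p n"
        using that by (auto simp: same_cell_def)
      moreover have "dist z w \<le> \<bar>fst z - fst w\<bar> + \<bar>snd z - snd w\<bar>"
        by (simp add: dist_prod_def dist_real_def sqrt_sum_squares_le_sum_abs)
      ultimately have "dist z w < e" using elim by linarith
      then show ?thesis using e by auto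
    qed
    then have "grid_avg (p n) (indicator U) z = (LINT w|lborel. grid_kernel (p n) z w)"
      unfolding grid_avg_def by (intro Bochner_Integration.integral_cong) (auto simp: grid_kernel_def)
    also have "\<dots> = 1"
      using nn_integral_grid_kernel(1)[OF p(1), of n z] by (simp add: integral_eq_nn_integral)
    finally show ?case .
  qed
qed

lemma grid_avg_bounds:
  assumes p: "0 < p" and f: "f \<in> borel_measurable borel" "\<And>z. 0 \<le> f z" "\<And>z. f z \<le> b"
  shows "0 \<le> grid_avg p f z" "grid_avg p f z \<le> b"
proof -
  have K: "integrable lborel (grid_kernel p z)"
    using nn_integral_grid_kernel(1)[OF p, of z] by (intro integrableI_bounded) auto
  have K1: "(LINT w|lborel. grid_kernel p z w) = 1"
    using nn_integral_grid_kernel(1)[OF p, of z] by (simp add: integral_eq_nn_integral)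
  show "0 \<le> grid_avg p f z"
    unfolding grid_avg_def using f by (intro integral_nonneg_AE) auto
  have "0 \<le> b" using f(2,3) order.trans by blast
  have "integrable lborel (\<lambda>w. grid_kernel p z w * f w)"
  proof (rule Bochner_Integration.integrable_bound)
    show "integrable lborel (\<lambda>w. b * grid_kernel p z w)" using K by simp
    show "(\<lambda>w. grid_kernel p z w * f w) \<in> borel_measurable lborel" using f(1) by measurable
    have "norm (grid_kernel p z w * f w) \<le> norm (b * grid_kernel p z w)" for w
      using f(2,3)[of w] \<open>0 \<le> b\<close> by (simp add: abs_mult mult.commute mult_right_mono)
    then show "AE w in lborel. norm (grid_kernel p z w * f w) \<le> norm (b * grid_kernel p z w)" by simp
  qed
  then have "grid_avg p f z \<le> (LINT w|lborel. grid_kernel p z w * b)"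
    unfolding grid_avg_def using K f by (intro integral_mono mult_left_mono) auto
  then show "grid_avg p f z \<le> b" using K1 by simp
qed

lemma grid_avg_indicator_open_tendsto:
  assumes U: "open U" "emeasure lborel U < \<infinity>" and p: "\<And>n. 0 < p n" "p \<longlonglongrightarrow> 0"
  shows "(\<lambda>n. LINT z|lborel. \<bar>grid_avg (p n) (indicator U) z - indicator U z\<bar>) \<longlonglongrightarrow> 0"
proof -
  let ?i = "indicator U :: real \<times> real \<Rightarrow> real"
  have [measurable]: "U \<in> sets borel" using U by auto
  have i: "integrable lborel ?i" using U by (simp add: integrable_indicator_iff)
  let ?g = "\<lambda>n. grid_avg (p n) ?i"
  have g: "integrable lborel (?g n)" for n
    by (rule grid_avg_integrable(1)[OF p(1) i])
  have gm [measurable]: "?g n \<in> borel_measurable borel" for n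
    using g[of n] by auto
  have g01: "0 \<le> ?g n z" "?g n z \<le> 1" for n z
    using grid_avg_bounds[OF p(1), of ?i 1 n z] by (auto simp: indicator_def)
  have gU: "integrable lborel (\<lambda>z. ?i z * ?g n z)" for n
    using g[of n] by (intro Bochner_Integration.integrable_bound[OF g[of n]]) (auto simp: indicator_def)
  have lim: "(\<lambda>n. LINT z|lborel. ?i z * ?g n z) \<longlonglongrightarrow> (LINT z|lborel. ?i z)"
  proof (rule integral_dominated_convergence[where w = ?i])
    show "AE z in lborel. (\<lambda>n. ?i z * ?g n z) \<longlonglongrightarrow> ?i z"
    proof (intro AE_I2)
      fix z
      show "(\<lambda>n. ?i z * ?g n z) \<longlonglongrightarrow> ?i z"
      proof (cases "z \<in> U")
        case True
        have "\<forall>\<^sub>F n in sequentially. ?i z * ?g n z = ?i z"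
          using grid_avg_eventually_indicator_open[OF U(1) True p] by eventually_elim simp
        then show ?thesis by (rule tendsto_eventually)
      qed simp
    qed
    show "AE z in lborel. norm (?i z * ?g n z) \<le> ?i z" for n
      using g01[of n] by (auto simp: indicator_def)
  qed (use i in auto)
  \<comment> \<open>The error is the averaged mass outside \<open>U\<close> plus the deficit inside
    \<open>U\<close>. Averaging does not increase the total mass, so the first part is at most the
    second.\<close>
  have bound: "(LINT z|lborel. \<bar>?g n z - ?i z\<bar>) \<le> 2 * ((LINT z|lborel. ?i z) - (LINT z|lborel. ?i z * ?g n z))" for n
  proof -
    have "\<bar>?g n z - ?i z\<bar> = ?g n z + ?i z - 2 * (?i z * ?g n z)" for z
      using g01[of n z] by (auto simp: indicator_def)
    then have "(LINT z|lborel. \<bar>?g n z - ?i z\<bar>) = (LINT z|lborel. ?g n z) + (LINT z|lborel. ?i z) - 2 * (LINT z|lborel. ?i z * ?g n z)"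
      using g[of n] i gU[of n] by simp
    moreover have "(LINT z|lborel. ?g n z) \<le> (LINT z|lborel. ?i z)"
      using grid_avg_integrable(2)[OF p(1) i, of n] g01[of n] by simp
    ultimately show ?thesis by simp
  qed
  have "(\<lambda>n. 2 * ((LINT z|lborel. ?i z) - (LINT z|lborel. ?i z * ?g n z))) \<longlonglongrightarrow> 2 * ((LINT z|lborel. ?i z) - (LINT z|lborel. ?i z))"
    by (intro tendsto_intros lim)
  then have "(\<lambda>n. 2 * ((LINT z|lborel. ?i z) - (LINT z|lborel. ?i z * ?g n z))) \<longlonglongrightarrow> 0"
    by simp
  from tendsto_0_le_real[OF _ bound this] show ?thesis
    by simp
qed

text \<open>Open sets come first because there the averages are eventually \<open>1\<close>, and the contraction
  property bounds the mass that leaks out; outer regularity passes to Borel sets.\<close>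

proposition grid_avg_tendsto_L1:
  assumes h: "integrable lborel h" and p: "\<And>n. 0 < p n" "p \<longlonglongrightarrow> 0"
  shows "(\<lambda>n. LINT z|lborel. \<bar>grid_avg (p n) h z - h z\<bar>) \<longlonglongrightarrow> 0"
proof -
  define Q where "Q h \<longleftrightarrow> (\<lambda>n. LINT z|lborel. \<bar>grid_avg (p n) h z - h z\<bar>) \<longlonglongrightarrow> 0" for h
  \<comment> \<open>Convergence passes to L1 limits: by the contraction property an approximation
    within \<open>e\<close> / 4 costs \<open>e\<close> / 2 in total.\<close>
  have approx: "Q f" if f: "integrable lborel f"
    and *: "\<And>e. 0 < e \<Longrightarrow> \<exists>g. integrable lborel g \<and> Q g \<and> (LINT z|lborel. \<bar>f z - g z\<bar>) < e" for f
    unfolding Q_def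
  proof (rule LIMSEQ_I)
    fix e :: real assume e: "0 < e"
    obtain g where g: "integrable lborel g" "Q g" "(LINT z|lborel. \<bar>f z - g z\<bar>) < e / 4"
      using *[of "e / 4"] e by auto
    have "\<forall>\<^sub>F n in sequentially. (LINT z|lborel. \<bar>grid_avg (p n) g z - g z\<bar>) < e / 2"
      using g(2) e unfolding Q_def by (intro order_tendstoD(2)) auto
    then obtain N where N: "\<And>n. N \<le> n \<Longrightarrow> (LINT z|lborel. \<bar>grid_avg (p n) g z - g z\<bar>) < e / 2"
      by (auto simp: eventually_sequentially)
    have "norm ((LINT z|lborel. \<bar>grid_avg (p n) f z - f z\<bar>) - 0) < e" if "N \<le> n" for n
      using grid_avg_approx_triangle[OF p(1) f g(1), of n] N[OF that] g(3) by simp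
    then show "\<exists>N. \<forall>n\<ge>N. norm ((LINT z|lborel. \<bar>grid_avg (p n) f z - f z\<bar>) - 0) < e" by blast
  qed
  have ind: "Q (indicator A)" if A [measurable]: "A \<in> sets borel" and fin: "emeasure lborel A < \<infinity>" for A
  proof (rule approx)
    show "integrable lborel (indicator A :: _ \<Rightarrow> real)" using fin by (simp add: integrable_indicator_iff)
    fix e :: real assume e: "0 < e"
    obtain U where U: "open U" "A \<subseteq> U" "emeasure lborel (U - A) < ennreal e"
      using outer_regular_lborel[OF A e] by metis
    have [measurable]: "U \<in> sets borel" using U by auto
    have "emeasure lborel U = emeasure lborel A + emeasure lborel (U - A)"
      using U(2) by (subst plus_emeasure) (auto intro!: arg_cong[of _ _ "emeasure lborel"])
    then have finU: "emeasure lborel U < \<infinity>"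
      using fin U(3) by (auto simp: less_top[symmetric] intro: less_trans)
    have "(LINT z|lborel. \<bar>indicator A z - indicator U z :: real\<bar>) = (LINT z|lborel. indicator (U - A) z)"
      using U(2) by (intro Bochner_Integration.integral_cong) (auto simp: indicator_def)
    also have "\<dots> < e"
      using U(3) e by (cases "emeasure lborel (U - A)" rule: ennreal_cases) (auto simp: measure_def ennreal_less_iff)
    finally show "\<exists>g. integrable lborel g \<and> Q g \<and> (LINT z|lborel. \<bar>indicator A z - g z\<bar>) < e"
      using finU grid_avg_indicator_open_tendsto[OF U(1) finU p]
      by (intro exI[of _ "indicator U"]) (auto simp: Q_def integrable_indicator_iff)
  qed
  from h have "Q h"
  proof (induction rule: integrable_induct)
    case (base A c)
    have "(LINT z|lborel. \<bar>grid_avg (p n) (\<lambda>z. indicator A z *\<^sub>R c) z - indicator A z *\<^sub>R c\<bar>)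
        = \<bar>c\<bar> * (LINT z|lborel. \<bar>grid_avg (p n) (indicator A) z - indicator A z\<bar>)" for n
      unfolding integral_mult_right_zero[symmetric] using grid_avg_cmult[of "p n" c "indicator A"]
      by (intro Bochner_Integration.integral_cong) (auto simp: abs_mult[symmetric] algebra_simps)
    then show ?case
      using ind[of A] base unfolding Q_def by (auto intro!: tendsto_mult_right_zero)
  next
    case (add f g)
    have bnd: "(LINT z|lborel. \<bar>grid_avg (p n) (\<lambda>z. f z + g z) z - (f z + g z)\<bar>)
       \<le> (LINT z|lborel. \<bar>grid_avg (p n) f z - f z\<bar>) + (LINT z|lborel. \<bar>grid_avg (p n) g z - g z\<bar>)" for n
    proof -
      have "(LINT z|lborel. \<bar>grid_avg (p n) (\<lambda>z. f z + g z) z - (f z + g z)\<bar>)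
         \<le> (LINT z|lborel. \<bar>grid_avg (p n) f z - f z\<bar> + \<bar>grid_avg (p n) g z - g z\<bar>)"
      proof (rule integral_mono)
        have fg: "integrable lborel (\<lambda>z. f z + g z)" using add by auto
        show "integrable lborel (\<lambda>z. \<bar>grid_avg (p n) (\<lambda>z. f z + g z) z - (f z + g z)\<bar>)"
          by (rule integrable_grid_avg_diff[OF p(1) fg])
        show "integrable lborel (\<lambda>z. \<bar>grid_avg (p n) f z - f z\<bar> + \<bar>grid_avg (p n) g z - g z\<bar>)"
          using integrable_grid_avg_diff[OF p(1)] add by auto
        show "\<bar>grid_avg (p n) (\<lambda>z. f z + g z) z - (f z + g z)\<bar>
            \<le> \<bar>grid_avg (p n) f z - f z\<bar> + \<bar>grid_avg (p n) g z - g z\<bar>" for z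
          unfolding grid_avg_add[OF p(1) add(1,2)] by linarith
      qed
      then show ?thesis using integrable_grid_avg_diff[OF p(1)] add by simp
    qed
    have lim0: "(\<lambda>n. (LINT z|lborel. \<bar>grid_avg (p n) f z - f z\<bar>) + (LINT z|lborel. \<bar>grid_avg (p n) g z - g z\<bar>)) \<longlonglongrightarrow> 0"
      using tendsto_add[of _ 0 _ _ 0] add unfolding Q_def by auto
    show ?case
      unfolding Q_def by (rule tendsto_0_le_real[OF _ bnd lim0]) simp
  next
    case (lim f s)
    show ?case
    proof (rule approx[OF lim.hyps(4)])
      fix e :: real assume e: "0 < e"
      have "(\<lambda>i. LINT z|lborel. \<bar>f z - s i z\<bar>) \<longlonglongrightarrow> (LINT z|(lborel :: (real \<times> real) measure). 0)"
      proof (rule integral_dominated_convergence[where w = "\<lambda>z. 3 * norm (f z)"])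
        show "AE z in lborel. (\<lambda>i. \<bar>f z - s i z\<bar>) \<longlonglongrightarrow> 0"
        proof (intro AE_I2)
          fix z
          have "(\<lambda>i. \<bar>f z - s i z\<bar>) \<longlonglongrightarrow> \<bar>f z - f z\<bar>"
            by (intro tendsto_intros lim.hyps(2)) simp
          then show "(\<lambda>i. \<bar>f z - s i z\<bar>) \<longlonglongrightarrow> 0" by simp
        qed
        show "AE z in lborel. norm \<bar>f z - s i z\<bar> \<le> 3 * norm (f z)" for i
        proof (intro AE_I2)
          fix z show "norm \<bar>f z - s i z\<bar> \<le> 3 * norm (f z)"
            using lim.hyps(3)[of z i] by simp
        qed
      qed (use lim in auto)
      then have "\<forall>\<^sub>F i in sequentially. (LINT z|lborel. \<bar>f z - s i z\<bar>) < e"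
        using e by (intro order_tendstoD(2)) auto
      then obtain i where "(LINT z|lborel. \<bar>f z - s i z\<bar>) < e"
        by (auto simp: eventually_sequentially)
      then show "\<exists>g. integrable lborel g \<and> Q g \<and> (LINT z|lborel. \<bar>f z - g z\<bar>) < e"
        using lim by blast
    qed
  qed
  then show ?thesis unfolding Q_def .
qed


section \<open>Cells and step functions\<close>

lemma measurable_cell [measurable]: "cell p u \<in> sets borel"
  by (simp add: cell_def)

lemma emeasure_cell: "0 \<le> p \<Longrightarrow> emeasure lborel (cell p u) = ennreal p"
  by (simp add: cell_def algebra_simps)

lemma measure_cell: "0 \<le> p \<Longrightarrow> measure lborel (cell p u) = p"
  using emeasure_cell[of p u] by (simp add: measure_def)

lemma cell_ceiling:
  assumes "0 < p"
  shows "x \<in> cell p u \<longleftrightarrow> \<lceil>x / p\<rceil> = int u"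
  using ceiling_div_eq_iff[OF assms, of x "int u"] by (simp add: cell_def)

lemma disjoint_family_cell: "0 < p \<Longrightarrow> disjoint_family (cell p)"
  unfolding disjoint_family_on_def by (auto simp: cell_ceiling)

lemma cell_subset:
  assumes "0 < p" "1 \<le> u" "u \<le> n"
  shows "cell p u \<subseteq> {0<..real n * p}"
proof
  fix x assume "x \<in> cell p u"
  then have x: "(real u - 1) * p < x" "x \<le> real u * p" by (auto simp: cell_def)
  moreover have "0 \<le> (real u - 1) * p" "real u * p \<le> real n * p"
    using assms by (auto intro!: mult_nonneg_nonneg)
  ultimately show "x \<in> {0<..real n * p}" by auto
qed

lemma in_cellE:
  assumes "0 < p" "x \<in> {0<..real n * p}"
  obtains u where "u \<in> {1..n}" "x \<in> cell p u"
proof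
  have "0 < x / p" "x / p \<le> real n" using assms by (auto simp: field_simps)
  then have *: "0 < \<lceil>x / p\<rceil>" "\<lceil>x / p\<rceil> \<le> int n" by (auto simp: ceiling_le_iff)
  then show "nat \<lceil>x / p\<rceil> \<in> {1..n}" by (simp only: atLeastAtMost_iff) linarith
  show "x \<in> cell p (nat \<lceil>x / p\<rceil>)"
    unfolding cell_ceiling[OF assms(1)] using * by linarith
qed

lemma step_fn_eq:
  assumes fin: "finite V" and dis: "disjoint_family_on I V"
    and u: "u \<in> V" "x \<in> I u" and v: "v \<in> V" "y \<in> I v"
  shows "step_fn I V c (x, y) = c u v"
proof -
  have only: "x \<in> I u' \<longleftrightarrow> u' = u" "y \<in> I u' \<longleftrightarrow> u' = v" if "u' \<in> V" for u'
    using that u v dis by (auto simp: disjoint_family_on_def)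
  have "step_fn I V c (x, y) = (\<Sum>u'\<in>V. \<Sum>v'\<in>V. if u' = u \<and> v' = v then c u v else 0)"
    unfolding step_fn_def using only by (intro sum.cong refl) (auto simp: indicator_def)
  also have "\<dots> = (\<Sum>u'\<in>V. if u' = u then c u v else 0)"
    using fin v(1) by (intro sum.cong refl) auto
  also have "\<dots> = c u v" using fin u(1) by simp
  finally show ?thesis .
qed

lemma step_fn_eq_0:
  assumes "x \<notin> (\<Union>u\<in>V. I u) \<or> y \<notin> (\<Union>u\<in>V. I u)"
  shows "step_fn I V c (x, y) = 0"
  unfolding step_fn_def using assms by (intro sum.neutral ballI) (auto simp: indicator_def)

lemma step_fn_bounds:
  assumes "finite V" "disjoint_family_on I V" "\<And>u v. u \<in> V \<Longrightarrow> v \<in> V \<Longrightarrow> 0 \<le> c u v \<and> c u v \<le> 1"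
  shows "0 \<le> step_fn I V c w \<and> step_fn I V c w \<le> 1"
proof (cases w)
  case (Pair x y)
  show ?thesis
  proof (cases "x \<in> (\<Union>u\<in>V. I u) \<and> y \<in> (\<Union>u\<in>V. I u)")
    case True
    then obtain u v where "u \<in> V" "x \<in> I u" "v \<in> V" "y \<in> I v" by auto
    then show ?thesis using step_fn_eq[OF assms(1,2), of u x v y c] assms(3)[of u v] Pair by simp
  next
    case False
    then show ?thesis using step_fn_eq_0[of x I V y c] Pair by auto
  qed
qed

lemma measurable_step_fn [measurable]:
  assumes "finite V" "\<And>u. u \<in> V \<Longrightarrow> I u \<in> sets borel"
  shows "step_fn I V c \<in> borel_measurable borel"
proof -
  have [measurable]: "I u \<times> I v \<in> sets borel" if "u \<in> V" "v \<in> V" for u v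
    using that assms unfolding borel_prod[symmetric] by measurable
  show ?thesis
    unfolding step_fn_def[abs_def]
    by (intro borel_measurable_sum borel_measurable_times borel_measurable_const borel_measurable_indicator) auto
qed

lemma grid_avg_on_cells:
  assumes p: "0 < p" and "x \<in> cell p u" "y \<in> cell p v"
  shows "grid_avg p h (x, y) = cell_avg p h u v"
proof -
  have "same_cell p (x, y) w \<longleftrightarrow> w \<in> cell p u \<times> cell p v" for w
    using assms by (cases w) (auto simp: same_cell_def cell_ceiling eq_commute)
  then have "grid_avg p h (x, y) = (LINT w|lborel. (indicator (cell p u \<times> cell p v) w * h w) / p\<^sup>2)"
    unfolding grid_avg_def by (intro Bochner_Integration.integral_cong) (auto simp: grid_kernel_def indicator_def)
  then show ?thesis by (simp add: cell_avg_def)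
qed

text \<open>The cells 1 to \<open>n\<close> tile the half-open square of side \<open>n\<close> *
  \<open>p\<close>, and both sides are constant on products of cells.\<close>

lemma step_fn_cell_avg:
  assumes p: "0 < p"
  shows "step_fn (cell p) {1..n} (cell_avg p h) z = indicator ({0<..real n * p} \<times> {0<..real n * p}) z * grid_avg p h z"
proof (cases z)
  case (Pair x y)
  show ?thesis
  proof (cases "x \<in> {0<..real n * p} \<and> y \<in> {0<..real n * p}")
    case True
    then obtain u v where "u \<in> {1..n}" "x \<in> cell p u" "v \<in> {1..n}" "y \<in> cell p v"
      using in_cellE[OF p] by metis
    then have "step_fn (cell p) {1..n} (cell_avg p h) (x, y) = cell_avg p h u v"
      "grid_avg p h (x, y) = cell_avg p h u v"
      using disjoint_family_cell[OF p]
      by (auto intro!: step_fn_eq grid_avg_on_cells p disjoint_family_on_mono[of _ UNIV "cell p"])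
    then show ?thesis using True Pair by simp
  next
    case False
    have "cell p u \<subseteq> {0<..real n * p}" if "u \<in> {1..n}" for u
      using that cell_subset[OF p] by auto
    then have "x \<notin> (\<Union>u\<in>{1..n}. cell p u) \<or> y \<notin> (\<Union>u\<in>{1..n}. cell p u)"
      using False by blast
    then show ?thesis
      using False step_fn_eq_0[of x "cell p" "{1..n}" y] unfolding Pair by auto
  qed
qed

lemma cell_avg_bounds:
  assumes p: "0 < p" and h: "h \<in> borel_measurable borel" "\<And>z. 0 \<le> h z" "\<And>z. h z \<le> 1"
  shows "0 \<le> cell_avg p h u v" "cell_avg p h u v \<le> 1"
proof -
  \<comment> \<open>The right endpoints belong to their cells, so the grid average takes the value
    in question there.\<close>
  have "real u * p \<in> cell p u" "real v * p \<in> cell p v" using p by (auto simp: cell_def)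
  then have "grid_avg p h (real u * p, real v * p) = cell_avg p h u v"
    by (rule grid_avg_on_cells[OF p])
  then show "0 \<le> cell_avg p h u v" "cell_avg p h u v \<le> 1"
    using grid_avg_bounds[OF p h] by metis+
qed

section \<open>Double sums over the Poisson process\<close>

text \<open>The factors k and k (k - 1) cancel against the factorial and shift the exponential
  series. These are the first two factorial moments of a Poisson variable.\<close>

lemma sums_exp_times:
  fixes x :: real
  shows "(\<lambda>k. real k * (x ^ k / fact k * exp (- x))) sums x"
    and "(\<lambda>k. real (k * (k - 1)) * (x ^ k / fact k * exp (- x))) sums x\<^sup>2"
proof -
  have e: "(\<lambda>k. x ^ k / fact k * exp (- x)) sums 1"
    using sums_mult2[OF exp_converges[of x], of "exp (- x)"] by (simp add: exp_minus field_simps)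
  have "(\<lambda>k. real (Suc k) * (x ^ Suc k / fact (Suc k) * exp (- x))) = (\<lambda>k. x * (x ^ k / fact k * exp (- x)))"
    by (simp add: fun_eq_iff field_simps del: of_nat_Suc)
  then have "(\<lambda>k. real (Suc k) * (x ^ Suc k / fact (Suc k) * exp (- x))) sums x"
    using sums_mult[OF e, of x] by simp
  then show 1: "(\<lambda>k. real k * (x ^ k / fact k * exp (- x))) sums x"
    by (subst (asm) sums_Suc_iff) simp
  have "(\<lambda>k. real (Suc k * (Suc k - 1)) * (x ^ Suc k / fact (Suc k) * exp (- x)))
      = (\<lambda>k. x * (real k * (x ^ k / fact k * exp (- x))))"
    by (simp add: fun_eq_iff field_simps del: of_nat_Suc mult_Suc mult_Suc_right)
  then have "(\<lambda>k. real (Suc k * (Suc k - 1)) * (x ^ Suc k / fact (Suc k) * exp (- x))) sums x\<^sup>2"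
    using sums_mult[OF 1, of x] by (simp add: power2_eq_square)
  then show "(\<lambda>k. real (k * (k - 1)) * (x ^ k / fact k * exp (- x))) sums x\<^sup>2"
    by (subst (asm) sums_Suc_iff) simp
qed

lemma sum_indicator_card_real:
  assumes "finite F"
  shows "(\<Sum>z\<in>F. indicator B z :: real) = real (card (F \<inter> B))"
  using assms by induction (auto simp: Int_insert_left)

lemma finite_le_natE:
  fixes F :: "real set"
  assumes "finite F"
  obtains T :: nat where "\<forall>x\<in>F. x \<le> real T"
proof -
  obtain T where "Max (insert 0 F) \<le> real T" using real_arch_simple by blast
  then have "\<forall>x\<in>F. x \<le> real T" using assms by auto
  then show ?thesis by (rule that)
qed

lemma sum_indicator_card:
  assumes "finite F"
  shows "(\<Sum>z\<in>F. indicator B z :: ennreal) = of_nat (card (F \<inter> B))"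
  using assms by induction (auto simp: Int_insert_left)

text \<open>The split is made so that every term is either a product of counts in disjoint sets,
  which are independent for the process, or a factorial count in one set.\<close>

lemma card_off_diagonal:
  assumes "finite X" "finite Y"
  shows "card {(x, y). x \<in> X \<and> y \<in> Y \<and> x \<noteq> y}
    = card (X - Y) * card (Y - X) + card (X - Y) * card (X \<inter> Y) + card (X \<inter> Y) * card (Y - X)
      + card (X \<inter> Y) * (card (X \<inter> Y) - 1)"
proof -
  let ?d = "card (X \<inter> Y)"
  have "{(x, y). x \<in> X \<and> y \<in> Y \<and> x \<noteq> y} = X \<times> Y - (\<lambda>x. (x, x)) ` (X \<inter> Y)" by auto
  moreover have "card ((\<lambda>x. (x, x)) ` (X \<inter> Y)) = ?d"
    by (intro card_image) (auto simp: inj_on_def)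
  ultimately have "card {(x, y). x \<in> X \<and> y \<in> Y \<and> x \<noteq> y} = card X * card Y - ?d"
    using assms card_Diff_subset[of "(\<lambda>x. (x, x)) ` (X \<inter> Y)" "X \<times> Y"]
    by (auto simp: card_cartesian_product)
  moreover have "card X = card (X - Y) + ?d"
    using card_Un_disjoint[of "X - Y" "X \<inter> Y"] assms by (simp add: Un_Diff_Int Int_commute) (metis Diff_disjoint Int_Diff_Un Int_Diff Int_commute Un_commute inf_le2)
  moreover have "card Y = card (Y - X) + ?d"
    using card_Un_disjoint[of "Y - X" "X \<inter> Y"] assms by (simp add: Un_Diff_Int Int_commute) (metis Diff_disjoint Int_Diff_Un Int_Diff Int_commute Un_commute inf_le2)
  ultimately show ?thesis
    by (cases ?d) (simp_all add: algebra_simps)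
qed

section \<open>Counts of the process and Campbell's formula for pairs\<close>

locale rate1_process = prob_space M for M :: "'b measure" +
  fixes \<Xi> :: "'b \<Rightarrow> real set"
  assumes process: "rate1_poisson_process M \<Xi>"
begin

text \<open>Both orders of each pair of points occur, as in the double integral;
  \<open>ordered_pairs\<close> keeps one of them.\<close>

definition off_diag :: "real \<Rightarrow> 'b \<Rightarrow> (real \<times> real) set" where
  "off_diag t \<omega> = {(x, y). x \<in> \<Xi> \<omega> \<inter> {0..t} \<and> y \<in> \<Xi> \<omega> \<inter> {0..t} \<and> x \<noteq> y}"

lemma points_nonneg: "\<omega> \<in> space M \<Longrightarrow> \<Xi> \<omega> \<subseteq> {0..}"
  and finite_points: "\<omega> \<in> space M \<Longrightarrow> finite (\<Xi> \<omega> \<inter> {0..t})"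
  using process by (auto simp: rate1_poisson_process_def)

lemma finite_off_diag: "\<omega> \<in> space M \<Longrightarrow> finite (off_diag t \<omega>)"
  unfolding off_diag_def by (rule finite_subset[of _ "(\<Xi> \<omega> \<inter> {0..t}) \<times> (\<Xi> \<omega> \<inter> {0..t})"]) (auto intro: finite_points)

lemma num_points_finite_measure:
  assumes "A \<in> sets borel" "A \<subseteq> {0..}" "emeasure lborel A < \<infinity>"
  shows "num_points \<Xi> A \<in> measurable M (count_space UNIV)"
    and "prob {\<omega>\<in>space M. num_points \<Xi> A \<omega> = k} = measure lborel A ^ k / fact k * exp (- measure lborel A)"
  using process assms by (auto simp: rate1_poisson_process_def)

lemma indep_num_points:
  assumes "\<And>i::nat. A i \<in> sets borel" "\<And>i. A i \<subseteq> {0..}" "\<And>i. emeasure lborel (A i) < \<infinity>" "disjoint_family A"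
  shows "indep_vars (\<lambda>_. count_space UNIV) (\<lambda>i. num_points \<Xi> (A i)) UNIV"
  using process assms by (auto simp: rate1_poisson_process_def)

lemma emeasure_bounded_finite:
  fixes A :: "real set"
  assumes "A \<subseteq> {0..t}"
  shows "emeasure lborel A < (\<infinity> :: ennreal)"
proof -
  have "emeasure lborel A \<le> emeasure lborel {0..t}" using assms by (intro emeasure_mono) auto
  also have "\<dots> < \<infinity>" by (cases "0 \<le> t") auto
  finally show ?thesis .
qed

text \<open>The process axioms concern sets of finite length, while \<open>A\<close> may have
  infinite length. Bounded windows bridge the gap: a positive count is the eventual value of the
  counts in the windows [0, t].\<close>

lemma num_points_measurable:
  assumes A [measurable]: "A \<in> sets borel" and "A \<subseteq> {0..}"
  shows "num_points \<Xi> A \<in> measurable M (count_space UNIV)"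
proof -
  define N where "N t = num_points \<Xi> (A \<inter> {0..real t})" for t :: nat
  have [measurable]: "N t \<in> measurable M (count_space UNIV)" for t
    unfolding N_def
  proof (rule num_points_finite_measure(1))
    show "emeasure lborel (A \<inter> {0..real t}) < \<infinity>" by (rule emeasure_bounded_finite[of _ "real t"]) auto
  qed (use assms in auto)
  have ev: "(\<exists>T. \<forall>t\<ge>T. N t \<omega> = Suc k) \<longleftrightarrow> num_points \<Xi> A \<omega> = Suc k" if \<omega>: "\<omega> \<in> space M" for \<omega> k
  proof
    assume "num_points \<Xi> A \<omega> = Suc k"
    then have fin: "finite (\<Xi> \<omega> \<inter> A)" and card: "card (\<Xi> \<omega> \<inter> A) = Suc k"
      by (auto simp: num_points_def card_gt_0_iff intro: ccontr)
    obtain T :: nat where T: "\<forall>x\<in>\<Xi> \<omega> \<inter> A. x \<le> real T"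
      using finite_le_natE[OF fin] .
    have "\<Xi> \<omega> \<inter> (A \<inter> {0..real t}) = \<Xi> \<omega> \<inter> A" if "T \<le> t" for t
    proof -
      have "x \<le> real t" if "x \<in> \<Xi> \<omega> \<inter> A" for x
        using T that \<open>T \<le> t\<close> by (meson of_nat_mono order.trans)
      then show ?thesis using assms(2) by auto
    qed
    then show "\<exists>T. \<forall>t\<ge>T. N t \<omega> = Suc k"
      using card unfolding N_def num_points_def by metis
  next
    assume "\<exists>T. \<forall>t\<ge>T. N t \<omega> = Suc k"
    then obtain T where T: "\<And>t. T \<le> t \<Longrightarrow> card (\<Xi> \<omega> \<inter> (A \<inter> {0..real t})) = Suc k"
      by (auto simp: N_def num_points_def)
    have fin: "finite (\<Xi> \<omega> \<inter> (A \<inter> {0..real t}))" for t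
      using finite_points[OF \<omega>, of "real t"] by (rule finite_subset[rotated]) auto
    have "\<Xi> \<omega> \<inter> A \<subseteq> \<Xi> \<omega> \<inter> (A \<inter> {0..real T})"
    proof
      fix x assume x: "x \<in> \<Xi> \<omega> \<inter> A"
      obtain t where t: "x \<le> real t" using real_arch_simple by blast
      have "\<Xi> \<omega> \<inter> (A \<inter> {0..real T}) = \<Xi> \<omega> \<inter> (A \<inter> {0..real (max t T)})"
        using T[of T] T[of "max t T"] fin by (intro card_subset_eq) auto
      then show "x \<in> \<Xi> \<omega> \<inter> (A \<inter> {0..real T})"
        using x t assms(2) by fastforce
    qed
    then have "\<Xi> \<omega> \<inter> A = \<Xi> \<omega> \<inter> (A \<inter> {0..real T})" by auto
    then show "num_points \<Xi> A \<omega> = Suc k" using T[of T] by (simp add: num_points_def)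
  qed
  have Suc: "{\<omega>\<in>space M. num_points \<Xi> A \<omega> = Suc k} \<in> sets M" for k
  proof -
    have "{\<omega>\<in>space M. num_points \<Xi> A \<omega> = Suc k} = {\<omega>\<in>space M. \<exists>T. \<forall>t\<ge>T. N t \<omega> = Suc k}"
      using ev by auto
    also have "\<dots> \<in> sets M" by measurable
    finally show ?thesis .
  qed
  have "{\<omega>\<in>space M. num_points \<Xi> A \<omega> = k} \<in> sets M" for k
  proof (cases k)
    \<comment> \<open>The value 0 stands both for no point and for infinitely many points, so it is
      reached as the complement of the positive values.\<close>
    case 0
    have "{\<omega>\<in>space M. num_points \<Xi> A \<omega> = 0} = space M - (\<Union>k. {\<omega>\<in>space M. num_points \<Xi> A \<omega> = Suc k})"
      by (auto simp: gr0_conv_Suc) (metis not0_implies_Suc)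
    then show ?thesis using 0 Suc by auto
  next
    case (Suc k')
    then show ?thesis using \<open>\<And>k. {\<omega>\<in>space M. num_points \<Xi> A \<omega> = Suc k} \<in> sets M\<close> by simp
  qed
  then show ?thesis
    by (auto simp: measurable_count_space_eq2_countable vimage_def Int_def conj_commute)
qed

lemma nn_integral_num_points:
  assumes A: "A \<in> sets borel" "A \<subseteq> {0..t}"
  shows "(\<integral>\<^sup>+\<omega>. of_nat (num_points \<Xi> A \<omega>) \<partial>M) = emeasure lborel A"
    and "(\<integral>\<^sup>+\<omega>. of_nat (num_points \<Xi> A \<omega> * (num_points \<Xi> A \<omega> - 1)) \<partial>M) = emeasure lborel A * emeasure lborel A"
proof -
  let ?N = "num_points \<Xi> A" and ?l = "measure lborel A"
  have fin: "emeasure lborel A < \<infinity>" using A emeasure_bounded_finite by blast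
  then have l: "emeasure lborel A = ennreal ?l" by (simp add: emeasure_eq_ennreal_measure less_top)
  have A0: "A \<subseteq> {0..}" using A by auto
  have [measurable]: "?N \<in> measurable M (count_space UNIV)"
    using A A0 fin by (intro num_points_finite_measure)
  have prob: "emeasure M {\<omega>\<in>space M. ?N \<omega> = k} = ennreal (?l ^ k / fact k * exp (- ?l))" for k
    using num_points_finite_measure(2)[OF A(1) A0 fin, of k] by (simp add: emeasure_eq_measure)
  have main: "(\<integral>\<^sup>+\<omega>. of_nat (f (?N \<omega>)) \<partial>M) = ennreal s"
    if "(\<lambda>k. real (f k) * (?l ^ k / fact k * exp (- ?l))) sums s" for f :: "nat \<Rightarrow> nat" and s
  proof -
    have "(\<integral>\<^sup>+\<omega>. of_nat (f (?N \<omega>)) \<partial>M)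
        = (\<integral>\<^sup>+\<omega>. (\<Sum>k. of_nat (f k) * indicator {\<omega>\<in>space M. ?N \<omega> = k} \<omega>) \<partial>M)"
    proof (intro nn_integral_cong)
      fix \<omega> assume "\<omega> \<in> space M"
      then show "of_nat (f (?N \<omega>)) = (\<Sum>k. of_nat (f k) * indicator {\<omega>\<in>space M. ?N \<omega> = k} \<omega> :: ennreal)"
        by (subst suminf_cmult_indicator[where i = "?N \<omega>"]) (auto simp: disjoint_family_on_def)
    qed
    also have "\<dots> = (\<Sum>k. \<integral>\<^sup>+\<omega>. of_nat (f k) * indicator {\<omega>\<in>space M. ?N \<omega> = k} \<omega> \<partial>M)"
      by (intro nn_integral_suminf) measurable
    also have "\<dots> = (\<Sum>k. of_nat (f k) * emeasure M {\<omega>\<in>space M. ?N \<omega> = k})"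
      by (intro suminf_cong nn_integral_cmult_indicator) measurable
    also have "\<dots> = (\<Sum>k. ennreal (real (f k) * (?l ^ k / fact k * exp (- ?l))))"
      unfolding prob by (simp add: ennreal_mult[symmetric] ennreal_of_nat_eq_real_of_nat)
    also have "\<dots> = ennreal s"
      using that by (intro suminf_ennreal_eq) auto
    finally show ?thesis .
  qed
  show "(\<integral>\<^sup>+\<omega>. of_nat (?N \<omega>) \<partial>M) = emeasure lborel A"
    unfolding l by (rule main[of "\<lambda>k. k"]) (rule sums_exp_times)
  show "(\<integral>\<^sup>+\<omega>. of_nat (?N \<omega> * (?N \<omega> - 1)) \<partial>M) = emeasure lborel A * emeasure lborel A"
    using main[of "\<lambda>k. k * (k - 1)", OF sums_exp_times(2)]
    unfolding l by (simp add: power2_eq_square ennreal_mult)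
qed

lemma nn_integral_num_points_disjoint:
  assumes A: "A \<in> sets borel" "A \<subseteq> {0..t}" and B: "B \<in> sets borel" "B \<subseteq> {0..t}" and dis: "A \<inter> B = {}"
  shows "(\<integral>\<^sup>+\<omega>. of_nat (num_points \<Xi> A \<omega> * num_points \<Xi> B \<omega>) \<partial>M) = emeasure lborel A * emeasure lborel B"
proof -
  \<comment> \<open>The independence axiom speaks of sequences of sets, so the two sets are padded
    with empty ones.\<close>
  define F where "F i = (if i = 0 then A else if i = 1 then B else {})" for i :: nat
  have F: "F i \<in> sets borel" "F i \<subseteq> {0..t}" for i using A B by (auto simp: F_def)
  have "indep_vars (\<lambda>_. count_space UNIV) (\<lambda>i. num_points \<Xi> (F i)) UNIV"
  proof (rule indep_num_points)
    show "F i \<subseteq> {0..}" for i using F(2)[of i] by auto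
    show "disjoint_family F" using dis by (auto simp: F_def disjoint_family_on_def)
    show "emeasure lborel (F i) < \<infinity>" for i by (rule emeasure_bounded_finite[OF F(2)])
  qed (use F in auto)
  then have "indep_vars (\<lambda>_. borel) (\<lambda>i \<omega>. of_nat (num_points \<Xi> (F i) \<omega>) :: ennreal) UNIV"
    by (rule indep_vars_compose2) simp
  then have "indep_vars (\<lambda>_. borel) (\<lambda>i \<omega>. of_nat (num_points \<Xi> (F i) \<omega>) :: ennreal) {0, 1}"
    by (rule indep_vars_subset) auto
  from indep_vars_nn_integral[OF _ this] show ?thesis
    using nn_integral_num_points(1)[OF A] nn_integral_num_points(1)[OF B] by (simp add: F_def)
qed

text \<open>For a rectangle \<open>A \<times> A'\<close> one splits along \<open>A \<inter> A'\<close>, which contributes the second factorial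
  moment of a Poisson variable; the rest is a Dynkin argument.\<close>

lemma campbell_indicator:
  assumes B: "B \<in> sets borel"
  shows "(\<lambda>\<omega>. \<Sum>z\<in>off_diag t \<omega>. indicator B z :: ennreal) \<in> borel_measurable M
    \<and> (\<integral>\<^sup>+\<omega>. (\<Sum>z\<in>off_diag t \<omega>. indicator B z) \<partial>M) = emeasure lborel (B \<inter> {0..t} \<times> {0..t})"
proof -
  let ?c = "\<lambda>B \<omega>. \<Sum>z\<in>off_diag t \<omega>. indicator B z :: ennreal"
  let ?Q = "{0..t} \<times> {0..t}"
  define P where "P B \<longleftrightarrow> ?c B \<in> borel_measurable M \<and> (\<integral>\<^sup>+\<omega>. ?c B \<omega> \<partial>M) = emeasure lborel (B \<inter> ?Q)" for B
  let ?G = "{a \<times> b | a b. a \<in> sets (borel :: real measure) \<and> b \<in> sets (borel :: real measure)}"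
  have Q [measurable]: "?Q \<in> sets borel" unfolding borel_prod[symmetric] by measurable
  have finQ: "emeasure lborel ?Q < \<infinity>"
    using emeasure_bounded_finite[of "{0..t}" t] by (simp add: emeasure_lborel_Times ennreal_mult_less_top)
  have sets_eq: "sets (borel :: (real \<times> real) measure) = sigma_sets UNIV ?G"
    unfolding borel_prod[symmetric] by (simp add: sets_pair_measure)
  have rect: "P (A \<times> A')" if [measurable]: "A \<in> sets borel" "A' \<in> sets borel" for A A'
  proof -
    define X Y where "X = A \<inter> {0..t}" and "Y = A' \<inter> {0..t}"
    have sets: "X - Y \<in> sets borel" "Y - X \<in> sets borel" "X \<inter> Y \<in> sets borel" "X \<in> sets borel" "Y \<in> sets borel"
      unfolding X_def Y_def by measurable
    have sub: "X - Y \<subseteq> {0..t}" "Y - X \<subseteq> {0..t}" "X \<inter> Y \<subseteq> {0..t}"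
      unfolding X_def Y_def by auto
    then have sub': "X - Y \<subseteq> {0..}" "Y - X \<subseteq> {0..}" "X \<inter> Y \<subseteq> {0..}" by auto
    let ?b = "num_points \<Xi> (X - Y)" and ?b' = "num_points \<Xi> (Y - X)" and ?d = "num_points \<Xi> (X \<inter> Y)"
    have m [measurable]: "?b \<in> measurable M (count_space UNIV)" "?b' \<in> measurable M (count_space UNIV)"
      "?d \<in> measurable M (count_space UNIV)"
      using num_points_measurable sets sub' by auto
    have c: "?c (A \<times> A') \<omega> = of_nat (?b \<omega> * ?b' \<omega>) + of_nat (?b \<omega> * ?d \<omega>) + of_nat (?d \<omega> * ?b' \<omega>) + of_nat (?d \<omega> * (?d \<omega> - 1))"
      if \<omega>: "\<omega> \<in> space M" for \<omega>
    proof -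
      let ?X = "\<Xi> \<omega> \<inter> X" and ?Y = "\<Xi> \<omega> \<inter> Y"
      have fin: "finite ?X" "finite ?Y"
        using finite_points[OF \<omega>, of t] by (auto simp: X_def Y_def intro: finite_subset[rotated])
      have "?c (A \<times> A') \<omega> = of_nat (card (off_diag t \<omega> \<inter> (A \<times> A')))"
        using finite_off_diag[OF \<omega>, of t] by (rule sum_indicator_card)
      also have "off_diag t \<omega> \<inter> (A \<times> A') = {(x, y). x \<in> ?X \<and> y \<in> ?Y \<and> x \<noteq> y}"
        by (auto simp: off_diag_def X_def Y_def)
      also have "card \<dots> = ?b \<omega> * ?b' \<omega> + ?b \<omega> * ?d \<omega> + ?d \<omega> * ?b' \<omega> + ?d \<omega> * (?d \<omega> - 1)"
      proof -
        have "?X - ?Y = \<Xi> \<omega> \<inter> (X - Y)" "?Y - ?X = \<Xi> \<omega> \<inter> (Y - X)" "?X \<inter> ?Y = \<Xi> \<omega> \<inter> (X \<inter> Y)" by auto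
        then show ?thesis unfolding card_off_diagonal[OF fin] num_points_def by simp
      qed
      finally show ?thesis by (simp only: of_nat_add)
    qed
    have "(\<integral>\<^sup>+\<omega>. ?c (A \<times> A') \<omega> \<partial>M) = (\<integral>\<^sup>+\<omega>. of_nat (?b \<omega> * ?b' \<omega>) + of_nat (?b \<omega> * ?d \<omega>)
        + of_nat (?d \<omega> * ?b' \<omega>) + of_nat (?d \<omega> * (?d \<omega> - 1)) \<partial>M)"
      by (intro nn_integral_cong c)
    also have "\<dots> = (\<integral>\<^sup>+\<omega>. of_nat (?b \<omega> * ?b' \<omega>) \<partial>M) + (\<integral>\<^sup>+\<omega>. of_nat (?b \<omega> * ?d \<omega>) \<partial>M)
        + (\<integral>\<^sup>+\<omega>. of_nat (?d \<omega> * ?b' \<omega>) \<partial>M) + (\<integral>\<^sup>+\<omega>. of_nat (?d \<omega> * (?d \<omega> - 1)) \<partial>M)"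
    proof -
      have "(\<lambda>\<omega>. of_nat (f (?b \<omega>) (?b' \<omega>) (?d \<omega>)) :: ennreal) \<in> borel_measurable M" for f :: "nat \<Rightarrow> nat \<Rightarrow> nat \<Rightarrow> nat"
        by measurable
      from this[of "\<lambda>x y z. x * y"] this[of "\<lambda>x y z. x * z"] this[of "\<lambda>x y z. z * y"] this[of "\<lambda>x y z. z * (z - 1)"]
      show ?thesis by (simp add: nn_integral_add del: of_nat_mult)
    qed
    also have "\<dots> = emeasure lborel (X - Y) * emeasure lborel (Y - X) + emeasure lborel (X - Y) * emeasure lborel (X \<inter> Y)
        + emeasure lborel (X \<inter> Y) * emeasure lborel (Y - X) + emeasure lborel (X \<inter> Y) * emeasure lborel (X \<inter> Y)"
      using nn_integral_num_points_disjoint[OF sets(1) sub(1) sets(2) sub(2)]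
        nn_integral_num_points_disjoint[OF sets(1) sub(1) sets(3) sub(3)]
        nn_integral_num_points_disjoint[OF sets(3) sub(3) sets(2) sub(2)]
        nn_integral_num_points(2)[OF sets(3) sub(3)]
      by (simp add: Int_Diff Diff_Int_distrib2 disjoint_iff del: of_nat_mult) 
    also have "\<dots> = (emeasure lborel (X - Y) + emeasure lborel (X \<inter> Y)) * (emeasure lborel (Y - X) + emeasure lborel (X \<inter> Y))"
      by (simp add: algebra_simps)
    also have "emeasure lborel (X - Y) + emeasure lborel (X \<inter> Y) = emeasure lborel X"
      using sets by (subst plus_emeasure) (auto intro!: arg_cong[of _ _ "emeasure lborel"])
    also have "emeasure lborel (Y - X) + emeasure lborel (X \<inter> Y) = emeasure lborel Y"
      using sets by (subst plus_emeasure) (auto intro!: arg_cong[of _ _ "emeasure lborel"])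
    also have "emeasure lborel X * emeasure lborel Y = emeasure lborel (X \<times> Y)"
      using sets by (simp add: emeasure_lborel_Times)
    also have "X \<times> Y = A \<times> A' \<inter> ?Q" by (auto simp: X_def Y_def)
    finally have "(\<integral>\<^sup>+\<omega>. ?c (A \<times> A') \<omega> \<partial>M) = emeasure lborel (A \<times> A' \<inter> ?Q)" .
    moreover have "?c (A \<times> A') \<in> borel_measurable M"
      by (subst measurable_cong[OF c]) measurable
    ultimately show ?thesis by (simp add: P_def)
  qed
  have G: "?G \<subseteq> Pow UNIV" by auto
  have "P B"
    using Int_stable_pair_measure_generator[of "borel :: real measure" "borel :: real measure"] G B[unfolded sets_eq]
  proof (induction rule: sigma_sets_induct_disjoint)
    case (basic A)
    then show ?case using rect by auto
  next
    case empty
    show ?case by (simp add: P_def)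
  next
    case (compl A)
    from compl(1) have A [measurable]: "A \<in> sets borel" unfolding sets_eq .
    have U: "P UNIV" using rect[of UNIV UNIV] by simp
    have cA: "?c A \<omega> \<le> ?c UNIV \<omega>" for \<omega>
      by (intro sum_mono) (simp add: indicator_def)
    have cU: "?c UNIV \<omega> < \<infinity>" for \<omega>
      by (simp add: of_nat_less_top)
    have eq: "?c (UNIV - A) \<omega> = ?c UNIV \<omega> - ?c A \<omega>" for \<omega>
    proof -
      have "?c UNIV \<omega> = ?c (UNIV - A) \<omega> + ?c A \<omega>"
        unfolding sum.distrib[symmetric] by (intro sum.cong refl) (auto simp: indicator_def)
      moreover have "?c A \<omega> \<noteq> \<infinity>" using cA[of \<omega>] cU[of \<omega>] by (metis leD)
      ultimately show ?thesis by (simp add: ennreal_add_diff_cancel_right)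
    qed
    \<comment> \<open>Complements require subtraction of extended nonnegative numbers, which is
      sound here because everything inside the bounded window is finite.\<close>
    have "emeasure lborel (A \<inter> ?Q) \<le> emeasure lborel ?Q" by (intro emeasure_mono) auto
    then have finA: "emeasure lborel (A \<inter> ?Q) < \<infinity>" using finQ by (rule le_less_trans)
    have "(\<integral>\<^sup>+\<omega>. ?c (UNIV - A) \<omega> \<partial>M) = (\<integral>\<^sup>+\<omega>. ?c UNIV \<omega> \<partial>M) - (\<integral>\<^sup>+\<omega>. ?c A \<omega> \<partial>M)"
      unfolding eq
    proof (rule nn_integral_diff)
      show "?c UNIV \<in> borel_measurable M" "?c A \<in> borel_measurable M" using U compl by (auto simp: P_def)
      show "(\<integral>\<^sup>+\<omega>. ?c A \<omega> \<partial>M) \<noteq> \<infinity>" using compl finA by (auto simp: P_def)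
    qed (use cA in auto)
    also have "\<dots> = emeasure lborel ?Q - emeasure lborel (A \<inter> ?Q)"
      using U compl by (simp add: P_def)
    also have "\<dots> = emeasure lborel (?Q - A \<inter> ?Q)"
      using finA by (intro emeasure_Diff[symmetric]) auto
    also have "?Q - A \<inter> ?Q = (UNIV - A) \<inter> ?Q" by auto
    finally show ?case
      using U compl unfolding P_def eq by auto
  next
    case (union A)
    have A [measurable]: "A i \<in> sets borel" for i using union(2) unfolding sets_eq by auto
    have eq: "?c (\<Union>i. A i) \<omega> = (\<Sum>i. ?c (A i) \<omega>)" for \<omega>
      unfolding suminf_indicator[OF union(1), symmetric] by (subst suminf_sum) auto
    have m: "?c (A i) \<in> borel_measurable M" for i using union(3) by (simp add: P_def)
    have "(\<integral>\<^sup>+\<omega>. ?c (\<Union>i. A i) \<omega> \<partial>M) = (\<Sum>i. \<integral>\<^sup>+\<omega>. ?c (A i) \<omega> \<partial>M)"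
      unfolding eq by (rule nn_integral_suminf[OF m])
    also have "\<dots> = (\<Sum>i. emeasure lborel (A i \<inter> ?Q))"
      using union(3) by (simp add: P_def)
    also have "\<dots> = emeasure lborel (\<Union>i. A i \<inter> ?Q)"
      using union(1) by (intro suminf_emeasure) (auto simp: disjoint_family_on_def)
    also have "(\<Union>i. A i \<inter> ?Q) = (\<Union>i. A i) \<inter> ?Q" by auto
    finally show ?case
      unfolding P_def eq using m by auto
  qed
  then show ?thesis by (simp add: P_def)
qed

text \<open>The second-order Campbell formula: pairs of distinct points have planar Lebesgue measure
  as mean measure. The indicator case extends by monotone approximation.\<close>

proposition campbell:
  fixes h :: "real \<times> real \<Rightarrow> ennreal"
  assumes "h \<in> borel_measurable borel"
  shows "(\<lambda>\<omega>. \<Sum>z\<in>off_diag t \<omega>. h z) \<in> borel_measurable M"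
    and "(\<integral>\<^sup>+\<omega>. (\<Sum>z\<in>off_diag t \<omega>. h z) \<partial>M) = (\<integral>\<^sup>+z. h z * indicator ({0..t} \<times> {0..t}) z \<partial>lborel)"
proof -
  have Q [measurable]: "{0..t} \<times> {0..t} \<in> sets borel" unfolding borel_prod[symmetric] by measurable
  have "(\<lambda>\<omega>. \<Sum>z\<in>off_diag t \<omega>. h z) \<in> borel_measurable M \<and>
    (\<integral>\<^sup>+\<omega>. (\<Sum>z\<in>off_diag t \<omega>. h z) \<partial>M) = (\<integral>\<^sup>+z. h z * indicator ({0..t} \<times> {0..t}) z \<partial>lborel)"
    using assms
  proof (induction rule: borel_measurable_induct)
    case (cong f g)
    then have "f = g" by auto
    then show ?case using cong by simp
  next
    case (set A)
    then show ?case
      using campbell_indicator[of A t] by (simp add: indicator_inter_arith[symmetric])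
  next
    case (mult u c)
    then show ?case
      by (auto simp: sum_distrib_left[symmetric] nn_integral_cmult mult.assoc)
  next
    case (add u v)
    then show ?case
      by (auto simp: sum.distrib nn_integral_add distrib_right)
  next
    case (seq U)
    have U [measurable]: "U i \<in> borel_measurable borel" for i using seq by auto
    have Umono: "U m z \<le> U n z" if "m \<le> n" for m n z
      using \<open>incseq U\<close> that unfolding incseq_def le_fun_def by blast
    have eq: "(\<Sum>z\<in>off_diag t \<omega>. (SUP i. U i) z) = (SUP i. \<Sum>z\<in>off_diag t \<omega>. U i z)" for \<omega>
      using Umono by (subst ennreal_SUP_sum) (auto simp: image_comp incseq_def)
    have inc: "incseq (\<lambda>i \<omega>. \<Sum>z\<in>off_diag t \<omega>. U i z)"
      using Umono by (auto simp: incseq_def le_fun_def intro!: sum_mono)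
    have m: "(\<lambda>\<omega>. \<Sum>z\<in>off_diag t \<omega>. U i z) \<in> borel_measurable M" for i using seq by auto
    have "(\<integral>\<^sup>+\<omega>. (SUP i. \<Sum>z\<in>off_diag t \<omega>. U i z) \<partial>M) = (SUP i. \<integral>\<^sup>+\<omega>. (\<Sum>z\<in>off_diag t \<omega>. U i z) \<partial>M)"
      by (rule nn_integral_monotone_convergence_SUP[OF inc m])
    also have "\<dots> = (SUP i. \<integral>\<^sup>+z. U i z * indicator ({0..t} \<times> {0..t}) z \<partial>lborel)"
      using seq by simp
    also have "\<dots> = (\<integral>\<^sup>+z. (SUP i. U i z * indicator ({0..t} \<times> {0..t}) z) \<partial>lborel)"
      using Umono by (intro nn_integral_monotone_convergence_SUP[symmetric])
        (auto simp: incseq_def le_fun_def intro!: mult_right_mono)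
    also have "\<dots> = (\<integral>\<^sup>+z. (SUP i. U i) z * indicator ({0..t} \<times> {0..t}) z \<partial>lborel)"
      by (intro nn_integral_cong) (simp add: SUP_mult_right_ennreal image_comp)
    finally show ?case
      unfolding eq using m by auto
  qed
  then show "(\<lambda>\<omega>. \<Sum>z\<in>off_diag t \<omega>. h z) \<in> borel_measurable M"
    "(\<integral>\<^sup>+\<omega>. (\<Sum>z\<in>off_diag t \<omega>. h z) \<partial>M) = (\<integral>\<^sup>+z. h z * indicator ({0..t} \<times> {0..t}) z \<partial>lborel)" by auto
qed


lemma off_diag_integrable:
  fixes f :: "real \<times> real \<Rightarrow> real"
  assumes f [measurable]: "f \<in> borel_measurable borel"
    and int: "integrable lborel (\<lambda>z. indicator ({0..t} \<times> {0..t}) z * f z)"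
  shows "integrable M (\<lambda>\<omega>. \<Sum>z\<in>off_diag t \<omega>. f z)"
    and "(LINT \<omega>|M. \<bar>\<Sum>z\<in>off_diag t \<omega>. f z\<bar>) \<le> (LINT z|lborel. indicator ({0..t} \<times> {0..t}) z * \<bar>f z\<bar>)"
    and "(LINT \<omega>|M. (\<Sum>z\<in>off_diag t \<omega>. \<bar>f z\<bar>)) = (LINT z|lborel. indicator ({0..t} \<times> {0..t}) z * \<bar>f z\<bar>)"
    and "integrable M (\<lambda>\<omega>. \<Sum>z\<in>off_diag t \<omega>. \<bar>f z\<bar>)"
proof -
  let ?Q = "{0..t} \<times> {0..t}"
  have m: "(\<lambda>\<omega>. \<Sum>z\<in>off_diag t \<omega>. g z) \<in> borel_measurable M"
    if [measurable]: "g \<in> borel_measurable borel" and nn: "\<And>z. 0 \<le> g z" for g :: "real \<times> real \<Rightarrow> real"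
  proof -
    have "(\<lambda>\<omega>. enn2real (\<Sum>z\<in>off_diag t \<omega>. ennreal (g z))) \<in> borel_measurable M"
      by (intro borel_measurable_enn2real campbell(1)) measurable
    then show ?thesis using nn by (simp add: sum_ennreal sum_nonneg)
  qed
  \<comment> \<open>Campbell's formula gives measurability for nonnegative functions; a signed one
    is split into positive and negative part.\<close>
  have "(\<Sum>z\<in>off_diag t \<omega>. f z) = (\<Sum>z\<in>off_diag t \<omega>. max 0 (f z)) - (\<Sum>z\<in>off_diag t \<omega>. max 0 (- f z))" for \<omega>
    unfolding sum_subtractf[symmetric] by (intro sum.cong refl) auto
  then have meas [measurable]: "(\<lambda>\<omega>. \<Sum>z\<in>off_diag t \<omega>. f z) \<in> borel_measurable M"
    using m[of "\<lambda>z. max 0 (f z)"] m[of "\<lambda>z. max 0 (- f z)"] by simp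
  have absm [measurable]: "(\<lambda>\<omega>. \<Sum>z\<in>off_diag t \<omega>. \<bar>f z\<bar>) \<in> borel_measurable M"
    by (rule m) auto
  have absint: "integrable lborel (\<lambda>z. indicator ?Q z * \<bar>f z\<bar>)"
    using integrable_abs[OF int] by (simp add: abs_mult)
  have "(\<integral>\<^sup>+\<omega>. ennreal (\<Sum>z\<in>off_diag t \<omega>. \<bar>f z\<bar>) \<partial>M) = (\<integral>\<^sup>+z. ennreal \<bar>f z\<bar> * indicator ?Q z \<partial>lborel)"
    by (subst campbell(2)[symmetric]) (auto simp: sum_ennreal)
  also have "\<dots> = (\<integral>\<^sup>+z. ennreal (indicator ?Q z * \<bar>f z\<bar>) \<partial>lborel)"
    by (intro nn_integral_cong) (auto simp: indicator_def)
  also have "\<dots> = ennreal (LINT z|lborel. indicator ?Q z * \<bar>f z\<bar>)"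
    using absint by (intro nn_integral_eq_integral) auto
  finally have nn: "(\<integral>\<^sup>+\<omega>. ennreal (\<Sum>z\<in>off_diag t \<omega>. \<bar>f z\<bar>) \<partial>M) = ennreal (LINT z|lborel. indicator ?Q z * \<bar>f z\<bar>)" .
  then show ai: "integrable M (\<lambda>\<omega>. \<Sum>z\<in>off_diag t \<omega>. \<bar>f z\<bar>)"
    by (intro integrableI_bounded) (auto simp: sum_nonneg)
  show eq: "(LINT \<omega>|M. (\<Sum>z\<in>off_diag t \<omega>. \<bar>f z\<bar>)) = (LINT z|lborel. indicator ?Q z * \<bar>f z\<bar>)"
    using nn by (subst integral_eq_nn_integral) (auto simp: sum_nonneg integral_nonneg_AE)
  show i: "integrable M (\<lambda>\<omega>. \<Sum>z\<in>off_diag t \<omega>. f z)"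
    by (rule Bochner_Integration.integrable_bound[OF ai]) (auto intro!: AE_I2 order.trans[OF sum_abs] simp: sum_nonneg)
  have "(LINT \<omega>|M. \<bar>\<Sum>z\<in>off_diag t \<omega>. f z\<bar>) \<le> (LINT \<omega>|M. (\<Sum>z\<in>off_diag t \<omega>. \<bar>f z\<bar>))"
    using i ai by (intro integral_mono) auto
  then show "(LINT \<omega>|M. \<bar>\<Sum>z\<in>off_diag t \<omega>. f z\<bar>) \<le> (LINT z|lborel. indicator ?Q z * \<bar>f z\<bar>)"
    using eq by simp
qed

section \<open>Double stochastic integrals as sums over pairs of points\<close>

lemma elementary_integral_measurable:
  assumes "elementary_data m c A"
  shows "elementary_integral \<Xi> m c A \<in> borel_measurable M"
proof -
  have "(\<lambda>\<omega>. real (num_points \<Xi> (A i) \<omega>)) \<in> borel_measurable M" if "i < m" for i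
    using that assms by (intro measurable_compose[OF num_points_measurable]) (auto simp: elementary_data_def)
  then show ?thesis
    unfolding elementary_integral_def[abs_def]
    by (intro borel_measurable_sum borel_measurable_times borel_measurable_const) auto
qed

lemma elementary_measurable:
  assumes "elementary_data m c A"
  shows "elementary m c A \<in> borel_measurable borel"
proof -
  have "A i \<times> A j \<in> sets borel" if "i < m" "j < m" for i j
    using that assms unfolding borel_prod[symmetric] by (auto simp: elementary_data_def)
  then show ?thesis
    unfolding elementary_def[abs_def]
    by (intro borel_measurable_sum borel_measurable_times borel_measurable_const borel_measurable_indicator) auto
qed

lemma elementary_on_rectangle:
  assumes data: "elementary_data m c A" and ij: "i < m" "j < m" and z: "z \<in> A i \<times> A j"
  shows "elementary m c A z = c i j"
proof -
  have dis: "disjoint_family_on A {..<m}" using data by (simp add: elementary_data_def)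
  have "elementary m c A z = step_fn A {..<m} c z"
    by (simp add: elementary_def step_fn_def)
  also have "\<dots> = c i j"
    using step_fn_eq[OF _ dis, of i "fst z" j "snd z" c] ij z by auto
  finally show ?thesis .
qed

end

lemma indicator_mult_eq_of_support:
  fixes f :: "'z \<Rightarrow> real"
  assumes "\<And>z. z \<notin> S \<Longrightarrow> f z = 0" "S \<subseteq> T"
  shows "indicator S z * f z = indicator T z *\<^sub>R f z"
  using assms by (cases "z \<in> S") (auto simp: indicator_def)

text \<open>If one set is infinite and the other nonempty, the product of the counts is unbounded.
  Hence both are finite or one is empty; in the latter case both sides are 0, even if the other set
  is infinite.\<close>

lemma eventually_card_mult_eq:
  fixes X Y :: "real set"
  assumes fin: "\<And>t. finite (X \<inter> {0..t})" "\<And>t. finite (Y \<inter> {0..t})" and nn: "X \<subseteq> {0..}" "Y \<subseteq> {0..}"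
    and bound: "\<And>t::nat. card (X \<inter> {0..real t}) * card (Y \<inter> {0..real t}) \<le> C"
  shows "\<forall>\<^sub>F t::nat in sequentially. card (X \<inter> {0..real t}) * card (Y \<inter> {0..real t}) = card X * card Y"
proof -
  have finite: "finite X"
    if fX: "\<And>t. finite (X \<inter> {0..t})" and fY: "\<And>t. finite (Y \<inter> {0..t})" and X0: "X \<subseteq> {0..}" and Y: "Y \<noteq> {}" "Y \<subseteq> {0..}"
      and b: "\<And>t::nat. card (X \<inter> {0..real t}) * card (Y \<inter> {0..real t}) \<le> C" for X Y :: "real set"
  proof (rule ccontr)
    assume inf: "infinite X"
    obtain F where F: "F \<subseteq> X" "finite F" "card F = Suc C"
      using infinite_arbitrarily_large[OF inf] by metis
    obtain y where y: "y \<in> Y" using Y by auto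
    have "finite (insert y F)" using F by simp
    then obtain t :: nat where t: "\<forall>x\<in>insert y F. x \<le> real t"
      by (rule finite_le_natE)
    have "Suc C \<le> card (X \<inter> {0..real t})"
      using F t X0 fX[of "real t"] by (subst F(3)[symmetric], intro card_mono) auto
    moreover have "y \<in> Y \<inter> {0..real t}" using y t Y by auto
    then have "1 \<le> card (Y \<inter> {0..real t})"
      using fY[of "real t"] by (metis One_nat_def Suc_leI card_gt_0_iff empty_iff)
    ultimately have "Suc C * 1 \<le> card (X \<inter> {0..real t}) * card (Y \<inter> {0..real t})"
      by (intro mult_le_mono)
    then show False using b[of t] by simp
  qed
  have stab: "\<forall>\<^sub>F t::nat in sequentially. Z \<inter> {0..real t} = Z" if "finite Z" "Z \<subseteq> {0..}" for Z :: "real set"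
  proof -
    obtain T :: nat where T: "\<forall>x\<in>Z. x \<le> real T"
      using finite_le_natE[OF \<open>finite Z\<close>] .
    have "Z \<inter> {0..real t} = Z" if "T \<le> t" for t
    proof -
      have "x \<le> real t" if "x \<in> Z" for x
        using T that \<open>T \<le> t\<close> by (meson of_nat_mono order.trans)
      then show ?thesis using \<open>Z \<subseteq> {0..}\<close> by auto
    qed
    then show ?thesis by (auto simp: eventually_sequentially)
  qed
  show ?thesis
  proof (cases "X = {} \<or> Y = {}")
    case True
    then show ?thesis by auto
  next
    case False
    have bound': "card (Y \<inter> {0..real t}) * card (X \<inter> {0..real t}) \<le> C" for t
      using bound[of t] by (simp only: mult.commute)
    have "X \<noteq> {}" "Y \<noteq> {}" using False by auto
    then have "finite X" "finite Y"
      using finite[OF fin(1,2) nn(1) _ nn(2) bound] finite[OF fin(2,1) nn(2) _ nn(1) bound'] by blast+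
    then have "\<forall>\<^sub>F t::nat in sequentially. X \<inter> {0..real t} = X" "\<forall>\<^sub>F t::nat in sequentially. Y \<inter> {0..real t} = Y"
      using stab nn by auto
    then show ?thesis by eventually_elim simp
  qed
qed

context rate1_process
begin

lemma off_diag_mono: "s \<le> t \<Longrightarrow> off_diag s \<omega> \<subseteq> off_diag t \<omega>"
  unfolding off_diag_def by auto

text \<open>A set of infinite measure occurs in an elementary function with a nonzero coefficient only
  next to a null set; instead of treating this case separately, finiteness of the sum over all
  pairs already forces the relevant counts to be finite or paired with an empty set.\<close>

lemma eventually_elementary_integral_eq:
  assumes data: "elementary_data m c A" and \<omega>: "\<omega> \<in> space M"
    and fin: "(SUP t. \<Sum>z\<in>off_diag (real t) \<omega>. ennreal \<bar>elementary m c A z\<bar>) < \<infinity>"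
  shows "\<forall>\<^sub>F t in sequentially. (\<Sum>z\<in>off_diag (real t) \<omega>. elementary m c A z) = elementary_integral \<Xi> m c A \<omega>"
proof -
  have dis: "A i \<inter> A j = {}" if "i < m" "j < m" "i \<noteq> j" for i j
    using data that by (auto simp: elementary_data_def disjoint_family_on_def)
  have c0: "c i i = 0" if "i < m" for i using data that by (auto simp: elementary_data_def)
  let ?N = "\<lambda>t i. card (\<Xi> \<omega> \<inter> A i \<inter> {0..real t})"
  have card_eq: "card (off_diag (real t) \<omega> \<inter> (A i \<times> A j)) = ?N t i * ?N t j" if "i < m" "j < m" "i \<noteq> j" for t i j
  proof -
    have "off_diag (real t) \<omega> \<inter> (A i \<times> A j) = (\<Xi> \<omega> \<inter> A i \<inter> {0..real t}) \<times> (\<Xi> \<omega> \<inter> A j \<inter> {0..real t})"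
      using dis[OF that] by (auto simp: off_diag_def)
    then show ?thesis by (simp add: card_cartesian_product)
  qed
  have sum_eq: "(\<Sum>z\<in>off_diag (real t) \<omega>. elementary m c A z) = (\<Sum>i<m. \<Sum>j<m. c i j * real (?N t i * ?N t j))" for t
  proof -
    have "(\<Sum>z\<in>off_diag (real t) \<omega>. elementary m c A z)
        = (\<Sum>i<m. \<Sum>j<m. c i j * (\<Sum>z\<in>off_diag (real t) \<omega>. indicator (A i \<times> A j) z))"
      unfolding elementary_def sum_distrib_left by (subst sum.swap, intro sum.cong refl, rule sum.swap)
    also have "\<dots> = (\<Sum>i<m. \<Sum>j<m. c i j * real (?N t i * ?N t j))"
    proof (intro sum.cong refl)
      fix i j assume ij: "i \<in> {..<m}" "j \<in> {..<m}"
      have "(\<Sum>z\<in>off_diag (real t) \<omega>. indicator (A i \<times> A j) z :: real) = real (card (off_diag (real t) \<omega> \<inter> (A i \<times> A j)))"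
        using finite_off_diag[OF \<omega>] by (rule sum_indicator_card_real)
      then show "c i j * (\<Sum>z\<in>off_diag (real t) \<omega>. indicator (A i \<times> A j) z) = c i j * real (?N t i * ?N t j)"
        using ij c0 card_eq[of i j t] by (cases "i = j") auto
    qed
    finally show ?thesis .
  qed
  have ev: "\<forall>\<^sub>F t in sequentially. c i j * real (?N t i * ?N t j)
      = c i j * real (card (\<Xi> \<omega> \<inter> A i) * card (\<Xi> \<omega> \<inter> A j))" if ij: "i < m" "j < m" for i j
  proof (cases "c i j = 0")
    case False
    then have neq: "i \<noteq> j" using c0 ij by auto
    \<comment> \<open>A single nonzero coefficient bounds the number of pairs in its rectangle,
      since each of them adds |\<open>c i j\<close>| to the sum.\<close>
    define S where "S = (SUP t. \<Sum>z\<in>off_diag (real t) \<omega>. ennreal \<bar>elementary m c A z\<bar>)"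
    have "ennreal (real (?N t i * ?N t j) * \<bar>c i j\<bar>) \<le> S" for t
    proof -
      have "ennreal (real (?N t i * ?N t j) * \<bar>c i j\<bar>) = (\<Sum>z\<in>off_diag (real t) \<omega> \<inter> (A i \<times> A j). ennreal \<bar>c i j\<bar>)"
        using card_eq[OF ij neq, of t] by (simp add: ennreal_mult ennreal_of_nat_eq_real_of_nat)
      also have "\<dots> = (\<Sum>z\<in>off_diag (real t) \<omega> \<inter> (A i \<times> A j). ennreal \<bar>elementary m c A z\<bar>)"
        by (intro sum.cong refl) (auto simp: elementary_on_rectangle[OF data ij])
      also have "\<dots> \<le> (\<Sum>z\<in>off_diag (real t) \<omega>. ennreal \<bar>elementary m c A z\<bar>)"
        by (intro sum_mono2 finite_off_diag \<omega>) auto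
      also have "\<dots> \<le> S" unfolding S_def by (intro SUP_upper) auto
      finally show ?thesis .
    qed
    moreover obtain s where s: "S = ennreal s" "0 \<le> s" using fin unfolding S_def[symmetric] by (cases S rule: ennreal_cases) auto
    ultimately have le: "real (?N t i * ?N t j) * \<bar>c i j\<bar> \<le> s" for t by simp
    have "real (?N t i * ?N t j) \<le> s / \<bar>c i j\<bar>" for t
      using le[of t] False by (simp add: field_simps)
    then have "?N t i * ?N t j \<le> nat \<lceil>s / \<bar>c i j\<bar>\<rceil>" for t
      by (metis le_nat_iff le_ceiling_iff nat_ceiling_le_eq of_nat_le_iff order.trans real_nat_ceiling_ge)
    then have "\<forall>\<^sub>F t in sequentially. ?N t i * ?N t j = card (\<Xi> \<omega> \<inter> A i) * card (\<Xi> \<omega> \<inter> A j)"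
      using finite_points[OF \<omega>] points_nonneg[OF \<omega>]
      by (intro eventually_card_mult_eq) (auto intro: finite_subset[rotated])
    then show ?thesis by eventually_elim simp
  qed simp
  have "\<forall>\<^sub>F t in sequentially. \<forall>i\<in>{..<m}. \<forall>j\<in>{..<m}. c i j * real (?N t i * ?N t j)
      = c i j * real (card (\<Xi> \<omega> \<inter> A i) * card (\<Xi> \<omega> \<inter> A j))"
    using ev by (intro eventually_ball_finite ballI) auto
  then show ?thesis
  proof eventually_elim
    case (elim t)
    then show ?case
      unfolding sum_eq elementary_integral_def num_points_def by (intro sum.cong refl) (auto simp: mult.assoc)
  qed
qed

lemma nn_integral_SUP_off_diag_le:
  fixes g :: "real \<times> real \<Rightarrow> real"
  assumes [measurable]: "g \<in> borel_measurable borel"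
  shows "(\<lambda>\<omega>. SUP t. \<Sum>z\<in>off_diag (real t) \<omega>. ennreal \<bar>g z\<bar>) \<in> borel_measurable M"
    and "(\<integral>\<^sup>+\<omega>. (SUP t. \<Sum>z\<in>off_diag (real t) \<omega>. ennreal \<bar>g z\<bar>) \<partial>M) \<le> (\<integral>\<^sup>+z. ennreal \<bar>indicator quadrant z *\<^sub>R g z\<bar> \<partial>lborel)"
proof -
  have m: "(\<lambda>\<omega>. \<Sum>z\<in>off_diag t \<omega>. ennreal \<bar>g z\<bar>) \<in> borel_measurable M" for t
    by (rule campbell(1)) measurable
  then show "(\<lambda>\<omega>. SUP t. \<Sum>z\<in>off_diag (real t) \<omega>. ennreal \<bar>g z\<bar>) \<in> borel_measurable M" by measurable
  \<comment> \<open>Finiteness of the windows is known only on the space of \<open>M\<close>.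
    Elsewhere the sums need not increase with the window; setting them to 0 gives a sequence that is
    monotone everywhere.\<close>
  define f where "f t \<omega> = (if \<omega> \<in> space M then \<Sum>z\<in>off_diag (real t) \<omega>. ennreal \<bar>g z\<bar> else 0)" for t :: nat and \<omega>
  have fm: "f t \<in> borel_measurable M" for t
    using m[of "real t"] by (subst measurable_cong[of M _ "\<lambda>\<omega>. \<Sum>z\<in>off_diag (real t) \<omega>. ennreal \<bar>g z\<bar>"]) (auto simp: f_def)
  have inc: "incseq f"
    unfolding incseq_def le_fun_def f_def
  proof (intro allI impI)
    fix s t :: nat and \<omega> assume "s \<le> t"
    then have "off_diag (real s) \<omega> \<subseteq> off_diag (real t) \<omega>" by (intro off_diag_mono) simp
    then show "(if \<omega> \<in> space M then \<Sum>z\<in>off_diag (real s) \<omega>. ennreal \<bar>g z\<bar> else 0)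
        \<le> (if \<omega> \<in> space M then \<Sum>z\<in>off_diag (real t) \<omega>. ennreal \<bar>g z\<bar> else 0)"
      using finite_off_diag by (auto intro!: sum_mono2)
  qed
  have "(\<integral>\<^sup>+\<omega>. (SUP t. \<Sum>z\<in>off_diag (real t) \<omega>. ennreal \<bar>g z\<bar>) \<partial>M) = (\<integral>\<^sup>+\<omega>. (SUP t. f t \<omega>) \<partial>M)"
    by (intro nn_integral_cong) (simp add: f_def)
  also have "\<dots> = (SUP t. \<integral>\<^sup>+\<omega>. f t \<omega> \<partial>M)"
    by (rule nn_integral_monotone_convergence_SUP[OF inc fm])
  also have "\<dots> \<le> (\<integral>\<^sup>+z. ennreal \<bar>indicator quadrant z *\<^sub>R g z\<bar> \<partial>lborel)"
  proof (rule SUP_least)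
    fix t
    have "(\<integral>\<^sup>+\<omega>. f t \<omega> \<partial>M) = (\<integral>\<^sup>+\<omega>. (\<Sum>z\<in>off_diag (real t) \<omega>. ennreal \<bar>g z\<bar>) \<partial>M)"
      by (intro nn_integral_cong) (simp add: f_def)
    also have "\<dots> = (\<integral>\<^sup>+z. ennreal \<bar>g z\<bar> * indicator ({0..real t} \<times> {0..real t}) z \<partial>lborel)"
      by (rule campbell(2)) measurable
    also have "\<dots> \<le> (\<integral>\<^sup>+z. ennreal \<bar>indicator quadrant z *\<^sub>R g z\<bar> \<partial>lborel)"
      by (intro nn_integral_mono) (auto simp: indicator_def)
    finally show "(\<integral>\<^sup>+\<omega>. f t \<omega> \<partial>M) \<le> (\<integral>\<^sup>+z. ennreal \<bar>indicator quadrant z *\<^sub>R g z\<bar> \<partial>lborel)" .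
  qed
  finally show "(\<integral>\<^sup>+\<omega>. (SUP t. \<Sum>z\<in>off_diag (real t) \<omega>. ennreal \<bar>g z\<bar>) \<partial>M) \<le> (\<integral>\<^sup>+z. ennreal \<bar>indicator quadrant z *\<^sub>R g z\<bar> \<partial>lborel)" .
qed

lemma off_diag_stable:
  assumes f0: "\<And>z. z \<notin> {0..a} \<times> {0..a} \<Longrightarrow> f z = (0 :: real)" and t: "a \<le> t" and \<omega>: "\<omega> \<in> space M"
  shows "(\<Sum>z\<in>off_diag t \<omega>. f z) = (\<Sum>z\<in>off_diag a \<omega>. f z)"
proof (rule sum.mono_neutral_right[OF finite_off_diag[OF \<omega>] off_diag_mono[OF t]])
  show "\<forall>z\<in>off_diag t \<omega> - off_diag a \<omega>. f z = 0"
    by (auto intro!: f0 simp: off_diag_def)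
qed

text \<open>Almost surely both terms are sums over the pairs in one large window, so they differ by
  at most a sum of the absolute difference of the integrands, whose mean Campbell's formula bounds
  by the L1 distance.\<close>

lemma elementary_integral_L1:
  fixes f :: "real \<times> real \<Rightarrow> real"
  assumes data: "elementary_data m c A"
    and f [measurable]: "f \<in> borel_measurable borel" and fi: "set_integrable lborel quadrant f"
    and f0: "\<And>z. z \<notin> {0..a} \<times> {0..a} \<Longrightarrow> f z = 0"
  shows "integrable M (elementary_integral \<Xi> m c A)"
    and "(LINT \<omega>|M. \<bar>elementary_integral \<Xi> m c A \<omega> - (\<Sum>z\<in>off_diag a \<omega>. f z)\<bar>)
      \<le> (LINT z:quadrant|lborel. \<bar>elementary m c A z - f z\<bar>)"
proof -
  let ?e = "elementary m c A" and ?E = "elementary_integral \<Xi> m c A" and ?Z = "\<lambda>\<omega>. \<Sum>z\<in>off_diag a \<omega>. f z"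
  have e [measurable]: "?e \<in> borel_measurable borel" by (rule elementary_measurable[OF data])
  have E [measurable]: "?E \<in> borel_measurable M" by (rule elementary_integral_measurable[OF data])
  have ei: "set_integrable lborel quadrant ?e" using data by (simp add: elementary_data_def)
  have "integrable lborel (\<lambda>z. indicator ({0..a} \<times> {0..a}) z * f z)"
  proof -
    have "(\<lambda>z. indicator ({0..a} \<times> {0..a}) z * f z) = (\<lambda>z. indicator quadrant z *\<^sub>R f z)"
      using f0 by (intro ext indicator_mult_eq_of_support) auto
    then show ?thesis using fi by (simp add: set_integrable_def)
  qed
  then have Z: "integrable M ?Z" by (intro off_diag_integrable f)
  have "(\<integral>\<^sup>+\<omega>. (SUP t. \<Sum>z\<in>off_diag (real t) \<omega>. ennreal \<bar>?e z\<bar>) \<partial>M) \<le> (\<integral>\<^sup>+z. ennreal \<bar>indicator quadrant z *\<^sub>R ?e z\<bar> \<partial>lborel)"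
    by (rule nn_integral_SUP_off_diag_le(2)) measurable
  also have "\<dots> < \<infinity>"
    using ei by (auto simp: set_integrable_def integrable_iff_bounded)
  finally have "AE \<omega> in M. (SUP t. \<Sum>z\<in>off_diag (real t) \<omega>. ennreal \<bar>?e z\<bar>) \<noteq> \<infinity>"
    by (intro nn_integral_PInf_AE nn_integral_SUP_off_diag_le) auto
  then have bound: "AE \<omega> in M. ennreal \<bar>?E \<omega> - ?Z \<omega>\<bar> \<le> (SUP t. \<Sum>z\<in>off_diag (real t) \<omega>. ennreal \<bar>?e z - f z\<bar>)"
  proof (rule AE_mp, intro AE_I2 impI)
    fix \<omega> assume \<omega>: "\<omega> \<in> space M" and "(SUP t. \<Sum>z\<in>off_diag (real t) \<omega>. ennreal \<bar>?e z\<bar>) \<noteq> \<infinity>"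
    then have "\<forall>\<^sub>F t in sequentially. (\<Sum>z\<in>off_diag (real t) \<omega>. ?e z) = ?E \<omega>"
      by (intro eventually_elementary_integral_eq[OF data \<omega>]) (simp only: infinity_ennreal_def less_top)
    moreover have "\<forall>\<^sub>F t in sequentially. a \<le> real t"
      by (rule eventually_compose_filterlim[OF eventually_ge_at_top filterlim_real_sequentially])
    ultimately have "\<forall>\<^sub>F t in sequentially. (\<Sum>z\<in>off_diag (real t) \<omega>. ?e z) = ?E \<omega> \<and> a \<le> real t"
      by eventually_elim simp
    then obtain t :: nat where t: "(\<Sum>z\<in>off_diag (real t) \<omega>. ?e z) = ?E \<omega>" "a \<le> real t"
      by (auto simp: eventually_sequentially)
    have "\<bar>?E \<omega> - ?Z \<omega>\<bar> = \<bar>\<Sum>z\<in>off_diag (real t) \<omega>. ?e z - f z\<bar>"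
      using t(1) off_diag_stable[where f = f, OF f0 t(2) \<omega>] by (simp add: sum_subtractf)
    also have "\<dots> \<le> (\<Sum>z\<in>off_diag (real t) \<omega>. \<bar>?e z - f z\<bar>)" by (rule sum_abs)
    finally have "ennreal \<bar>?E \<omega> - ?Z \<omega>\<bar> \<le> (\<Sum>z\<in>off_diag (real t) \<omega>. ennreal \<bar>?e z - f z\<bar>)"
      by (simp add: sum_ennreal ennreal_leI)
    also have "\<dots> \<le> (SUP t. \<Sum>z\<in>off_diag (real t) \<omega>. ennreal \<bar>?e z - f z\<bar>)" by (intro SUP_upper) auto
    finally show "ennreal \<bar>?E \<omega> - ?Z \<omega>\<bar> \<le> (SUP t. \<Sum>z\<in>off_diag (real t) \<omega>. ennreal \<bar>?e z - f z\<bar>)" .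
  qed
  have di: "integrable lborel (\<lambda>z. indicator quadrant z *\<^sub>R (?e z - f z))"
    using set_integral_diff(1)[OF ei fi] by (simp add: set_integrable_def)
  have "(\<integral>\<^sup>+\<omega>. ennreal \<bar>?E \<omega> - ?Z \<omega>\<bar> \<partial>M) \<le> (\<integral>\<^sup>+\<omega>. (SUP t. \<Sum>z\<in>off_diag (real t) \<omega>. ennreal \<bar>?e z - f z\<bar>) \<partial>M)"
    by (rule nn_integral_mono_AE[OF bound])
  also have "\<dots> \<le> (\<integral>\<^sup>+z. ennreal \<bar>indicator quadrant z *\<^sub>R (?e z - f z)\<bar> \<partial>lborel)"
    by (rule nn_integral_SUP_off_diag_le(2)) measurable
  also have "\<dots> = ennreal (LINT z|lborel. \<bar>indicator quadrant z *\<^sub>R (?e z - f z)\<bar>)"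
    using di by (intro nn_integral_eq_integral) auto
  also have "(LINT z|lborel. \<bar>indicator quadrant z *\<^sub>R (?e z - f z)\<bar>) = (LINT z:quadrant|lborel. \<bar>?e z - f z\<bar>)"
    unfolding set_lebesgue_integral_def by (intro Bochner_Integration.integral_cong) (auto simp: indicator_def)
  finally have nn: "(\<integral>\<^sup>+\<omega>. ennreal \<bar>?E \<omega> - ?Z \<omega>\<bar> \<partial>M) \<le> ennreal (LINT z:quadrant|lborel. \<bar>?e z - f z\<bar>)" .
  have Zm [measurable]: "?Z \<in> borel_measurable M" using Z by auto
  have EZ: "integrable M (\<lambda>\<omega>. ?E \<omega> - ?Z \<omega>)"
    using nn by (intro integrableI_bounded) (auto intro: le_less_trans)
  then show "integrable M ?E"
    using Bochner_Integration.integrable_add[OF EZ Z] by simp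
  have "0 \<le> (LINT z:quadrant|lborel. \<bar>?e z - f z\<bar>)"
    unfolding set_lebesgue_integral_def by (intro integral_nonneg_AE) auto
  then show "(LINT \<omega>|M. \<bar>?E \<omega> - ?Z \<omega>\<bar>) \<le> (LINT z:quadrant|lborel. \<bar>?e z - f z\<bar>)"
    using nn EZ by (simp add: nn_integral_eq_integral)
qed

lemma has_stoch_integral_off_diag:
  fixes f :: "real \<times> real \<Rightarrow> real"
  assumes f: "f \<in> borel_measurable borel" and fi: "set_integrable lborel quadrant f"
    and f0: "\<And>z. z \<notin> {0..a} \<times> {0..a} \<Longrightarrow> f z = 0"
  shows "has_stoch_integral M \<Xi> f (\<lambda>\<omega>. \<Sum>z\<in>off_diag a \<omega>. f z)"
proof -
  have "(\<lambda>z. indicator ({0..a} \<times> {0..a}) z * f z) = (\<lambda>z. indicator quadrant z *\<^sub>R f z)"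
    using f0 by (intro ext indicator_mult_eq_of_support) auto
  then have Z: "integrable M (\<lambda>\<omega>. \<Sum>z\<in>off_diag a \<omega>. f z)"
    using fi by (intro off_diag_integrable f) (simp add: set_integrable_def)
  show ?thesis
    unfolding has_stoch_integral_def
  proof (intro conjI allI impI fi Z)
    fix m :: "nat \<Rightarrow> nat" and c A k
    assume *: "(\<forall>k. elementary_data (m k) (c k) (A k)) \<and>
      (\<lambda>k. LINT z:quadrant|lborel. \<bar>elementary (m k) (c k) (A k) z - f z\<bar>) \<longlonglongrightarrow> 0"
    then show "integrable M (elementary_integral \<Xi> (m k) (c k) (A k))"
      using elementary_integral_L1(1)[OF _ f fi f0] by blast
    show "(\<lambda>k. LINT \<omega>|M. \<bar>elementary_integral \<Xi> (m k) (c k) (A k) \<omega> - (\<Sum>z\<in>off_diag a \<omega>. f z)\<bar>) \<longlonglongrightarrow> 0"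
      using * by (intro tendsto_0_le_real[OF _ elementary_integral_L1(2)[OF _ f fi f0]]) auto
  qed
qed

end

section \<open>Approximation by elementary functions and uniqueness of the integral\<close>

lemma AE_lborel_coordinates_notin:
  fixes S :: "real set"
  assumes "finite S"
  shows "AE z in lborel. fst z \<notin> S \<and> snd z \<notin> S"
proof -
  have S: "S \<in> sets borel" "emeasure lborel S = 0"
    using assms by (auto intro: finite_imp_closed borel_closed emeasure_lborel_countable countable_finite)
  have "emeasure lborel (S \<times> (UNIV :: real set)) = 0" "emeasure lborel ((UNIV :: real set) \<times> S) = 0"
    using S by (simp_all add: emeasure_lborel_Times)
  moreover have "S \<times> (UNIV :: real set) \<in> sets borel" "(UNIV :: real set) \<times> S \<in> sets borel"
    unfolding borel_prod[symmetric] using S by measurable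
  ultimately have "AE z in lborel. z \<notin> S \<times> (UNIV :: real set)" "AE z in lborel. z \<notin> (UNIV :: real set) \<times> S"
    by (auto intro!: AE_not_in simp: null_sets_def)
  then show ?thesis by eventually_elim (auto simp: mem_Times_iff)
qed

context rate1_process
begin

text \<open>Without an approximating sequence the condition in \<open>has_stoch_integral\<close>
  would be void and would not determine the integral. The grid averages of \<open>f\<close> serve,
  with the diagonal cells deleted; these have total area at most \<open>a\<close> *
  \<open>p k\<close>, which tends to 0.\<close>

lemma elementary_approx_exists:
  fixes f :: "real \<times> real \<Rightarrow> real"
  assumes a: "0 < a" and f [measurable]: "f \<in> borel_measurable borel" and fB: "\<And>z. \<bar>f z\<bar> \<le> B"
    and f0: "\<And>z. z \<notin> {0..a} \<times> {0..a} \<Longrightarrow> f z = 0" and int: "integrable lborel f"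
  shows "\<exists>m c A. (\<forall>k::nat. elementary_data (m k) (c k) (A k)) \<and>
      (\<lambda>k. LINT z:quadrant|lborel. \<bar>elementary (m k) (c k) (A k) z - f z\<bar>) \<longlonglongrightarrow> 0"
proof -
  define p where "p k = a / real (Suc k)" for k
  define A where "A k i = cell (p k) (Suc i)" for k i
  define c where "c k i j = (if i = j then 0 else cell_avg (p k) f (Suc i) (Suc j))" for k i j
  let ?e = "\<lambda>k. elementary (Suc k) (c k) (A k)"
  have p: "0 < p k" "real (Suc k) * p k = a" for k using a by (auto simp: p_def)
  have p0: "p \<longlonglongrightarrow> 0"
    unfolding p_def using LIMSEQ_Suc[OF lim_const_over_n[of a]] by simp
  have disj: "disjoint_family_on (A k) {..<Suc k}" for k
    using disjoint_family_cell[OF p(1)] by (auto simp: A_def disjoint_family_on_def)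
  have e_meas [measurable]: "?e k \<in> borel_measurable borel" for k
  proof -
    have "?e k = step_fn (A k) {..<Suc k} (c k)" by (auto simp: elementary_def step_fn_def fun_eq_iff)
    then show ?thesis by (simp add: measurable_step_fn A_def)
  qed
  define D where "D k = (\<Union>u\<in>{1..Suc k}. cell (p k) u \<times> cell (p k) u)" for k
  have D [measurable]: "D k \<in> sets borel" for k
    unfolding D_def borel_prod[symmetric] by measurable
  have mD: "emeasure lborel (D k) \<le> ennreal (a * p k)" for k
  proof -
    have "emeasure lborel (D k) \<le> (\<Sum>u\<in>{1..Suc k}. emeasure lborel (cell (p k) u \<times> cell (p k) u))"
      unfolding D_def by (intro emeasure_subadditive_finite) (auto simp: borel_prod[symmetric])
    also have "\<dots> = (\<Sum>u\<in>{1..Suc k}. ennreal (p k * p k))"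
      using p(1)[of k] by (intro sum.cong refl) (simp add: emeasure_lborel_Times emeasure_cell ennreal_mult)
    also have "\<dots> = ennreal (real (Suc k) * p k * p k)"
      using p(1)[of k] by (simp add: ennreal_of_nat_eq_real_of_nat ennreal_mult[symmetric] mult.assoc del: of_nat_Suc)
    finally show ?thesis by (simp only: p)
  qed
  have B0: "0 \<le> B" using fB[of 0] by linarith
  have e_cases: "?e k z = (if z \<in> D k then 0 else indicator ({0<..a} \<times> {0<..a}) z * grid_avg (p k) f z)" for k z
  proof (cases z)
    case (Pair x y)
    show ?thesis
    proof (cases "x \<in> {0<..a} \<and> y \<in> {0<..a}")
      case True
      then obtain u v where uv: "u \<in> {1..Suc k}" "x \<in> cell (p k) u" "v \<in> {1..Suc k}" "y \<in> cell (p k) v"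
        using in_cellE[OF p(1)[of k]] p(2)[of k] by metis
      have "?e k z = step_fn (A k) {..<Suc k} (c k) (x, y)" by (simp add: elementary_def step_fn_def Pair)
      also have "\<dots> = c k (u - 1) (v - 1)"
        using uv by (intro step_fn_eq disj) (auto simp: A_def)
      also have "\<dots> = (if u = v then 0 else cell_avg (p k) f u v)"
        using uv by (auto simp: c_def)
      finally have "?e k z = (if u = v then 0 else cell_avg (p k) f u v)" .
      moreover have "z \<in> D k \<longleftrightarrow> u = v"
      proof
        assume "z \<in> D k"
        then obtain w where "x \<in> cell (p k) w" "y \<in> cell (p k) w" by (auto simp: D_def Pair)
        then show "u = v" using uv(2,4) by (simp add: cell_ceiling[OF p(1)])
      qed (use uv in \<open>auto simp: D_def Pair\<close>)
      ultimately show ?thesis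
        using grid_avg_on_cells[OF p(1) uv(2,4), of f] True Pair by auto
    next
      case False
      have sub: "cell (p k) u \<subseteq> {0<..a}" if "u \<in> {1..Suc k}" for u
        using that cell_subset[OF p(1)[of k], of u "Suc k"] p(2)[of k] by auto
      have "?e k z = step_fn (A k) {..<Suc k} (c k) (x, y)" by (simp add: elementary_def step_fn_def Pair)
      also have "\<dots> = 0"
      proof (rule step_fn_eq_0)
        have "A k u \<subseteq> {0<..a}" if "u \<in> {..<Suc k}" for u
          unfolding A_def using that by (intro sub) auto
        then show "x \<notin> (\<Union>u\<in>{..<Suc k}. A k u) \<or> y \<notin> (\<Union>u\<in>{..<Suc k}. A k u)"
          using False by blast
      qed
      finally show ?thesis using False Pair by auto
    qed
  qed
  have avgB: "\<bar>grid_avg (p k) f z\<bar> \<le> B" if "z \<in> D k" for k z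
  proof -
    have K: "integrable lborel (grid_kernel (p k) z)" "(LINT w|lborel. grid_kernel (p k) z w) = 1"
      using nn_integral_grid_kernel(1)[OF p(1), of k z] by (auto intro!: integrableI_bounded simp: integral_eq_nn_integral)
    have "\<bar>grid_avg (p k) f z\<bar> \<le> (LINT w|lborel. \<bar>grid_kernel (p k) z w * f w\<bar>)"
      unfolding grid_avg_def using integral_norm_bound[of lborel "\<lambda>w. grid_kernel (p k) z w * f w"] by simp
    also have "\<dots> \<le> (LINT w|lborel. grid_kernel (p k) z w * B)"
    proof (rule integral_mono)
      show "integrable lborel (\<lambda>w. \<bar>grid_kernel (p k) z w * f w\<bar>)"
        by (intro integrable_abs integrable_grid_kernel_mult p int)
      show "integrable lborel (\<lambda>w. grid_kernel (p k) z w * B)" using K by simp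
      show "\<bar>grid_kernel (p k) z w * f w\<bar> \<le> grid_kernel (p k) z w * B" for w
        using fB[of w] by (simp add: abs_mult mult_left_mono)
    qed
    finally show ?thesis using K by simp
  qed
  have data: "elementary_data (Suc k) (c k) (A k)" for k
    unfolding elementary_data_def
  proof (intro conjI allI impI disj)
    show "A k i \<in> sets borel" for i by (simp add: A_def)
    show "A k i \<subseteq> {0..}" if "i < Suc k" for i
      using cell_subset[OF p(1)[of k], of "Suc i" "Suc k"] that by (auto simp: A_def)
    show "c k i i = 0" for i by (simp add: c_def)
    show "set_integrable lborel quadrant (?e k)"
      unfolding set_integrable_def
    proof (rule Bochner_Integration.integrable_bound[OF grid_avg_integrable(1)[OF p(1) int]])
      have "quadrant \<in> sets (borel :: (real \<times> real) measure)" unfolding borel_prod[symmetric] by measurable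
      then show "(\<lambda>z. indicator quadrant z *\<^sub>R ?e k z) \<in> borel_measurable lborel" by simp
      show "AE z in lborel. norm (indicator quadrant z *\<^sub>R ?e k z) \<le> norm (grid_avg (p k) f z)"
        unfolding e_cases by (intro AE_I2) (auto simp: indicator_def)
    qed
  qed
  have bound: "(LINT z:quadrant|lborel. \<bar>?e k z - f z\<bar>)
      \<le> (LINT z|lborel. \<bar>grid_avg (p k) f z - f z\<bar>) + B * (a * p k)" for k
  proof -
    have Dfin: "emeasure lborel (D k) < \<infinity>" using mD[of k] by (rule le_less_trans) simp
    have DI: "integrable lborel (indicator (D k) :: _ \<Rightarrow> real)"
      using Dfin by (simp add: integrable_indicator_iff)
    have gi: "integrable lborel (\<lambda>z. \<bar>grid_avg (p k) f z - f z\<bar>)"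
      by (rule integrable_grid_avg_diff[OF p(1) int])
    have axes: "AE z in lborel. fst z \<notin> {0::real} \<and> snd z \<notin> {0::real}"
      by (rule AE_lborel_coordinates_notin) simp
    have "(LINT z:quadrant|lborel. \<bar>?e k z - f z\<bar>) \<le> (LINT z|lborel. \<bar>grid_avg (p k) f z - f z\<bar> + B * indicator (D k) z)"
      unfolding set_lebesgue_integral_def
    proof (rule integral_mono_AE')
      show "integrable lborel (\<lambda>z. \<bar>grid_avg (p k) f z - f z\<bar> + B * indicator (D k) z)"
        using gi DI by simp
      show "AE z in lborel. indicator quadrant z *\<^sub>R \<bar>?e k z - f z\<bar> \<le> \<bar>grid_avg (p k) f z - f z\<bar> + B * indicator (D k) z"
        using axes
      proof eventually_elim
        case (elim z)
        have "\<bar>?e k z - f z\<bar> \<le> \<bar>grid_avg (p k) f z - f z\<bar> + B * indicator (D k) z" if "z \<in> {0<..a} \<times> {0<..a}"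
          using avgB[of z k] that unfolding e_cases by (auto simp: indicator_def)
        moreover have "f z = 0 \<and> ?e k z = 0" if "z \<notin> {0<..a} \<times> {0<..a}"
        proof
          show "f z = 0" using that elim by (intro f0) (auto simp: mem_Times_iff)
          show "?e k z = 0" unfolding e_cases using that by auto
        qed
        ultimately show ?case using B0 by (cases "z \<in> {0<..a} \<times> {0<..a}") (auto simp: indicator_def split: if_splits)
      qed
      show "AE z in lborel. 0 \<le> \<bar>grid_avg (p k) f z - f z\<bar> + B * indicator (D k) z"
        using B0 by auto
    qed
    also have "\<dots> = (LINT z|lborel. \<bar>grid_avg (p k) f z - f z\<bar>) + B * measure lborel (D k)"
      using gi DI by simp
    also have "B * measure lborel (D k) \<le> B * (a * p k)"
      using mD[of k] a p(1)[of k] B0 by (intro mult_left_mono) (auto simp: measure_def intro!: enn2real_leI)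
    finally show ?thesis by simp
  qed
  have "(\<lambda>k. (LINT z|lborel. \<bar>grid_avg (p k) f z - f z\<bar>) + B * (a * p k)) \<longlonglongrightarrow> 0 + B * (a * 0)"
    by (intro tendsto_intros grid_avg_tendsto_L1 int p p0)
  then have "(\<lambda>k. LINT z:quadrant|lborel. \<bar>?e k z - f z\<bar>) \<longlonglongrightarrow> 0"
    by (intro tendsto_0_le_real[OF _ bound]) (auto simp: set_lebesgue_integral_def intro!: integral_nonneg_AE)
  then show ?thesis
    using data by (intro exI[of _ Suc] exI[of _ c] exI[of _ A]) auto
qed

text \<open>The version picked by the choice operator and the sum over pairs are L1 limits of one
  and the same sequence, hence equal almost everywhere.\<close>

lemma stoch_integral_eq_off_diag:
  fixes f :: "real \<times> real \<Rightarrow> real"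
  assumes a: "0 < a" and f: "f \<in> borel_measurable borel" and fB: "\<And>z. \<bar>f z\<bar> \<le> B"
    and f0: "\<And>z. z \<notin> {0..a} \<times> {0..a} \<Longrightarrow> f z = 0"
  shows "stoch_integral M \<Xi> f \<in> borel_measurable M"
    and "AE \<omega> in M. stoch_integral M \<Xi> f \<omega> = (\<Sum>z\<in>off_diag a \<omega>. f z)"
proof -
  let ?Z = "\<lambda>\<omega>. \<Sum>z\<in>off_diag a \<omega>. f z" and ?S = "stoch_integral M \<Xi> f"
  have Q: "{0..a} \<times> {0..a} \<in> sets (borel :: (real \<times> real) measure)" "quadrant \<in> sets (borel :: (real \<times> real) measure)"
    unfolding borel_prod[symmetric] by measurable
  have "emeasure lborel ({0..a} \<times> {0..a}) < \<infinity>"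
    using a by (simp add: emeasure_lborel_Times ennreal_mult_less_top)
  then have "integrable lborel (\<lambda>z. B * indicator ({0..a} \<times> {0..a}) z :: real)"
    using Q by (simp add: integrable_indicator_iff)
  then have int: "integrable lborel f"
  proof (rule Bochner_Integration.integrable_bound)
    have "norm (f z) \<le> norm (B * indicator ({0..a} \<times> {0..a}) z)" for z
      using fB[of z] f0[of z] by (cases "z \<in> {0..a} \<times> {0..a}") (auto simp del: mem_Times_iff)
    then show "AE z in lborel. norm (f z) \<le> norm (B * indicator ({0..a} \<times> {0..a}) z)" by simp
  qed (use f in simp)
  then have fi: "set_integrable lborel quadrant f"
    using Q unfolding set_integrable_def by (intro integrable_mult_indicator) auto
  have Z: "has_stoch_integral M \<Xi> f ?Z"
    by (rule has_stoch_integral_off_diag[OF f fi f0])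
  then have S: "has_stoch_integral M \<Xi> f ?S"
    unfolding stoch_integral_def by (rule someI[where P = "has_stoch_integral M \<Xi> f"])
  then show "?S \<in> borel_measurable M" by (auto simp: has_stoch_integral_def)
  obtain m c A where approx: "\<forall>k::nat. elementary_data (m k) (c k) (A k)"
      "(\<lambda>k. LINT z:quadrant|lborel. \<bar>elementary (m k) (c k) (A k) z - f z\<bar>) \<longlonglongrightarrow> 0"
    using elementary_approx_exists[OF a f fB f0 int] by blast
  let ?E = "\<lambda>k. elementary_integral \<Xi> (m k) (c k) (A k)"
  have iE: "integrable M (?E k)" for k
    using Z approx unfolding has_stoch_integral_def by blast
  have iZ: "integrable M ?Z" and iS: "integrable M ?S"
    using Z S by (auto simp: has_stoch_integral_def)
  have lim: "(\<lambda>k. LINT \<omega>|M. \<bar>?E k \<omega> - ?Z \<omega>\<bar>) \<longlonglongrightarrow> 0" "(\<lambda>k. LINT \<omega>|M. \<bar>?E k \<omega> - ?S \<omega>\<bar>) \<longlonglongrightarrow> 0"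
    using Z S approx unfolding has_stoch_integral_def by blast+
  have "(LINT \<omega>|M. \<bar>?S \<omega> - ?Z \<omega>\<bar>) \<le> (LINT \<omega>|M. \<bar>?E k \<omega> - ?Z \<omega>\<bar>) + (LINT \<omega>|M. \<bar>?E k \<omega> - ?S \<omega>\<bar>)" for k
  proof -
    have "(LINT \<omega>|M. \<bar>?S \<omega> - ?Z \<omega>\<bar>) \<le> (LINT \<omega>|M. \<bar>?E k \<omega> - ?Z \<omega>\<bar> + \<bar>?E k \<omega> - ?S \<omega>\<bar>)"
      using iE iZ iS by (intro integral_mono) auto
    then show ?thesis using iE iZ iS by simp
  qed
  moreover have "(\<lambda>k. (LINT \<omega>|M. \<bar>?E k \<omega> - ?Z \<omega>\<bar>) + (LINT \<omega>|M. \<bar>?E k \<omega> - ?S \<omega>\<bar>)) \<longlonglongrightarrow> 0"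
    using tendsto_add[OF lim] by simp
  ultimately have "(LINT \<omega>|M. \<bar>?S \<omega> - ?Z \<omega>\<bar>) \<le> 0"
    by (intro LIMSEQ_le_const) auto
  moreover have "0 \<le> (LINT \<omega>|M. \<bar>?S \<omega> - ?Z \<omega>\<bar>)" by (intro integral_nonneg_AE) auto
  ultimately have "(LINT \<omega>|M. \<bar>?S \<omega> - ?Z \<omega>\<bar>) = 0" by linarith
  then have "AE \<omega> in M. \<bar>?S \<omega> - ?Z \<omega>\<bar> = 0"
    using iZ iS by (subst (asm) integral_nonneg_eq_0_iff_AE) auto
  then show "AE \<omega> in M. ?S \<omega> = ?Z \<omega>" by eventually_elim simp
qed

section \<open>Products over pairs of points\<close>

lemma ordered_pairs_off_diag: "ordered_pairs (\<Xi> \<omega> \<inter> {0..a}) = off_diag a \<omega> \<inter> {(x, y). x < y}"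
  by (auto simp: ordered_pairs_def off_diag_def)

text \<open>The factors are complex and may be 0, which blocks the passage to a sum of logarithms.
  For a simple function the product is a finite product of powers whose exponents are counts of
  pairs; pointwise limits give the rest.\<close>

lemma measurable_prod_pairs:
  fixes f :: "real \<times> real \<Rightarrow> complex"
  assumes f: "f \<in> borel_measurable borel"
  shows "(\<lambda>\<omega>. \<Prod>z\<in>ordered_pairs (\<Xi> \<omega> \<inter> {0..a}). f z) \<in> borel_measurable M"
proof -
  let ?O = "\<lambda>\<omega>. ordered_pairs (\<Xi> \<omega> \<inter> {0..a})"
  have fin: "finite (?O \<omega>)" if "\<omega> \<in> space M" for \<omega>
    using finite_points[OF that] by simp
  obtain F where F: "\<And>i. simple_function borel (F i)" and lim: "\<And>z. (\<lambda>i. F i z) \<longlonglongrightarrow> f z"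
    using borel_measurable_implies_sequence_metric[OF f, of 0] by auto
  have "(\<lambda>\<omega>. \<Prod>z\<in>?O \<omega>. F i z) \<in> borel_measurable M" for i
  proof -
    let ?N = "\<lambda>c \<omega>. card (off_diag a \<omega> \<inter> ({(x, y). x < y} \<inter> F i -` {c}))"
    have fr: "finite (range (F i))" using F[of i] by (simp add: simple_function_def)
    have prod_eq: "(\<Prod>z\<in>?O \<omega>. F i z) = (\<Prod>c\<in>range (F i). c ^ ?N c \<omega>)" if \<omega>: "\<omega> \<in> space M" for \<omega>
    proof -
      have "(\<Prod>z\<in>?O \<omega>. F i z) = (\<Prod>c\<in>range (F i). \<Prod>z\<in>{z\<in>?O \<omega>. F i z = c}. F i z)"
        by (rule prod.group[symmetric]) (use fin[OF \<omega>] fr in auto)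
      also have "\<dots> = (\<Prod>c\<in>range (F i). c ^ card {z\<in>?O \<omega>. F i z = c})"
      proof (intro prod.cong refl)
        fix c
        have "(\<Prod>z\<in>{z\<in>?O \<omega>. F i z = c}. F i z) = (\<Prod>z\<in>{z\<in>?O \<omega>. F i z = c}. c)"
          by (intro prod.cong) auto
        then show "(\<Prod>z\<in>{z\<in>?O \<omega>. F i z = c}. F i z) = c ^ card {z\<in>?O \<omega>. F i z = c}" by simp
      qed
      also have "\<dots> = (\<Prod>c\<in>range (F i). c ^ ?N c \<omega>)"
        by (intro prod.cong refl arg_cong[of _ _ "\<lambda>S. _ ^ card S"]) (auto simp: ordered_pairs_off_diag)
      finally show ?thesis .
    qed
    have N: "?N c \<in> measurable M (count_space UNIV)" for c
    proof -
      have "open {z. fst z < (snd z :: real)}" by (intro open_Collect_less continuous_intros)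
      then have less: "{(x, y). x < (y::real)} \<in> sets borel" by (simp add: case_prod_beta' borel_open)
      have "F i -` {c} \<in> sets borel" using simple_functionD(2)[OF F[of i], of "{c}"] by simp
      then have B: "{(x, y). x < y} \<inter> F i -` {c} \<in> sets borel" using less by (rule sets.Int[rotated])
      have "(\<lambda>\<omega>. \<Sum>z\<in>off_diag a \<omega>. indicator ({(x, y). x < y} \<inter> F i -` {c}) z :: ennreal) \<in> borel_measurable M"
        using campbell_indicator[OF B, of a] by blast
      then have m: "(\<lambda>\<omega>. of_nat (?N c \<omega>) :: ennreal) \<in> borel_measurable M"
        by (subst (asm) measurable_cong[OF sum_indicator_card[OF finite_off_diag]])
      have "{\<omega>\<in>space M. ?N c \<omega> = k} = (\<lambda>\<omega>. of_nat (?N c \<omega>) :: ennreal) -` {of_nat k} \<inter> space M" for k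
        by auto
      also have "\<dots> k \<in> sets M" for k
        using m by (rule measurable_sets) auto
      finally have "{\<omega>\<in>space M. ?N c \<omega> = k} \<in> sets M" for k .
      then show ?thesis
        by (auto simp: measurable_count_space_eq2_countable vimage_def Int_def conj_commute)
    qed
    have "(\<lambda>\<omega>. \<Prod>c\<in>range (F i). c ^ ?N c \<omega>) \<in> borel_measurable M"
      by (intro borel_measurable_prod measurable_compose[OF N]) simp
    then show ?thesis
      by (subst measurable_cong[OF prod_eq])
  qed
  then show ?thesis
    by (rule borel_measurable_LIMSEQ_metric[where f = "\<lambda>i \<omega>. \<Prod>z\<in>?O \<omega>. F i z"]) (intro tendsto_prod lim)
qed

text \<open>The Poisson counterpart of \<open>edge_gf\<close>: points of the process replace the
  selected vertices and a kernel replaces the matrix.\<close>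

definition Psi :: "real \<Rightarrow> complex \<Rightarrow> (real \<times> real \<Rightarrow> real) \<Rightarrow> complex" where
  "Psi a z W = (LINT \<omega>|M. pair_prod (\<lambda>x y. 1 - (1 - z) * of_real (W (x, y))) (\<Xi> \<omega> \<inter> {0..a}))"

lemma pair_prod_points_measurable:
  assumes W [measurable]: "W \<in> borel_measurable borel"
  shows "(\<lambda>\<omega>. pair_prod (\<lambda>x y. 1 - (1 - z) * of_real (W (x, y))) (\<Xi> \<omega> \<inter> {0..a})) \<in> borel_measurable M"
proof -
  have "(\<lambda>\<omega>. \<Prod>w\<in>ordered_pairs (\<Xi> \<omega> \<inter> {0..a}). 1 - (1 - z) * of_real (W w)) \<in> borel_measurable M"
    by (intro measurable_prod_pairs) measurable
  then show ?thesis by (simp add: pair_prod_def case_prod_beta)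
qed

lemma pair_prod_points_integrable:
  assumes W: "W \<in> borel_measurable borel" and W01: "\<And>w. 0 \<le> W w \<and> W w \<le> 1" and z: "norm z \<le> 1"
  shows "integrable M (\<lambda>\<omega>. pair_prod (\<lambda>x y. 1 - (1 - z) * of_real (W (x, y))) (\<Xi> \<omega> \<inter> {0..a}))"
  using norm_edge_factor_le_1[OF z] W01
  by (intro integrable_const_bound[where B = 1] pair_prod_points_measurable W AE_I2 norm_pair_prod_le_1) auto

text \<open>Two products of factors from the unit disc differ by at most the sum of the differences
  of the factors, and each of these is at most 2 * |\<open>W\<close> - \<open>V\<close>|.\<close>

lemma norm_Psi_diff_le:
  assumes W [measurable]: "W \<in> borel_measurable borel" and W01: "\<And>w. 0 \<le> W w \<and> W w \<le> 1"
    and V [measurable]: "V \<in> borel_measurable borel" and V01: "\<And>w. 0 \<le> V w \<and> V w \<le> 1"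
    and z: "norm z \<le> 1" and a: "0 < a"
  shows "norm (Psi a z W - Psi a z V) \<le> 2 * (LINT w|lborel. indicator ({0..a} \<times> {0..a}) w * \<bar>W w - V w\<bar>)"
proof -
  let ?Q = "{0..a} \<times> {0..a}"
  let ?P = "\<lambda>W \<omega>. pair_prod (\<lambda>x y. 1 - (1 - z) * of_real (W (x, y))) (\<Xi> \<omega> \<inter> {0..a})"
  have Q: "?Q \<in> sets (borel :: (real \<times> real) measure)" unfolding borel_prod[symmetric] by measurable
  have "emeasure lborel ?Q < \<infinity>" using a by (simp add: emeasure_lborel_Times ennreal_mult_less_top)
  then have Qi: "integrable lborel (indicator ?Q :: _ \<Rightarrow> real)" using Q by (simp add: integrable_indicator_iff)
  have di: "integrable lborel (\<lambda>w. indicator ?Q w * (W w - V w))"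
  proof (rule Bochner_Integration.integrable_bound[OF Qi])
    show "(\<lambda>w. indicator ?Q w * (W w - V w)) \<in> borel_measurable lborel" using Q by measurable
    have "\<bar>W w - V w\<bar> \<le> 1" for w using W01[of w] V01[of w] by linarith
    then show "AE w in lborel. norm (indicator ?Q w * (W w - V w)) \<le> norm (indicator ?Q w :: real)"
      by (intro AE_I2) (auto simp: abs_mult mult_left_le)
  qed
  have m: "(\<lambda>w. W w - V w) \<in> borel_measurable borel" by measurable
  have pw: "norm (?P W \<omega> - ?P V \<omega>) \<le> 2 * (\<Sum>w\<in>off_diag a \<omega>. \<bar>W w - V w\<bar>)" if \<omega>: "\<omega> \<in> space M" for \<omega>
  proof -
    let ?O = "ordered_pairs (\<Xi> \<omega> \<inter> {0..a})"
    have "norm (?P W \<omega> - ?P V \<omega>) \<le> (\<Sum>w\<in>?O. norm ((1 - (1 - z) * of_real (W w)) - (1 - (1 - z) * of_real (V w))))"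
      unfolding pair_prod_def case_prod_beta prod.collapse
      using norm_edge_factor_le_1[OF z] W01 V01 by (intro norm_prod_diff) auto
    also have "\<dots> \<le> (\<Sum>w\<in>?O. 2 * \<bar>W w - V w\<bar>)"
    proof (intro sum_mono)
      fix w
      have "(1 - (1 - z) * of_real (W w)) - (1 - (1 - z) * of_real (V w)) = (1 - z) * of_real (V w - W w)"
        by (simp add: algebra_simps)
      then have "norm ((1 - (1 - z) * of_real (W w)) - (1 - (1 - z) * of_real (V w))) = norm (1 - z) * \<bar>W w - V w\<bar>"
        by (simp add: norm_mult abs_minus_commute del: of_real_diff)
      also have "\<dots> \<le> 2 * \<bar>W w - V w\<bar>"
        using z norm_triangle_ineq4[of 1 z] by (intro mult_right_mono) auto
      finally show "norm ((1 - (1 - z) * of_real (W w)) - (1 - (1 - z) * of_real (V w))) \<le> 2 * \<bar>W w - V w\<bar>" .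
    qed
    also have "\<dots> \<le> (\<Sum>w\<in>off_diag a \<omega>. 2 * \<bar>W w - V w\<bar>)"
      unfolding ordered_pairs_off_diag using finite_off_diag[OF \<omega>] by (intro sum_mono2) auto
    finally show ?thesis by (simp add: sum_distrib_left)
  qed
  have iW: "integrable M (?P W)" and iV: "integrable M (?P V)"
    using pair_prod_points_integrable W V W01 V01 z by auto
  have "norm (Psi a z W - Psi a z V) = norm (LINT \<omega>|M. ?P W \<omega> - ?P V \<omega>)"
    unfolding Psi_def using iW iV by simp
  also have "\<dots> \<le> (LINT \<omega>|M. norm (?P W \<omega> - ?P V \<omega>))"
    by (rule integral_norm_bound)
  also have "\<dots> \<le> (LINT \<omega>|M. 2 * (\<Sum>w\<in>off_diag a \<omega>. \<bar>W w - V w\<bar>))"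
    using iW iV off_diag_integrable(4)[OF m di] pw by (intro integral_mono) auto
  also have "\<dots> = 2 * (LINT w|lborel. indicator ?Q w * \<bar>W w - V w\<bar>)"
    using off_diag_integrable(3)[OF m di] by simp
  finally show ?thesis .
qed

section \<open>Occupied cells of the Poisson process against Bernoulli selection\<close>

lemma prob_num_points_ge:
  assumes A: "A \<in> sets borel" "A \<subseteq> {0..t}" and q: "measure lborel A = q"
  shows "prob {\<omega>\<in>space M. 1 \<le> num_points \<Xi> A \<omega>} = 1 - exp (- q)"
    and "prob {\<omega>\<in>space M. 2 \<le> num_points \<Xi> A \<omega>} \<le> q\<^sup>2"
proof -
  let ?N = "num_points \<Xi> A"
  have A0: "A \<subseteq> {0..}" using A by auto
  have fin: "emeasure lborel A < \<infinity>" by (rule emeasure_bounded_finite[OF A(2)])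
  have [measurable]: "?N \<in> measurable M (count_space UNIV)"
    by (rule num_points_finite_measure[OF A(1) A0 fin])
  have q0: "0 \<le> q" using q by auto
  have p0: "prob {\<omega>\<in>space M. ?N \<omega> = 0} = exp (- q)"
    using num_points_finite_measure(2)[OF A(1) A0 fin, of 0] q by simp
  have p1: "prob {\<omega>\<in>space M. ?N \<omega> = 1} = q * exp (- q)"
  proof -
    have "prob {\<omega>\<in>space M. ?N \<omega> = 1} = measure lborel A ^ 1 / fact 1 * exp (- measure lborel A)"
      by (rule num_points_finite_measure(2)[OF A(1) A0 fin])
    then show ?thesis by (simp only: q power_one_right fact_1 div_by_1)
  qed
  have "{\<omega>\<in>space M. 1 \<le> ?N \<omega>} = space M - {\<omega>\<in>space M. ?N \<omega> = 0}" by auto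
  then show "prob {\<omega>\<in>space M. 1 \<le> ?N \<omega>} = 1 - exp (- q)"
    using prob_compl[of "{\<omega>\<in>space M. ?N \<omega> = 0}"] p0 by simp
  have "prob ({\<omega>\<in>space M. ?N \<omega> = 0} \<union> {\<omega>\<in>space M. ?N \<omega> = 1}) = exp (- q) + q * exp (- q)"
    by (subst finite_measure_Union) (auto simp: p0 p1[simplified])
  moreover have "{\<omega>\<in>space M. 2 \<le> ?N \<omega>} = space M - ({\<omega>\<in>space M. ?N \<omega> = 0} \<union> {\<omega>\<in>space M. ?N \<omega> = 1})" by auto
  ultimately have "prob {\<omega>\<in>space M. 2 \<le> ?N \<omega>} = 1 - (1 + q) * exp (- q)"
    using prob_compl[of "{\<omega>\<in>space M. ?N \<omega> = 0} \<union> {\<omega>\<in>space M. ?N \<omega> = 1}"] by (simp add: algebra_simps)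
  also have "\<dots> \<le> 1 - (1 + q) * (1 - q)"
    using exp_ge_add_one_self[of "- q"] q0 by (intro diff_left_mono mult_left_mono) auto
  also have "\<dots> = q\<^sup>2" by (simp add: algebra_simps power2_eq_square)
  finally show "prob {\<omega>\<in>space M. 2 \<le> ?N \<omega>} \<le> q\<^sup>2" .
qed

text \<open>The occupied cells form a Bernoulli selection with probability 1 - exp (-
  \<open>q\<close>), and as long as no cell holds two points, both products agree factor by factor.
  The exceptional event has probability at most \<open>card V\<close> * q^2, and the products differ
  there by at most 2. Replacing 1 - exp (- \<open>q\<close>) by \<open>q\<close> costs another 2 *
  \<open>card V\<close> * q^2.\<close>

lemma norm_Psi_step_fn_diff:
  fixes I :: "nat \<Rightarrow> real set"
  assumes fin: "finite V" and I: "\<And>v. v \<in> V \<Longrightarrow> I v \<in> sets borel" "\<And>v. v \<in> V \<Longrightarrow> I v \<subseteq> {0..a}"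
    and dis: "disjoint_family_on I V" and q: "\<And>v. v \<in> V \<Longrightarrow> measure lborel (I v) = q" "0 \<le> q" "q \<le> 1"
    and A01: "\<And>u v. u \<in> V \<Longrightarrow> v \<in> V \<Longrightarrow> 0 \<le> A u v \<and> A u v \<le> 1"
    and sym: "\<And>u v. u \<in> V \<Longrightarrow> v \<in> V \<Longrightarrow> A u v = A v u" and z: "norm z \<le> 1"
  shows "norm (Psi a z (step_fn I V A) - edge_gf q z V A) \<le> 4 * real (card V) * q\<^sup>2"
proof -
  let ?q' = "1 - exp (- q)"
  \<comment> \<open>Empty sets extend the family to all indices, since the independence axiom asks
    for a sequence.\<close>
  define J where "J i = (if i \<in> V then I i else {})" for i
  have J: "J i \<in> sets borel" "J i \<subseteq> {0..a}" for i using I by (auto simp: J_def)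
  have "indep_vars (\<lambda>_. count_space UNIV) (\<lambda>i. num_points \<Xi> (J i)) UNIV"
  proof (rule indep_num_points)
    show "J i \<subseteq> {0..}" for i using J(2)[of i] by auto
    show "emeasure lborel (J i) < \<infinity>" for i by (rule emeasure_bounded_finite[OF J(2)])
    show "disjoint_family J" using dis by (auto simp: J_def disjoint_family_on_def)
  qed (rule J)
  then have "indep_vars (\<lambda>_. count_space UNIV) (\<lambda>i \<omega>. 1 \<le> num_points \<Xi> (J i) \<omega>) UNIV"
    by (rule indep_vars_compose2) simp
  then have "indep_vars (\<lambda>_. count_space UNIV) (\<lambda>i \<omega>. 1 \<le> num_points \<Xi> (J i) \<omega>) V"
    by (rule indep_vars_subset) auto
  then have indep: "indep_vars (\<lambda>_. count_space UNIV) (\<lambda>i \<omega>. 1 \<le> num_points \<Xi> (I i) \<omega>) V"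
    by (rule indep_vars_cong[THEN iffD1, rotated 3]) (auto simp: J_def)
  define F where "F = pair_prod (\<lambda>u v. 1 - (1 - z) * of_real (A u v) :: complex)"
  define S where "S \<omega> = {v\<in>V. 1 \<le> num_points \<Xi> (I v) \<omega>}" for \<omega>
  let ?W = "step_fn I V A"
  let ?P = "\<lambda>\<omega>. pair_prod (\<lambda>x y. 1 - (1 - z) * of_real (?W (x, y))) (\<Xi> \<omega> \<inter> {0..a})"
  define Bad where "Bad = (\<Union>v\<in>V. {\<omega>\<in>space M. 2 \<le> num_points \<Xi> (I v) \<omega>})"
  have N [measurable]: "num_points \<Xi> (I v) \<in> measurable M (count_space UNIV)" if "v \<in> V" for v
    using I[OF that] by (intro num_points_measurable) auto
  have Bad: "Bad \<in> sets M" unfolding Bad_def using fin by (intro sets.finite_UN) auto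
  have FS: "(\<lambda>\<omega>. F (S \<omega>)) \<in> borel_measurable M" "(LINT \<omega>|M. F (S \<omega>)) = edge_gf ?q' z V A"
    using expectation_random_subset[OF fin indep prob_num_points_ge(1)[OF I q(1)], of F]
    unfolding S_def edge_gf_def F_def by auto
  have W01: "0 \<le> ?W w \<and> ?W w \<le> 1" for w
    using A01 by (intro step_fn_bounds fin dis) auto
  have Wm: "?W \<in> borel_measurable borel" using fin I by (intro measurable_step_fn) auto
  have iP: "integrable M ?P" by (rule pair_prod_points_integrable[OF Wm W01 z])
  have nP: "norm (?P \<omega>) \<le> 1" for \<omega>
    using norm_edge_factor_le_1[OF z] W01 by (intro norm_pair_prod_le_1) auto
  have nF: "norm (F (S \<omega>)) \<le> 1" for \<omega>
    unfolding F_def using norm_edge_factor_le_1[OF z] A01 by (intro norm_pair_prod_le_1) (auto simp: S_def)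
  have iF: "integrable M (\<lambda>\<omega>. F (S \<omega>))"
    using nF FS(1) by (intro integrable_const_bound[where B = 1]) auto
  have good: "?P \<omega> = F (S \<omega>)" if \<omega>: "\<omega> \<in> space M" "\<omega> \<notin> Bad" for \<omega>
  proof -
    \<comment> \<open>Off \<open>Bad\<close> an occupied cell holds exactly one point, which
      represents its vertex.\<close>
    define h where "h v = (THE x. x \<in> \<Xi> \<omega> \<inter> I v)" for v
    have fI: "finite (\<Xi> \<omega> \<inter> I v)" if "v \<in> V" for v
      using finite_points[OF \<omega>(1), of a] I(2)[OF that] by (auto intro: finite_subset[rotated])
    have h: "\<Xi> \<omega> \<inter> I v = {h v}" if v: "v \<in> S \<omega>" for v
    proof -
      have "card (\<Xi> \<omega> \<inter> I v) = 1"
        using v \<omega> by (force simp: S_def Bad_def num_points_def)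
      then obtain x where "\<Xi> \<omega> \<inter> I v = {x}" by (auto simp: card_1_singleton_iff)
      then show ?thesis by (simp add: h_def)
    qed
    define Y where "Y = \<Xi> \<omega> \<inter> (\<Union>v\<in>V. I v)"
    have Y_sub: "Y \<subseteq> \<Xi> \<omega> \<inter> {0..a}" using I(2) by (auto simp: Y_def)
    have in_S: "v \<in> S \<omega>" if "v \<in> V" "x \<in> \<Xi> \<omega>" "x \<in> I v" for v x
      using that fI[OF that(1)] by (auto simp: S_def num_points_def Suc_le_eq card_gt_0_iff)
    have hI: "h v \<in> I v" "h v \<in> \<Xi> \<omega>" if "v \<in> S \<omega>" for v using h[OF that] by auto
    have bij: "bij_betw h (S \<omega>) Y"
    proof (rule bij_betw_imageI)
      show "inj_on h (S \<omega>)"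
      proof (rule inj_onI)
        fix u v assume "u \<in> S \<omega>" "v \<in> S \<omega>" "h u = h v"
        then have "h u \<in> I u \<inter> I v" "u \<in> V" "v \<in> V" using hI by (auto simp: S_def) (metis hI(1))
        then show "u = v" using dis by (auto simp: disjoint_family_on_def)
      qed
      show "h ` S \<omega> = Y"
      proof
        show "h ` S \<omega> \<subseteq> Y" using hI by (auto simp: Y_def S_def)
        show "Y \<subseteq> h ` S \<omega>"
        proof
          fix x assume "x \<in> Y"
          then obtain v where v: "v \<in> V" "x \<in> I v" "x \<in> \<Xi> \<omega>" by (auto simp: Y_def)
          then have "v \<in> S \<omega>" "x = h v" using in_S[OF v(1,3,2)] h by auto
          then show "x \<in> h ` S \<omega>" by auto
        qed
      qed
    qed
    have W_h: "?W (h u, h v) = A u v" if "u \<in> S \<omega>" "v \<in> S \<omega>" for u v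
      using that hI by (intro step_fn_eq fin dis) (auto simp: S_def)
    \<comment> \<open>Points outside all the sets \<open>I v\<close> contribute factors 1, because
      the step function vanishes there.\<close>
    have "?P \<omega> = pair_prod (\<lambda>x y. 1 - (1 - z) * of_real (?W (x, y))) Y"
      unfolding pair_prod_def
    proof (rule prod.mono_neutral_right)
      show "finite (ordered_pairs (\<Xi> \<omega> \<inter> {0..a}))" using finite_points[OF \<omega>(1)] by simp
      show "ordered_pairs Y \<subseteq> ordered_pairs (\<Xi> \<omega> \<inter> {0..a})" using Y_sub by (auto simp: ordered_pairs_def)
      show "\<forall>i\<in>ordered_pairs (\<Xi> \<omega> \<inter> {0..a}) - ordered_pairs Y. (case i of (x, y) \<Rightarrow> 1 - (1 - z) * of_real (?W (x, y))) = 1"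
        by (auto simp: ordered_pairs_def Y_def intro!: step_fn_eq_0)
    qed
    also have "\<dots> = pair_prod (\<lambda>u v. 1 - (1 - z) * of_real (?W (h u, h v))) (S \<omega>)"
    proof (rule pair_prod_reindex[OF bij])
      fix x y assume "x \<in> Y" "y \<in> Y"
      then obtain u v where uv: "u \<in> S \<omega>" "v \<in> S \<omega>" "x = h u" "y = h v"
        using bij by (auto simp: bij_betw_def)
      then have "A u v = A v u" using sym by (auto simp: S_def)
      then show "1 - (1 - z) * of_real (?W (x, y)) = 1 - (1 - z) * of_real (?W (y, x))"
        using W_h uv by simp
    qed
    also have "\<dots> = F (S \<omega>)"
      unfolding F_def by (intro pair_prod_cong) (simp add: W_h)
    finally show ?thesis .
  qed
  have "norm (Psi a z ?W - edge_gf ?q' z V A) = norm (LINT \<omega>|M. ?P \<omega> - F (S \<omega>))"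
    unfolding Psi_def FS(2)[symmetric] using iP iF by simp
  also have "\<dots> \<le> (LINT \<omega>|M. norm (?P \<omega> - F (S \<omega>)))" by (rule integral_norm_bound)
  also have "\<dots> \<le> (LINT \<omega>|M. 2 * indicator Bad \<omega>)"
  proof (intro integral_mono)
    show "integrable M (\<lambda>\<omega>. norm (?P \<omega> - F (S \<omega>)))" using iP iF by auto
    show "integrable M (\<lambda>\<omega>. 2 * indicator Bad \<omega> :: real)" using Bad by (simp add: emeasure_eq_measure)
    fix \<omega> assume "\<omega> \<in> space M"
    then show "norm (?P \<omega> - F (S \<omega>)) \<le> 2 * indicator Bad \<omega>"
      using good[of \<omega>] norm_triangle_ineq4[of "?P \<omega>" "F (S \<omega>)"] nP[of \<omega>] nF[of \<omega>] by (cases "\<omega> \<in> Bad") auto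
  qed
  also have "\<dots> = 2 * prob Bad" using Bad by simp
  also have "prob Bad \<le> (\<Sum>v\<in>V. prob {\<omega>\<in>space M. 2 \<le> num_points \<Xi> (I v) \<omega>})"
    unfolding Bad_def using fin by (intro finite_measure_subadditive_finite) auto
  also have "\<dots> \<le> (\<Sum>v\<in>V. q\<^sup>2)"
    using prob_num_points_ge(2)[OF I q(1)] by (intro sum_mono) auto
  finally have 1: "norm (Psi a z ?W - edge_gf ?q' z V A) \<le> 2 * (real (card V) * q\<^sup>2)" by simp
  have "\<bar>?q' - q\<bar> \<le> q\<^sup>2"
  proof -
    have "1 - q \<le> exp (- q)" using exp_ge_add_one_self[of "- q"] by simp
    moreover have "exp (- q) \<le> 1 / (1 + q)"
      using exp_ge_add_one_self[of q] q(2) by (simp add: exp_minus field_simps)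
    moreover have "1 / (1 + q) \<le> 1 - q + q\<^sup>2"
    proof -
      have "(1 - q + q\<^sup>2) * (1 + q) = 1 + q ^ 3" by (simp add: algebra_simps power2_eq_square power3_eq_cube)
      then have "1 \<le> (1 - q + q\<^sup>2) * (1 + q)" using q(2) by simp
      then show ?thesis using q(2) by (simp add: divide_le_eq)
    qed
    ultimately show ?thesis by (simp add: abs_le_iff) 
  qed
  then have "2 * real (card V) * \<bar>?q' - q\<bar> \<le> 2 * real (card V) * q\<^sup>2"
    by (intro mult_left_mono) auto
  moreover have "norm (edge_gf ?q' z V A - edge_gf q z V A) \<le> 2 * real (card V) * \<bar>?q' - q\<bar>"
    using q by (intro norm_edge_gf_diff_prob fin z A01) auto
  moreover have "norm (Psi a z ?W - edge_gf q z V A) \<le> norm (Psi a z ?W - edge_gf ?q' z V A) + norm (edge_gf ?q' z V A - edge_gf q z V A)"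
    using norm_triangle_ineq[of "Psi a z ?W - edge_gf ?q' z V A" "edge_gf ?q' z V A - edge_gf q z V A"] by simp
  ultimately show ?thesis using 1 by linarith
qed

end

section \<open>The quadratic form and its generating function\<close>

lemma adj_sym: "adj E u v = adj E v u"
  by (simp add: adj_def insert_commute)

lemma adj_bounds: "0 \<le> adj E u v \<and> adj E u v \<le> 1"
  by (simp add: adj_def)

lemma adj_self:
  assumes "E \<subseteq> nsets V 2"
  shows "adj E u u = 0"
  using assms by (auto simp: adj_def nsets_def)

lemma T_stat_eq:
  assumes E: "E \<subseteq> nsets {1..n} 2"
  shows "T_stat n E X \<omega> = (\<Sum>(u, v)\<in>ordered_pairs {v\<in>{1..n}. X v \<omega>}. adj E u v)"
proof -
  let ?S = "{v\<in>{1..n}. X v \<omega>}"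
  have "(\<Sum>u = 1..n. \<Sum>v = 1..n. adj E u v * of_bool (X u \<omega>) * of_bool (X v \<omega>))
      = (\<Sum>p\<in>{1..n} \<times> {1..n}. adj E (fst p) (snd p) * of_bool (X (fst p) \<omega>) * of_bool (X (snd p) \<omega>))"
    unfolding sum.cartesian_product by (intro sum.cong refl) auto
  also have "\<dots> = (\<Sum>p\<in>?S \<times> ?S. adj E (fst p) (snd p))"
    by (intro sum.mono_neutral_cong_right) auto
  also have "\<dots> = 2 * (\<Sum>p\<in>ordered_pairs ?S. adj E (fst p) (snd p))"
    by (subst sum_square_ordered_pairs) (simp_all add: adj_self[OF E] adj_sym[of E "snd _"])
  finally show ?thesis
    by (simp add: T_stat_def case_prod_beta)
qed

text \<open>The entries are 0 or 1, so the exponential of an entry is affine in it, and the sum in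
  the exponent becomes a product over pairs.\<close>

lemma exp_T_stat:
  assumes E: "E \<subseteq> nsets {1..n} 2"
  shows "exp (w * of_real (T_stat n E X \<omega>))
    = pair_prod (\<lambda>u v. 1 - (1 - exp w) * of_real (adj E u v)) {v\<in>{1..n}. X v \<omega>}"
proof -
  have "exp (w * of_real (adj E u v)) = 1 - (1 - exp w) * of_real (adj E u v)" for u v
    by (simp add: adj_def)
  then show ?thesis
    unfolding T_stat_eq[OF E] pair_prod_def
    by (simp add: sum_distrib_left exp_sum case_prod_beta)
qed

lemma prob_bernoulli:
  assumes "prob_space P" and X: "X \<in> measurable P (count_space UNIV)"
    and distr: "distr P (count_space UNIV) X = measure_pmf (bernoulli_pmf p)" and p: "0 \<le> p" "p \<le> 1"
  shows "measure P {\<omega>\<in>space P. X \<omega>} = p"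
proof -
  have "measure P {\<omega>\<in>space P. X \<omega>} = measure (distr P (count_space UNIV) X) {True}"
    using X by (subst measure_distr) (auto intro!: arg_cong[of _ _ "measure P"])
  also have "\<dots> = p"
    unfolding distr using p by (simp add: measure_pmf_single)
  finally show ?thesis .
qed

context
  fixes P :: "'a measure" and X :: "nat \<Rightarrow> 'a \<Rightarrow> bool" and n :: nat and p :: real and E :: "nat set set"
  assumes P: "prob_space P" and p: "0 \<le> p" "p \<le> 1"
    and indep: "prob_space.indep_vars P (\<lambda>_. count_space UNIV) X {1..n}"
    and distr: "\<And>u. u \<in> {1..n} \<Longrightarrow> distr P (count_space UNIV) (X u) = measure_pmf (bernoulli_pmf p)"
    and E: "E \<subseteq> nsets {1..n} 2"
begin

interpretation prob_space P by (rule P)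

lemma vertex_measurable: "u \<in> {1..n} \<Longrightarrow> X u \<in> measurable P (count_space UNIV)"
  using indep by (auto simp: indep_vars_def)

lemma vertex_prob: "u \<in> {1..n} \<Longrightarrow> prob {\<omega>\<in>space P. X u \<omega>} = p"
  using prob_bernoulli[OF P vertex_measurable distr p] by auto

lemma T_stat_measurable: "T_stat n E X \<in> borel_measurable P"
proof -
  define F where "F S = complex_of_real (\<Sum>(u, v)\<in>ordered_pairs S. adj E u v)" for S
  have "(\<lambda>\<omega>. F {v\<in>{1..n}. X v \<omega>}) \<in> borel_measurable P"
    by (rule expectation_random_subset(1)[OF _ indep vertex_prob]) auto
  then have "(\<lambda>\<omega>. Re (F {v\<in>{1..n}. X v \<omega>})) \<in> borel_measurable P" by measurable
  moreover have "T_stat n E X = (\<lambda>\<omega>. Re (F {v\<in>{1..n}. X v \<omega>}))"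
    unfolding F_def Re_complex_of_real by (intro ext T_stat_eq[OF E])
  ultimately show ?thesis by simp
qed

lemma expectation_exp_T_stat:
  "(LINT \<omega>|P. exp (w * of_real (T_stat n E X \<omega>))) = edge_gf p (exp w) {1..n} (adj E)"
  unfolding exp_T_stat[OF E] edge_gf_def
  by (rule expectation_random_subset(2)[OF _ indep vertex_prob]) auto

lemma sum_adj_ordered_pairs: "(\<Sum>(u, v)\<in>ordered_pairs {1..n}. adj E u v) = real (card E)"
proof -
  let ?O = "{(u, v)\<in>ordered_pairs {1..n}. {u, v} \<in> E}"
  have img: "(\<lambda>(u, v). {u, v}) ` ?O = E"
  proof (intro set_eqI iffI)
    fix e assume e: "e \<in> E"
    then obtain u v where uv: "e = {u, v}" "u \<noteq> v" "u \<in> {1..n}" "v \<in> {1..n}"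
      using E by (auto simp: nsets_def card_2_iff)
    then have "(min u v, max u v) \<in> ?O" "e = (\<lambda>(u, v). {u, v}) (min u v, max u v)"
      using e by (auto simp: ordered_pairs_def min_def max_def insert_commute)
    then show "e \<in> (\<lambda>(u, v). {u, v}) ` ?O" by blast
  qed auto
  have inj: "inj_on (\<lambda>(u, v). {u, v}) ?O"
    by (auto simp: inj_on_def ordered_pairs_def doubleton_eq_iff)
  have "card E = card ?O"
    using card_image[OF inj] unfolding img .
  moreover have "(\<Sum>(u, v)\<in>ordered_pairs {1..n}. adj E u v) = (\<Sum>p\<in>ordered_pairs {1..n}. if p \<in> ?O then 1 else 0)"
    by (intro sum.cong refl) (auto simp: adj_def)
  moreover have "\<dots> = real (card (ordered_pairs {1..n} \<inter> ?O))"
    by (subst sum.inter_restrict[symmetric]) auto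
  moreover have "ordered_pairs {1..n} \<inter> ?O = ?O" by auto
  ultimately show ?thesis by simp
qed

lemma T_stat_nonneg: "0 \<le> T_stat n E X \<omega>"
  unfolding T_stat_eq[OF E] by (intro sum_nonneg) (auto simp: adj_bounds)

lemma expectation_T_stat:
  shows "integrable P (T_stat n E X)" and "(LINT \<omega>|P. T_stat n E X \<omega>) = p\<^sup>2 * real (card E)"
proof -
  let ?O = "ordered_pairs {1..n}"
  define B where "B u v = {\<omega>\<in>space P. X u \<omega> \<and> X v \<omega>}" for u v
  have B: "B u v \<in> sets P" and prob_B: "prob (B u v) = p\<^sup>2" if "(u, v) \<in> ?O" for u v
  proof -
    have uv: "u \<in> {1..n}" "v \<in> {1..n}" "u \<noteq> v" using that by (auto simp: ordered_pairs_def)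
    note [measurable] = vertex_measurable[OF uv(1)] vertex_measurable[OF uv(2)]
    show "B u v \<in> sets P" unfolding B_def by measurable
    have "B u v = (\<Inter>w\<in>{u, v}. X w -` {True} \<inter> space P)" by (auto simp: B_def)
    also have "prob \<dots> = (\<Prod>w\<in>{u, v}. prob (X w -` {True} \<inter> space P))"
      using uv by (intro indep_varsD[OF indep]) auto
    also have "\<dots> = (\<Prod>w\<in>{u, v}. p)"
    proof (intro prod.cong refl)
      fix w assume "w \<in> {u, v}"
      then have "w \<in> {1..n}" using uv by auto
      moreover have "X w -` {True} \<inter> space P = {\<omega>\<in>space P. X w \<omega>}" by auto
      ultimately show "prob (X w -` {True} \<inter> space P) = p" using vertex_prob by simp
    qed
    also have "\<dots> = p\<^sup>2" using uv by (simp add: power2_eq_square)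
    finally show "prob (B u v) = p\<^sup>2" .
  qed
  have T: "T_stat n E X \<omega> = (\<Sum>(u, v)\<in>?O. adj E u v * indicator (B u v) \<omega>)" if "\<omega> \<in> space P" for \<omega>
    unfolding T_stat_eq[OF E] using that
    by (intro sum.mono_neutral_cong_left) (simp_all, auto simp: ordered_pairs_def B_def indicator_def)
  have int: "integrable P (\<lambda>\<omega>. case i of (u, v) \<Rightarrow> adj E u v * indicator (B u v) \<omega>)" if "i \<in> ?O" for i
    using that B by (cases i) (auto simp: emeasure_eq_measure)
  have "integrable P (\<lambda>\<omega>. \<Sum>(u, v)\<in>?O. adj E u v * indicator (B u v) \<omega>)"
    using int by (rule Bochner_Integration.integrable_sum)
  then show "integrable P (T_stat n E X)"
    by (subst Bochner_Integration.integrable_cong[OF refl T])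
  have "(LINT \<omega>|P. T_stat n E X \<omega>) = (LINT \<omega>|P. (\<Sum>(u, v)\<in>?O. adj E u v * indicator (B u v) \<omega>))"
    by (intro Bochner_Integration.integral_cong refl T)
  also have "\<dots> = (\<Sum>i\<in>?O. LINT \<omega>|P. (case i of (u, v) \<Rightarrow> adj E u v * indicator (B u v) \<omega>))"
    using int by (rule Bochner_Integration.integral_sum)
  also have "\<dots> = (\<Sum>(u, v)\<in>?O. adj E u v * p\<^sup>2)"
    using B prob_B by (intro sum.cong refl) auto
  also have "\<dots> = p\<^sup>2 * real (card E)"
    using sum_adj_ordered_pairs by (simp add: sum_distrib_left[symmetric] case_prod_beta mult.commute)
  finally show "(LINT \<omega>|P. T_stat n E X \<omega>) = p\<^sup>2 * real (card E)" .
qed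

end

section \<open>Consequences of cut convergence\<close>

text \<open>On a cell the ceilings in \<open>graph_kernel\<close> are the vertex indices. On the
  axes, which meet none of the cells 1 to \<open>n\<close>, one ceiling is 0, and 0 lies in no
  edge.\<close>

lemma graph_kernel_eq_step_fn:
  assumes p: "0 < p" and E: "E \<subseteq> nsets {1..n} 2"
  shows "graph_kernel n E (1 / p) z = step_fn (cell p) {1..n} (adj E) z"
proof (cases z)
  case (Pair x y)
  have r: "real n / (1 / p) = real n * p" "\<And>x. x * (1 / p) = x / p" by simp_all
  have no0: "{0, w} \<notin> E" "{w, 0} \<notin> E" for w
    using E by (auto simp: nsets_def subset_iff)
  show ?thesis
  proof (cases "x \<in> {0<..real n * p} \<and> y \<in> {0<..real n * p}")
    case True
    then obtain u v where uv: "u \<in> {1..n}" "x \<in> cell p u" "v \<in> {1..n}" "y \<in> cell p v"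
      using in_cellE[OF p] by metis
    then have "nat \<lceil>x / p\<rceil> = u" "nat \<lceil>y / p\<rceil> = v" using cell_ceiling[OF p] by auto
    then have "graph_kernel n E (1 / p) z = adj E u v"
      using True by (simp add: graph_kernel_def Pair adj_def r)
    also have "\<dots> = step_fn (cell p) {1..n} (adj E) z"
      unfolding Pair using uv disjoint_family_cell[OF p]
      by (intro step_fn_eq[symmetric]) (auto intro: disjoint_family_on_mono[of _ UNIV])
    finally show ?thesis .
  next
    case False
    have "graph_kernel n E (1 / p) z = 0"
    proof (cases "x \<in> {0..real n * p} \<and> y \<in> {0..real n * p}")
      case True
      with False have "x = 0 \<or> y = 0" by auto
      then show ?thesis using no0 by (auto simp: graph_kernel_def Pair)
    qed (auto simp: graph_kernel_def Pair r)
    moreover have "cell p u \<subseteq> {0<..real n * p}" if "u \<in> {1..n}" for u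
      using that cell_subset[OF p] by auto
    then have "x \<notin> (\<Union>u\<in>{1..n}. cell p u) \<or> y \<notin> (\<Union>u\<in>{1..n}. cell p u)"
      using False by blast
    ultimately show ?thesis
      using step_fn_eq_0[of x "cell p" "{1..n}" y] Pair by simp
  qed
qed

section \<open>Testing the cut norm against particular functions\<close>

lemma indicator_square_measurable: "{0..K} \<times> {0..K::real} \<in> sets borel"
  unfolding borel_prod[symmetric] by measurable

lemma integrable_indicator_square: "integrable lborel (indicator ({0..K} \<times> {0..K::real}) :: _ \<Rightarrow> real)"
proof -
  have "emeasure lborel ({0..K} \<times> {0..K}) < \<infinity>"
    by (cases "0 \<le> K") (simp_all add: emeasure_lborel_Times ennreal_mult_less_top)
  then show ?thesis using indicator_square_measurable by (simp add: integrable_indicator_iff)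
qed

text \<open>A real supremum dominates the members of a set only if the set is bounded above; here
  |\<open>U\<close>| <= 1 bounds all the integrals by the area of the square.\<close>

lemma cut_norm_upper:
  assumes U: "\<And>z. z \<in> {0..K} \<times> {0..K} \<Longrightarrow> \<bar>U z\<bar> \<le> 1"
    and f: "f \<in> borel_measurable borel" "\<And>x. \<bar>f x\<bar> \<le> 1" and g: "g \<in> borel_measurable borel" "\<And>x. \<bar>g x\<bar> \<le> 1"
  shows "\<bar>LINT z|lborel. indicator ({0..K} \<times> {0..K}) z * (U z * f (fst z) * g (snd z))\<bar> \<le> cut_norm K U"
proof -
  let ?Q = "{0..K} \<times> {0..K}"
  let ?S = "{(f, g). set_borel_measurable borel {0..K} f \<and> set_borel_measurable borel {0..K} g \<and>
          (\<forall>x\<in>{0..K}. f x \<in> {-1..1::real}) \<and> (\<forall>x\<in>{0..K}. g x \<in> {-1..1::real})}"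
  let ?v = "\<lambda>(f, g). \<bar>LINT (x, y):?Q|lborel. U (x, y) * f x * g y\<bar>"
  have bdd: "bdd_above (?v ` ?S)"
  proof (rule bdd_aboveI2)
    fix h assume h: "h \<in> ?S"
    obtain f g where fg: "h = (f, g)" by (cases h)
    with h have fg1: "\<bar>f x\<bar> \<le> 1" "\<bar>g x\<bar> \<le> 1" if "x \<in> {0..K}" for x using that by (auto simp: abs_le_iff minus_le_iff)
    have "\<bar>indicator ?Q z *\<^sub>R (U z * f (fst z) * g (snd z))\<bar> \<le> indicator ?Q z" for z
    proof (cases "z \<in> ?Q")
      case True
      then have "\<bar>U z\<bar> * \<bar>f (fst z)\<bar> * \<bar>g (snd z)\<bar> \<le> 1 * 1 * 1"
        using U[OF True] fg1 by (intro mult_mono) (auto simp: mem_Times_iff)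
      then show ?thesis using True by (simp add: abs_mult)
    qed simp
    then have "(LINT z|lborel. \<bar>indicator ?Q z *\<^sub>R (U z * f (fst z) * g (snd z))\<bar>) \<le> (LINT z|lborel. indicator ?Q z)"
      by (intro integral_mono' integrable_indicator_square) auto
    then have "\<bar>LINT z|lborel. indicator ?Q z *\<^sub>R (U z * f (fst z) * g (snd z))\<bar> \<le> (LINT z|lborel. indicator ?Q z)"
      by (rule order.trans[OF integral_abs_bound])
    then show "?v h \<le> (LINT z|lborel. indicator ?Q z)"
      unfolding fg by (simp add: set_lebesgue_integral_def case_prod_beta)
  qed
  have mem: "(f, g) \<in> ?S"
    using f g by (auto simp: set_borel_measurable_def abs_le_iff)
  have "?v (f, g) \<le> cut_norm K U"
    unfolding cut_norm_def by (rule cSUP_upper[OF mem bdd])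
  then show ?thesis by (simp add: set_lebesgue_integral_def case_prod_beta)
qed

lemma cut_norm_cong:
  assumes "\<And>z. z \<in> {0..K} \<times> {0..K} \<Longrightarrow> U z = U' z"
  shows "cut_norm K U = cut_norm K U'"
proof -
  have "(LINT (x, y):{0..K} \<times> {0..K}|lborel. U (x, y) * f x * g y) = (LINT (x, y):{0..K} \<times> {0..K}|lborel. U' (x, y) * f x * g y)"
    for f g :: "real \<Rightarrow> real"
    unfolding set_lebesgue_integral_def using assms
    by (intro Bochner_Integration.integral_cong refl) (auto simp: indicator_def)
  then show ?thesis unfolding cut_norm_def by simp
qed

context
  fixes p a K :: real and n :: nat and E :: "nat set set" and W :: "real \<times> real \<Rightarrow> real"
  assumes p: "0 < p" and E: "E \<subseteq> nsets {1..n} 2" and np: "real n * p \<le> a" and aK: "a \<le> K"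
    and W: "W \<in> borel_measurable borel" and W01: "\<And>z. 0 \<le> W z \<and> W z \<le> 1"
begin

abbreviation (input) "cut_dist \<equiv> cut_norm K (\<lambda>z. graph_kernel n E (1 / p) z - W z)"

lemma graph_kernel_01: "0 \<le> graph_kernel n E (1 / p) z \<and> graph_kernel n E (1 / p) z \<le> 1"
  by (auto simp: graph_kernel_def split: prod.splits)

lemma kernel_diff_bounded: "\<bar>graph_kernel n E (1 / p) z - W z\<bar> \<le> 1"
  using graph_kernel_01[of z] W01[of z] by linarith

lemma graph_kernel_outside:
  assumes "fst z \<notin> {0<..real n * p} \<or> snd z \<notin> {0<..real n * p}"
  shows "graph_kernel n E (1 / p) z = 0"
proof -
  have "cell p u \<subseteq> {0<..real n * p}" if "u \<in> {1..n}" for u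
    using that cell_subset[OF p] by auto
  then have "fst z \<notin> (\<Union>u\<in>{1..n}. cell p u) \<or> snd z \<notin> (\<Union>u\<in>{1..n}. cell p u)"
    using assms by blast
  from step_fn_eq_0[OF this] show ?thesis
    unfolding graph_kernel_eq_step_fn[OF p E] by simp
qed

text \<open>The strips beyond \<open>b\<close> lie outside the support of the graph kernel. Testing
  with their indicators leaves minus the integral of \<open>W\<close>, and as \<open>W\<close> is
  nonnegative nothing cancels.\<close>

lemma cut_norm_mass:
  assumes b: "real n * p \<le> b"
  shows "(LINT z|lborel. indicator ({b<..K} \<times> {0..K}) z * W z) \<le> cut_dist"
    and "(LINT z|lborel. indicator ({0..K} \<times> {b<..K}) z * W z) \<le> cut_dist"
proof -
  have b0: "0 \<le> b" using p b by (intro order.trans[OF _ b]) auto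
  let ?Q = "{0..K} \<times> {0..K}" and ?U = "\<lambda>z. graph_kernel n E (1 / p) z - W z"
  have "indicator ?Q z * (?U z * indicator {b<..K} (fst z) * 1) = - (indicator ({b<..K} \<times> {0..K}) z * W z)" for z
    using graph_kernel_outside[of z] b b0 by (auto simp: indicator_def mem_Times_iff)
  then have "\<bar>LINT z|lborel. - (indicator ({b<..K} \<times> {0..K}) z * W z)\<bar> \<le> cut_dist"
    using cut_norm_upper[where U = ?U and f = "indicator {b<..K}" and g = "\<lambda>_. 1" and K = K, OF kernel_diff_bounded]
    by (simp only:) simp
  then show "(LINT z|lborel. indicator ({b<..K} \<times> {0..K}) z * W z) \<le> cut_dist"
    by (simp add: abs_le_iff)
  have "indicator ?Q z * (?U z * 1 * indicator {b<..K} (snd z)) = - (indicator ({0..K} \<times> {b<..K}) z * W z)" for z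
    using graph_kernel_outside[of z] b b0 by (auto simp: indicator_def mem_Times_iff)
  then have "\<bar>LINT z|lborel. - (indicator ({0..K} \<times> {b<..K}) z * W z)\<bar> \<le> cut_dist"
    using cut_norm_upper[where U = ?U and f = "\<lambda>_. 1" and g = "indicator {b<..K}" and K = K, OF kernel_diff_bounded]
    by (simp only:) simp
  then show "(LINT z|lborel. indicator ({0..K} \<times> {b<..K}) z * W z) \<le> cut_dist"
    by (simp add: abs_le_iff)
qed

text \<open>Vectors extend to functions constant on the cells, and integration of \<open>W\<close>
  against these sees only its cell averages. A product of two cells has area p^2, hence the
  division.\<close>

lemma cut_norm_matrix:
  assumes f: "\<And>v. v \<in> {1..n} \<Longrightarrow> \<bar>f v\<bar> \<le> 1" and g: "\<And>v. v \<in> {1..n} \<Longrightarrow> \<bar>g v\<bar> \<le> 1"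
  shows "\<bar>\<Sum>u\<in>{1..n}. \<Sum>v\<in>{1..n}. (adj E u v - cell_avg p W u v) * f u * g v\<bar> \<le> cut_dist / p\<^sup>2"
proof -
  let ?V = "{1..n}" and ?Q = "{0..K} \<times> {0..K}"
  define ext where "ext h x = (\<Sum>u\<in>?V. h u * indicator (cell p u) x)" for h :: "nat \<Rightarrow> real" and x
  have ext_on: "ext h x = h u" if u: "u \<in> ?V" "x \<in> cell p u" for h x u
  proof -
    have "ext h x = (\<Sum>v\<in>?V. if v = u then h u else 0)"
      unfolding ext_def using u by (intro sum.cong refl) (auto simp: indicator_def cell_ceiling[OF p])
    then show ?thesis using u by simp
  qed
  have ext_le: "\<bar>ext h x\<bar> \<le> 1" if h: "\<And>v. v \<in> ?V \<Longrightarrow> \<bar>h v\<bar> \<le> 1" for h x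
  proof (cases "\<exists>u\<in>?V. x \<in> cell p u")
    case True
    then show ?thesis using ext_on h by metis
  next
    case False
    then have "ext h x = 0" unfolding ext_def by (intro sum.neutral) auto
    then show ?thesis by simp
  qed
  have ext_m: "ext h \<in> borel_measurable borel" for h unfolding ext_def[abs_def] by measurable
  let ?c = "\<lambda>u v. cell p u \<times> cell p v"
  have c_sets: "?c u v \<in> sets borel" for u v unfolding borel_prod[symmetric] by measurable
  have c_fin: "emeasure lborel (?c u v) < \<infinity>" for u v
    using p by (simp add: emeasure_lborel_Times emeasure_cell ennreal_mult_less_top)
  have c_int: "integrable lborel (indicator (?c u v) :: _ \<Rightarrow> real)" for u v
    using c_sets c_fin by (simp add: integrable_indicator_iff)
  have cW: "integrable lborel (\<lambda>z. indicator (?c u v) z * W z)" for u v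
  proof (rule Bochner_Integration.integrable_bound[OF c_int])
    show "(\<lambda>z. indicator (?c u v) z * W z) \<in> borel_measurable lborel" using W c_sets by simp
    show "AE z in lborel. norm (indicator (?c u v) z * W z) \<le> norm (indicator (?c u v) z :: real)"
      using W01 by (intro AE_I2) (auto simp: indicator_def)
  qed
  have pw: "indicator ?Q z * ((graph_kernel n E (1 / p) z - W z) * ext f (fst z) * ext g (snd z))
      = (\<Sum>u\<in>?V. \<Sum>v\<in>?V. (adj E u v * indicator (?c u v) z - indicator (?c u v) z * W z) * (f u * g v))" for z
  proof (cases z)
    case (Pair x y)
    have cell_sub: "cell p u \<subseteq> {0..K}" if "u \<in> ?V" for u
    proof -
      have "cell p u \<subseteq> {0<..real n * p}" using that by (intro cell_subset[OF p]) auto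
      then show ?thesis using np aK by force
    qed
    have "ext f x * ext g y = (\<Sum>u\<in>?V. \<Sum>v\<in>?V. indicator (?c u v) z * (f u * g v))"
      unfolding ext_def sum_product Pair by (intro sum.cong refl) (auto simp: indicator_def)
    note eq = this
    have "indicator ?Q z * ((graph_kernel n E (1 / p) z - W z) * ext f (fst z) * ext g (snd z))
       = indicator ?Q z * (graph_kernel n E (1 / p) z - W z) * (ext f x * ext g y)"
      by (simp add: Pair)
    also have "\<dots> = (\<Sum>u\<in>?V. \<Sum>v\<in>?V. indicator ?Q z * (graph_kernel n E (1 / p) z - W z) * (indicator (?c u v) z * (f u * g v)))"
      unfolding eq by (simp only: sum_distrib_left)
    also have "\<dots> = (\<Sum>u\<in>?V. \<Sum>v\<in>?V. (adj E u v * indicator (?c u v) z - indicator (?c u v) z * W z) * (f u * g v))"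
    proof (intro sum.cong refl)
      fix u v assume uv: "u \<in> ?V" "v \<in> ?V"
      show "indicator ?Q z * (graph_kernel n E (1 / p) z - W z) * (indicator (?c u v) z * (f u * g v))
        = (adj E u v * indicator (?c u v) z - indicator (?c u v) z * W z) * (f u * g v)"
      proof (cases "z \<in> ?c u v")
        case True
        then have "graph_kernel n E (1 / p) z = adj E u v"
          unfolding graph_kernel_eq_step_fn[OF p E] Pair using uv disjoint_family_cell[OF p]
          by (intro step_fn_eq) (auto intro: disjoint_family_on_mono[of _ UNIV])
        moreover have "z \<in> ?Q" using True cell_sub uv Pair by blast
        ultimately show ?thesis using True by simp
      qed simp
    qed
    finally show ?thesis .
  qed
  have "(LINT z|lborel. indicator ?Q z * ((graph_kernel n E (1 / p) z - W z) * ext f (fst z) * ext g (snd z)))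
      = (\<Sum>u\<in>?V. \<Sum>v\<in>?V. (LINT z|lborel. (adj E u v * indicator (?c u v) z - indicator (?c u v) z * W z) * (f u * g v)))"
    unfolding pw using c_int cW by (subst Bochner_Integration.integral_sum) (auto intro!: Bochner_Integration.integral_sum sum.cong)
  also have "\<dots> = (\<Sum>u\<in>?V. \<Sum>v\<in>?V. p\<^sup>2 * ((adj E u v - cell_avg p W u v) * f u * g v))"
  proof (intro sum.cong refl)
    fix u v
    have "(LINT z|lborel. (adj E u v * indicator (?c u v) z - indicator (?c u v) z * W z) * (f u * g v))
       = (adj E u v * measure lborel (?c u v) - (LINT z|lborel. indicator (?c u v) z * W z)) * (f u * g v)"
      using c_int[of u v] cW[of u v] by simp
    also have "measure lborel (?c u v) = p\<^sup>2"
      using p by (simp add: measure_def emeasure_lborel_Times emeasure_cell ennreal_mult[symmetric] power2_eq_square)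
    also have "(LINT z|lborel. indicator (?c u v) z * W z) = p\<^sup>2 * cell_avg p W u v"
      using p by (simp add: cell_avg_def)
    finally show "(LINT z|lborel. (adj E u v * indicator (?c u v) z - indicator (?c u v) z * W z) * (f u * g v))
       = p\<^sup>2 * ((adj E u v - cell_avg p W u v) * f u * g v)"
      by (simp add: algebra_simps)
  qed
  finally have "p\<^sup>2 * \<bar>\<Sum>u\<in>?V. \<Sum>v\<in>?V. (adj E u v - cell_avg p W u v) * f u * g v\<bar>
      = \<bar>LINT z|lborel. indicator ?Q z * ((graph_kernel n E (1 / p) z - W z) * ext f (fst z) * ext g (snd z))\<bar>"
    by (simp add: sum_distrib_left[symmetric] abs_mult)
  also have "\<dots> \<le> cut_dist"
    by (intro cut_norm_upper kernel_diff_bounded ext_m ext_le f g)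
  finally show ?thesis using p by (simp add: field_simps)
qed

end

context rate1_process
begin

text \<open>The chain leads from the graph to the cell averages of \<open>W\<close>, then to the
  Poisson points on the averaged kernel, then to those on \<open>W\<close> itself. It costs the cut
  distance \<gamma>, a discretisation error of order n q^2, and the L1 distance \<beta> of the
  restricted kernel from its averages, together with the mass of \<open>W\<close> outside the
  grid.\<close>

proposition edge_gf_tendsto_Psi:
  fixes n :: "nat \<Rightarrow> nat" and q :: "nat \<Rightarrow> real" and E :: "nat \<Rightarrow> nat set set" and W :: "real \<times> real \<Rightarrow> real"
  assumes a: "0 < a" "a \<le> K"
    and q: "\<And>k. 0 < q k" "\<And>k. q k < 1" "q \<longlonglongrightarrow> 0" and nq: "\<And>k. real (n k) * q k \<le> a"
    and E: "\<And>k. E k \<subseteq> nsets {1..n k} 2"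
    and W: "W \<in> borel_measurable borel" and W01: "\<And>w. 0 \<le> W w \<and> W w \<le> 1" and Wsym: "\<And>x y. W (x, y) = W (y, x)"
    and cut: "(\<lambda>k. cut_norm K (\<lambda>w. graph_kernel (n k) (E k) (1 / q k) w - W w)) \<longlonglongrightarrow> 0"
    and z: "norm z \<le> 1"
  defines "W' \<equiv> \<lambda>w. indicator ({0..a} \<times> {0..a}) w * W w"
  shows "(\<lambda>k. edge_gf (q k) z {1..n k} (adj (E k))) \<longlonglongrightarrow> Psi a z W'"
proof -
  let ?Q = "{0..a} \<times> {0..a}"
  define \<gamma> where "\<gamma> k = cut_norm K (\<lambda>w. graph_kernel (n k) (E k) (1 / q k) w - W w)" for k
  define V where "V k = step_fn (cell (q k)) {1..n k} (cell_avg (q k) W')" for k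
  have W'm: "W' \<in> borel_measurable borel"
    unfolding W'_def using W indicator_square_measurable[of a] by simp
  have W'01: "0 \<le> W' w \<and> W' w \<le> 1" for w
    using W01[of w] by (auto simp: W'_def indicator_def)
  have W'0: "0 \<le> W' w" "W' w \<le> 1" for w using W'01 by auto
  have W'sym: "W' (x, y) = W' (y, x)" for x y
    using Wsym[of x y] by (auto simp: W'_def indicator_def)
  have W'int: "integrable lborel W'"
    using W01 W'm by (intro Bochner_Integration.integrable_bound[OF integrable_indicator_square[of a]])
      (auto simp: W'_def indicator_def intro!: AE_I2)
  have cell_sub: "cell (q k) u \<subseteq> {0<..a}" if "u \<in> {1..n k}" for k u
    using cell_subset[OF q(1)[of k], of u "n k"] that nq[of k] by force
  \<comment> \<open>All cells lie in the square of side \<open>a\<close>, so restricting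
    \<open>W\<close> to it does not change the averages.\<close>
  have cell_avg_eq: "cell_avg (q k) W u v = cell_avg (q k) W' u v" if "u \<in> {1..n k}" "v \<in> {1..n k}" for k u v
  proof -
    have "indicator (cell (q k) u \<times> cell (q k) v) w * W w = indicator (cell (q k) u \<times> cell (q k) v) w * W' w" for w
      using cell_sub[OF that(1)] cell_sub[OF that(2)] by (auto simp: W'_def indicator_def)
    then show ?thesis by (simp only: cell_avg_def)
  qed
  have cell_avg_sym: "cell_avg (q k) W' u v = cell_avg (q k) W' v u" for k u v
  proof -
    let ?x = "real u * q k" and ?y = "real v * q k"
    have xy: "?x \<in> cell (q k) u" "?y \<in> cell (q k) v" using q(1)[of k] by (auto simp: cell_def)
    let ?f = "\<lambda>w. indicator (cell (q k) u \<times> cell (q k) v) w * W' w"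
    have c: "cell (q k) u \<times> cell (q k) v \<in> sets borel" unfolding borel_prod[symmetric] by measurable
    have m: "(\<lambda>w. indicator (cell (q k) u \<times> cell (q k) v) w * W' w) \<in> borel_measurable (lborel \<Otimes>\<^sub>M lborel)"
      using c W'm by (simp add: lborel_prod)
    have "(LINT w|lborel. ?f w) = (LINT w|(lborel \<Otimes>\<^sub>M lborel). ?f w)" by (simp add: lborel_prod)
    also have "\<dots> = (LINT (x, y)|(lborel \<Otimes>\<^sub>M lborel). ?f (y, x))"
      using m by (intro lborel_pair.integral_product_swap[symmetric])
    also have "\<dots> = (LINT w|lborel. indicator (cell (q k) v \<times> cell (q k) u) w * W' w)"
      unfolding lborel_prod using W'sym by (intro Bochner_Integration.integral_cong) (auto simp: indicator_def)
    finally show ?thesis by (simp add: cell_avg_def)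
  qed
  have cell_avg01: "0 \<le> cell_avg (q k) W' u v \<and> cell_avg (q k) W' u v \<le> 1" for k u v
    using cell_avg_bounds[OF q(1) W'm W'0] by auto
  have step1: "norm (edge_gf (q k) z {1..n k} (adj (E k)) - edge_gf (q k) z {1..n k} (cell_avg (q k) W'))
      \<le> (1 / (1 - q k))\<^sup>2 * (4 * \<gamma> k + a * q k)" for k
  proof -
    have "norm (edge_gf (q k) z {1..n k} (adj (E k)) - edge_gf (q k) z {1..n k} (cell_avg (q k) W'))
       \<le> (q k / (1 - q k))\<^sup>2 * (4 * (\<gamma> k / (q k)\<^sup>2) + real (card {1..n k}))"
    proof (rule norm_edge_gf_diff_cut)
      fix f g :: "nat \<Rightarrow> real" assume f: "\<And>v. v \<in> {1..n k} \<Longrightarrow> \<bar>f v\<bar> \<le> 1" and g: "\<And>v. v \<in> {1..n k} \<Longrightarrow> \<bar>g v\<bar> \<le> 1"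
      have "(\<Sum>u\<in>{1..n k}. \<Sum>v\<in>{1..n k}. (adj (E k) u v - cell_avg (q k) W' u v) * f u * g v)
        = (\<Sum>u\<in>{1..n k}. \<Sum>v\<in>{1..n k}. (adj (E k) u v - cell_avg (q k) W u v) * f u * g v)"
        using cell_avg_eq by (intro sum.cong refl) simp
      then show "\<bar>\<Sum>u\<in>{1..n k}. \<Sum>v\<in>{1..n k}. (adj (E k) u v - cell_avg (q k) W' u v) * f u * g v\<bar> \<le> \<gamma> k / (q k)\<^sup>2"
        using cut_norm_matrix[OF q(1) E nq a(2) W W01 f g] by (simp add: \<gamma>_def)
    qed (use q z adj_sym adj_bounds cell_avg_sym cell_avg01 in \<open>auto intro: less_imp_le\<close>)
    \<comment> \<open>Here the weight q^2 of the two selected vertices cancels the division by q^2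
      in the matrix bound.\<close>
    also have "\<dots> = (1 / (1 - q k))\<^sup>2 * (4 * \<gamma> k + real (n k) * q k * q k)"
    proof -
      have "(q k)\<^sup>2 * (4 * (\<gamma> k / (q k)\<^sup>2) + real (card {1..n k})) = 4 * \<gamma> k + real (n k) * q k * q k"
        using q(1)[of k] by (simp add: distrib_left power2_eq_square mult.commute)
      then show ?thesis by (simp add: power_divide)
    qed
    also have "\<dots> \<le> (1 / (1 - q k))\<^sup>2 * (4 * \<gamma> k + a * q k)"
      using nq[of k] q(1)[of k] by (intro mult_left_mono add_left_mono mult_right_mono) auto
    finally show ?thesis .
  qed
  have disj: "disjoint_family_on (cell (q k)) {1..n k}" for k
    using disjoint_family_cell[OF q(1)] by (auto intro: disjoint_family_on_mono[of _ UNIV])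
  have step2: "norm (Psi a z (V k) - edge_gf (q k) z {1..n k} (cell_avg (q k) W')) \<le> 4 * (a * q k)" for k
  proof -
    have "norm (Psi a z (V k) - edge_gf (q k) z {1..n k} (cell_avg (q k) W')) \<le> 4 * real (card {1..n k}) * (q k)\<^sup>2"
      unfolding V_def
    proof (rule norm_Psi_step_fn_diff)
      show "cell (q k) v \<subseteq> {0..a}" if "v \<in> {1..n k}" for v using cell_sub[OF that] by auto
      show "measure lborel (cell (q k) v) = q k" for v using q(1)[of k] by (intro measure_cell) auto
    qed (use q(1)[of k] q(2)[of k] z cell_avg_sym cell_avg01 disj in \<open>auto intro: less_imp_le\<close>)
    also have "\<dots> = 4 * (real (n k) * q k * q k)" by (simp add: power2_eq_square)
    also have "\<dots> \<le> 4 * (a * q k)"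
      using nq[of k] q(1)[of k] by (intro mult_left_mono mult_right_mono) auto
    finally show ?thesis .
  qed
  have V01: "0 \<le> V k w \<and> V k w \<le> 1" for k w
    unfolding V_def step_fn_cell_avg[OF q(1)] using grid_avg_bounds[OF q(1) W'm W'0, of k w]
    by (auto simp: indicator_def)
  have Vm: "V k \<in> borel_measurable borel" for k unfolding V_def by (intro measurable_step_fn) auto
  define \<beta> where "\<beta> k = (LINT w|lborel. \<bar>grid_avg (q k) W' w - W' w\<bar>)" for k
  \<comment> \<open>The grid fills only the square of side n q, which may be smaller than
    \<open>a\<close>. Outside it the averaged kernel is 0, and the mass of \<open>W\<close> lies in
    two strips, each bounded by the cut distance.\<close>
  have step3: "norm (Psi a z (V k) - Psi a z W') \<le> 2 * (\<beta> k + 2 * \<gamma> k)" for k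
  proof -
    let ?b = "real (n k) * q k"
    have b0: "0 \<le> ?b" using q(1)[of k] by simp
    let ?R1 = "{?b<..K} \<times> {0..K}" and ?R2 = "{0..K} \<times> {?b<..K}"
    have R: "?R1 \<in> sets borel" "?R2 \<in> sets borel" unfolding borel_prod[symmetric] by measurable
    have gi: "integrable lborel (\<lambda>w. \<bar>grid_avg (q k) W' w - W' w\<bar>)"
      by (rule integrable_grid_avg_diff[OF q(1) W'int])
    have Ri: "integrable lborel (\<lambda>w. indicator S w * W w)" if S: "S \<in> sets borel" "S \<subseteq> {0..K} \<times> {0..K}" for S
      using W01 W S(1) S(2)[THEN subsetD]
      by (intro Bochner_Integration.integrable_bound[OF integrable_indicator_square[of K]]) (auto simp: indicator_def intro!: AE_I2)
    have R1: "integrable lborel (\<lambda>w. indicator ?R1 w * W w)" using b0 by (intro Ri R) auto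
    have R2: "integrable lborel (\<lambda>w. indicator ?R2 w * W w)" using b0 by (intro Ri R) auto
    have "(LINT w|lborel. indicator ?Q w * \<bar>V k w - W' w\<bar>)
        \<le> (LINT w|lborel. \<bar>grid_avg (q k) W' w - W' w\<bar> + (indicator ?R1 w * W w + indicator ?R2 w * W w))"
    proof (rule integral_mono_AE')
      show "integrable lborel (\<lambda>w. \<bar>grid_avg (q k) W' w - W' w\<bar> + (indicator ?R1 w * W w + indicator ?R2 w * W w))"
        using gi R1 R2 by simp
      have "AE w in lborel. fst w \<notin> {0::real} \<and> snd w \<notin> {0::real}"
        by (rule AE_lborel_coordinates_notin) simp
      then show "AE w in lborel. indicator ?Q w * \<bar>V k w - W' w\<bar>
          \<le> \<bar>grid_avg (q k) W' w - W' w\<bar> + (indicator ?R1 w * W w + indicator ?R2 w * W w)"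
      proof eventually_elim
        case (elim w)
        show ?case
        proof (cases "w \<in> {0<..?b} \<times> {0<..?b}")
          case True
          then show ?thesis
            using W01[of w] unfolding V_def step_fn_cell_avg[OF q(1)] by (auto simp: indicator_def)
        next
          case False
          then have "V k w = 0" unfolding V_def step_fn_cell_avg[OF q(1)] by simp
          moreover have "w \<in> ?R1 \<union> ?R2" if "w \<in> ?Q"
            using False elim that a(2) by (auto simp: mem_Times_iff not_le)
          ultimately show ?thesis
            using W01[of w] by (cases "w \<in> ?Q") (auto simp: W'_def indicator_def)
        qed
      qed
      show "AE w in lborel. 0 \<le> \<bar>grid_avg (q k) W' w - W' w\<bar> + (indicator ?R1 w * W w + indicator ?R2 w * W w)"
        using W01 by (intro AE_I2) (auto intro!: add_nonneg_nonneg)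
    qed
    also have "\<dots> = \<beta> k + ((LINT w|lborel. indicator ?R1 w * W w) + (LINT w|lborel. indicator ?R2 w * W w))"
      using gi R1 R2 by (simp add: \<beta>_def)
    also have "\<dots> \<le> \<beta> k + (\<gamma> k + \<gamma> k)"
      using cut_norm_mass[OF q(1) E nq a(2) W W01 order.refl] unfolding \<gamma>_def by (intro add_left_mono add_mono) auto
    finally have "2 * (LINT w|lborel. indicator ?Q w * \<bar>V k w - W' w\<bar>) \<le> 2 * (\<beta> k + 2 * \<gamma> k)" by simp
    then show ?thesis
      by (rule order.trans[OF norm_Psi_diff_le[OF Vm V01 W'm W'01 z a(1)]])
  qed
  have bound: "norm (edge_gf (q k) z {1..n k} (adj (E k)) - Psi a z W')
      \<le> (1 / (1 - q k))\<^sup>2 * (4 * \<gamma> k + a * q k) + 4 * (a * q k) + 2 * (\<beta> k + 2 * \<gamma> k)" for k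
  proof -
    let ?D = "edge_gf (q k) z {1..n k}"
    have tri: "norm (x1 - x4) \<le> norm (x1 - x2) + norm (x3 - x2) + norm (x3 - x4)" for x1 x2 x3 x4 :: complex
      using norm_triangle_ineq[of "x1 - x2" "x2 - x4"] norm_triangle_ineq[of "x2 - x3" "x3 - x4"]
        norm_minus_commute[of x2 x3] by simp
    have "norm (?D (adj (E k)) - Psi a z W') \<le> norm (?D (adj (E k)) - ?D (cell_avg (q k) W'))
        + norm (Psi a z (V k) - ?D (cell_avg (q k) W')) + norm (Psi a z (V k) - Psi a z W')"
      by (rule tri)
    then show ?thesis
      using step1[of k] step2[of k] step3[of k] by linarith
  qed
  have "(\<lambda>k. (1 / (1 - q k))\<^sup>2 * (4 * \<gamma> k + a * q k) + 4 * (a * q k) + 2 * (\<beta> k + 2 * \<gamma> k))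
      \<longlonglongrightarrow> (1 / (1 - 0))\<^sup>2 * (4 * 0 + a * 0) + 4 * (a * 0) + 2 * (0 + 2 * 0)"
    using cut unfolding \<gamma>_def[symmetric]
    by (intro tendsto_intros q(3) grid_avg_tendsto_L1[OF W'int q(1,3), folded \<beta>_def]) auto
  then have "(\<lambda>k. norm (edge_gf (q k) z {1..n k} (adj (E k)) - Psi a z W')) \<longlonglongrightarrow> 0"
    by (intro tendsto_0_le_real[OF _ bound]) auto
  then show ?thesis
    by (simp add: tendsto_norm_zero_iff LIM_zero_iff)
qed

end

section \<open>Compactness of kernels\<close>

lemma diagonal_subsequence:
  fixes F :: "'i::countable \<Rightarrow> nat \<Rightarrow> real"
  assumes "\<And>i. bounded (range (F i))"
  obtains r where "strict_mono r" "\<And>i. convergent (\<lambda>k. F i (r k))"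
proof -
  interpret subseqs "\<lambda>m s. convergent (\<lambda>k. F (from_nat m) (s k))"
  proof
    fix m and s :: "nat \<Rightarrow> nat"
    have "bounded (range (\<lambda>k. F (from_nat m) (s k)))"
      using assms by (rule bounded_subset) auto
    from bounded_imp_convergent_subsequence[OF this]
    show "\<exists>r'. strict_mono r' \<and> convergent (\<lambda>k. F (from_nat m) ((s \<circ> r') k))"
      by (auto simp: convergent_def o_def)
  qed
  have "convergent (\<lambda>k. F i (diagseq k))" for i
  proof -
    have "convergent (\<lambda>k. F (from_nat (to_nat i)) ((diagseq \<circ> (+) (Suc (to_nat i))) k))"
    proof (rule diagseq_holds)
      fix r s :: "nat \<Rightarrow> nat" and m
      assume "strict_mono r" "convergent (\<lambda>k. F (from_nat m) (s k))"
      then show "convergent (\<lambda>k. F (from_nat m) ((s \<circ> r) k))"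
        using convergent_subseq_convergent[of "\<lambda>k. F (from_nat m) (s k)" r] by (simp add: o_def)
    qed
    then have "convergent (\<lambda>k. F i (diagseq (k + Suc (to_nat i))))"
      by (simp add: add.commute)
    then show ?thesis
      by (subst (asm) convergent_ignore_initial_segment)
  qed
  then show ?thesis using that subseq_diagseq by blast
qed

definition kernel_on :: "real \<Rightarrow> (real \<times> real \<Rightarrow> real) \<Rightarrow> bool" where
  "kernel_on a W \<longleftrightarrow> W \<in> borel_measurable borel \<and> (\<forall>w. 0 \<le> W w \<and> W w \<le> 1) \<and>
     (\<forall>x y. W (x, y) = W (y, x)) \<and> (\<forall>w. w \<notin> {0..a} \<times> {0..a} \<longrightarrow> W w = 0)"

lemma kernel_onD:
  assumes "kernel_on a W"
  shows "W \<in> borel_measurable borel" "0 \<le> W w \<and> W w \<le> 1" "W (x, y) = W (y, x)"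
    "w \<notin> {0..a} \<times> {0..a} \<Longrightarrow> W w = 0"
  using assms unfolding kernel_on_def by blast+

text \<open>The Cauchy property gives almost everywhere convergence along a subsequence, and
  dominated convergence on the square turns this into L1 convergence.\<close>

lemma L1_limit_of_kernels:
  fixes U :: "nat \<Rightarrow> real \<times> real \<Rightarrow> real"
  assumes Um: "\<And>m. U m \<in> borel_measurable borel" and U01: "\<And>m w. 0 \<le> U m w \<and> U m w \<le> 1"
    and Usym: "\<And>m x y. U m (x, y) = U m (y, x)"
    and cauchy: "\<And>e. 0 < e \<Longrightarrow> \<exists>N. \<forall>i\<ge>N. \<forall>j\<ge>N. (LINT w|lborel. indicator ({0..a} \<times> {0..a}) w * \<bar>U i w - U j w\<bar>) < e"
  obtains W r where "strict_mono r" "kernel_on a W"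
    "(\<lambda>i. LINT w|lborel. indicator ({0..a} \<times> {0..a}) w * \<bar>U (r i) w - W w\<bar>) \<longlonglongrightarrow> 0"
proof -
  let ?Q = "{0..a} \<times> {0..a}"
  define u where "u m w = indicator ?Q w * U m w" for m w
  have um [measurable]: "u m \<in> borel_measurable borel" for m
    unfolding u_def using Um indicator_square_measurable[of a] by simp
  have u01: "0 \<le> u m w" "u m w \<le> 1" "u m w \<le> indicator ?Q w" for m w
    using U01[of m w] by (auto simp: u_def indicator_def)
  have ui: "integrable lborel (u m)" for m
    using u01 um by (intro Bochner_Integration.integrable_bound[OF integrable_indicator_square[of a]]) (auto intro!: AE_I2)
  have "norm (u i w - u j w) = indicator ?Q w * \<bar>U i w - U j w\<bar>" for i j w
    by (simp add: u_def indicator_def)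
  then have "\<exists>N. \<forall>i\<ge>N. \<forall>j\<ge>N. (LINT w|lborel. norm (u i w - u j w)) < e" if "0 < e" for e
    using cauchy[OF that] by simp
  from cauchy_L1_AE_cauchy_subseq[OF ui this] obtain r where r: "strict_mono r" "AE w in lborel. Cauchy (\<lambda>i. u (r i) w)"
    by blast
  \<comment> \<open>Clamping and the indicator make \<open>W\<close> a kernel at every point, also
    where the sequence diverges. Symmetry survives because the sequences at (x, y) and (y, x)
    coincide.\<close>
  define W where "W w = indicator ?Q w * max 0 (min 1 (lim (\<lambda>i. u (r i) w)))" for w
  have "(\<lambda>w. lim (\<lambda>i. u (r i) w)) \<in> borel_measurable borel" by measurable
  then have Wm [measurable]: "W \<in> borel_measurable borel"
    unfolding W_def[abs_def] using indicator_square_measurable[of a] by measurable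
  have W01: "0 \<le> W w \<and> W w \<le> 1" for w by (auto simp: W_def indicator_def)
  have "u m (x, y) = u m (y, x)" for m x y using Usym[of m x y] by (auto simp: u_def indicator_def)
  then have Wsym: "W (x, y) = W (y, x)" for x y by (auto simp: W_def indicator_def)
  have "(\<lambda>i. LINT w|lborel. indicator ?Q w * \<bar>U (r i) w - W w\<bar>) \<longlonglongrightarrow> (LINT w|(lborel :: (real \<times> real) measure). 0)"
  proof (rule integral_dominated_convergence[where w = "indicator ?Q"])
    show "integrable lborel (indicator ?Q :: _ \<Rightarrow> real)" by (rule integrable_indicator_square)
    show "(\<lambda>w. indicator ?Q w * \<bar>U (r i) w - W w\<bar>) \<in> borel_measurable lborel" for i
      using Um[of "r i"] indicator_square_measurable[of a] by simp
    have "\<bar>U (r i) w - W w\<bar> \<le> 1" for i w using U01[of "r i" w] W01[of w] by linarith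
    then show "AE w in lborel. norm (indicator ?Q w * \<bar>U (r i) w - W w\<bar>) \<le> indicator ?Q w" for i
      by (intro AE_I2) (simp add: indicator_def)
    show "AE w in lborel. (\<lambda>i. indicator ?Q w * \<bar>U (r i) w - W w\<bar>) \<longlonglongrightarrow> 0"
      using r(2)
    proof eventually_elim
      case (elim w)
      show ?case
      proof (cases "w \<in> ?Q")
        case True
        have lim: "(\<lambda>i. u (r i) w) \<longlonglongrightarrow> lim (\<lambda>i. u (r i) w)"
          using elim by (simp add: Cauchy_convergent_iff convergent_LIMSEQ_iff)
        have "0 \<le> lim (\<lambda>i. u (r i) w)" "lim (\<lambda>i. u (r i) w) \<le> 1"
          using LIMSEQ_le_const[OF lim, of 0] LIMSEQ_le_const2[OF lim, of 1] u01 by auto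
        then have "W w = lim (\<lambda>i. u (r i) w)" using True by (simp add: W_def)
        moreover have "u (r i) w = U (r i) w" for i using True by (simp add: u_def)
        ultimately have "(\<lambda>i. U (r i) w) \<longlonglongrightarrow> W w" using lim by simp
        then have "(\<lambda>i. \<bar>U (r i) w - W w\<bar>) \<longlonglongrightarrow> \<bar>W w - W w\<bar>" by (intro tendsto_intros)
        then show ?thesis using True by simp
      qed simp
    qed
  qed simp
  then have "(\<lambda>i. LINT w|lborel. indicator ?Q w * \<bar>U (r i) w - W w\<bar>) \<longlonglongrightarrow> 0" by simp
  then show ?thesis
    using Wm W01 Wsym by (intro that[of r W] r(1)) (auto simp: W_def kernel_on_def)
qed

text \<open>The vertices are sorted by their label of level \<open>k\<close>; as the labels of lower levels are
  quotients of it, every block of level \<open>m \<le> k\<close> then occupies an interval.\<close>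

definition vertex_order :: "nat \<Rightarrow> (nat \<Rightarrow> nat \<Rightarrow> real) \<Rightarrow> nat \<Rightarrow> nat \<Rightarrow> nat" where
  "vertex_order n A k = key_rank {1..n} (\<lambda>v. greedy_label {1..n} A k v * Suc n + v)"

text \<open>The left endpoint of the interval of block \<open>c\<close> once the vertices are sorted
  by label. It refers to level \<open>m\<close> only, so sorting by a finer level leaves it in
  place.\<close>

definition block_bound :: "real \<Rightarrow> nat \<Rightarrow> (nat \<Rightarrow> nat \<Rightarrow> real) \<Rightarrow> nat \<Rightarrow> nat \<Rightarrow> real" where
  "block_bound q n A m c = q * real (card {v\<in>{1..n}. greedy_label {1..n} A m v < c})"

definition block_avg :: "nat \<Rightarrow> (nat \<Rightarrow> nat \<Rightarrow> real) \<Rightarrow> nat \<Rightarrow> nat \<Rightarrow> nat \<Rightarrow> real" where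
  "block_avg n A m c d = block_density {1..n} A (greedy_label {1..n} A m) c d"

text \<open>A product of two cells has area q^2, which makes this the squared L2 norm of the block
  kernel.\<close>

definition scaled_energy :: "real \<Rightarrow> nat \<Rightarrow> (nat \<Rightarrow> nat \<Rightarrow> real) \<Rightarrow> nat \<Rightarrow> real" where
  "scaled_energy q n A m = q\<^sup>2 * energy {1..n} A (greedy_label {1..n} A m)"

text \<open>At level \<open>m\<close> finitely many bounded numbers determine this kernel, and how
  many does not depend on \<open>n\<close>; this is the source of compactness. Labels that do not
  occur have empty intervals.\<close>

definition block_kernel :: "real \<Rightarrow> nat \<Rightarrow> (nat \<Rightarrow> nat \<Rightarrow> real) \<Rightarrow> nat \<Rightarrow> real \<times> real \<Rightarrow> real" where
  "block_kernel q n A m =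
     step_fn (\<lambda>c. {block_bound q n A m c<..block_bound q n A m (Suc c)}) {..<4 ^ m} (block_avg n A m)"

abbreviation block_matrix :: "nat \<Rightarrow> (nat \<Rightarrow> nat \<Rightarrow> real) \<Rightarrow> nat \<Rightarrow> nat \<Rightarrow> nat \<Rightarrow> real" where
  "block_matrix n A m u v \<equiv> block_avg n A m (greedy_label {1..n} A m u) (greedy_label {1..n} A m v)"

section \<open>Blocks as intervals of sorted cells\<close>

lemma vertex_order_bij: "bij_betw (vertex_order n A k) {1..n} {1..n}"
proof -
  have "inj_on (\<lambda>v. greedy_label {1..n} A k v * Suc n + v) {1..n}"
  proof (rule inj_onI)
    fix u v assume "u \<in> {1..n}" "v \<in> {1..n}"
      "greedy_label {1..n} A k u * Suc n + u = greedy_label {1..n} A k v * Suc n + v"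
    \<comment> \<open>In base \<open>Suc n\<close> the label forms the leading digits of the key and
      the vertex its last digit.\<close>
    then have "(greedy_label {1..n} A k u * Suc n + u) mod Suc n = (greedy_label {1..n} A k v * Suc n + v) mod Suc n"
      "u < Suc n" "v < Suc n" by auto
    then show "u = v" by (simp only: mod_mult_self3 mod_less)
  qed
  from bij_betw_key_rank[OF _ this] show ?thesis by (simp add: vertex_order_def)
qed

lemma vertex_order_between:
  fixes A :: "nat \<Rightarrow> nat \<Rightarrow> real"
  assumes "m \<le> k" and v: "v \<in> {1..n}"
  defines "l \<equiv> greedy_label {1..n} A m"
  shows "card {u \<in> {1..n}. l u < l v} < vertex_order n A k v" "vertex_order n A k v \<le> card {u \<in> {1..n}. l u < Suc (l v)}"
proof -
  let ?L = "greedy_label {1..n} A k"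
  have "?L u * Suc n + u < ?L w * Suc n + w" if "u \<in> {1..n}" "w \<in> {1..n}" "l u < l w" for u w
  proof -
    have "l u = ?L u div 4 ^ (k - m)" "l w = ?L w div 4 ^ (k - m)"
      using greedy_label_div[of "{1..n}" A m _ "k - m"] assms(1) by (auto simp: l_def)
    then have "?L u < ?L w" using that(3) by (metis div_le_mono leD leI)
    then have "(?L u + 1) * Suc n \<le> ?L w * Suc n" by (intro mult_le_mono1) simp
    then show ?thesis using that(1) by simp
  qed
  then show "card {u \<in> {1..n}. l u < l v} < vertex_order n A k v" "vertex_order n A k v \<le> card {u \<in> {1..n}. l u < Suc (l v)}"
    unfolding vertex_order_def using key_rank_between[OF _ v, of l "\<lambda>v. ?L v * Suc n + v"] by auto
qed

lemma block_bound_mono: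
  assumes "0 \<le> q" "c \<le> d"
  shows "block_bound q n A m c \<le> block_bound q n A m d"
  unfolding block_bound_def using assms by (intro mult_left_mono) (auto intro!: card_mono)

lemma block_bound_nonneg: "0 \<le> q \<Longrightarrow> 0 \<le> block_bound q n A m c"
  by (simp add: block_bound_def)

lemma block_bound_le: "0 \<le> q \<Longrightarrow> block_bound q n A m c \<le> real n * q"
proof -
  assume "0 \<le> q"
  moreover have "card {v\<in>{1..n}. greedy_label {1..n} A m v < c} \<le> card {1..n}" by (intro card_mono) auto
  ultimately show ?thesis unfolding block_bound_def by (simp add: mult.commute mult_left_mono)
qed

lemma disjoint_block_intervals:
  assumes "0 \<le> q"
  shows "disjoint_family (\<lambda>c. {block_bound q n A m c<..block_bound q n A m (Suc c)})"
  unfolding disjoint_family_on_def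
proof (intro ballI impI)
  fix c d :: nat assume "c \<noteq> d"
  then consider "Suc c \<le> d" | "Suc d \<le> c" by linarith
  then show "{block_bound q n A m c<..block_bound q n A m (Suc c)} \<inter> {block_bound q n A m d<..block_bound q n A m (Suc d)} = {}"
    using block_bound_mono[OF assms, of "Suc c" d n A m] block_bound_mono[OF assms, of "Suc d" c n A m] by cases auto
qed

lemma cell_in_block:
  assumes "0 < q" "m \<le> k" and v: "v \<in> {1..n}"
  shows "cell q (vertex_order n A k v) \<subseteq>
    {block_bound q n A m (greedy_label {1..n} A m v)<..block_bound q n A m (Suc (greedy_label {1..n} A m v))}"
proof
  fix x assume x: "x \<in> cell q (vertex_order n A k v)"
  let ?r = "vertex_order n A k v" and ?l = "greedy_label {1..n} A m"
  have "real (card {u \<in> {1..n}. ?l u < ?l v}) \<le> real ?r - 1" "real ?r \<le> real (card {u \<in> {1..n}. ?l u < Suc (?l v)})"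
    using vertex_order_between[OF assms(2) v, of A] by auto
  then have "block_bound q n A m (?l v) \<le> (real ?r - 1) * q" "real ?r * q \<le> block_bound q n A m (Suc (?l v))"
    using assms(1) by (auto simp: block_bound_def mult.commute intro: mult_left_mono mult_right_mono)
  then show "x \<in> {block_bound q n A m (?l v)<..block_bound q n A m (Suc (?l v))}"
    using x by (auto simp: cell_def)
qed

text \<open>When the vertices are sorted by a finer level \<open>k\<close>, every cell still lies
  inside one block interval of level \<open>m\<close>. Kernels of two levels can therefore be
  compared on common cells.\<close>

lemma block_kernel_eq_step_fn:
  assumes q: "0 < q" and mk: "m \<le> k"
  shows "block_kernel q n A m w = step_fn (\<lambda>v. cell q (vertex_order n A k v)) {1..n} (block_matrix n A m) w"
proof (cases w)
  case (Pair x y)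
  let ?l = "greedy_label {1..n} A m" and ?r = "vertex_order n A k"
  let ?J = "\<lambda>c. {block_bound q n A m c<..block_bound q n A m (Suc c)}"
  have disj: "disjoint_family_on (\<lambda>v. cell q (?r v)) {1..n}"
    unfolding disjoint_family_on_def
  proof (intro ballI impI)
    fix u v assume "u \<in> {1..n}" "v \<in> {1..n}" "u \<noteq> v"
    then have "?r u \<noteq> ?r v"
      using vertex_order_bij[of n A k] by (meson bij_betw_imp_inj_on inj_onD)
    then show "cell q (?r u) \<inter> cell q (?r v) = {}"
      using disjoint_family_cell[OF q] by (simp add: disjoint_family_on_def)
  qed
  have dJ: "disjoint_family_on ?J {..<4 ^ m}"
    using disjoint_block_intervals[of q n A m] q by (auto intro: disjoint_family_on_mono[of _ UNIV])
  show ?thesis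
  proof (cases "x \<in> (\<Union>v\<in>{1..n}. cell q (?r v)) \<and> y \<in> (\<Union>v\<in>{1..n}. cell q (?r v))")
    case True
    then obtain u v where uv: "u \<in> {1..n}" "x \<in> cell q (?r u)" "v \<in> {1..n}" "y \<in> cell q (?r v)" by auto
    have "x \<in> ?J (?l u)" by (rule subsetD[OF cell_in_block[OF q mk uv(1)] uv(2)])
    moreover have "y \<in> ?J (?l v)" by (rule subsetD[OF cell_in_block[OF q mk uv(3)] uv(4)])
    ultimately have "block_kernel q n A m (x, y) = block_avg n A m (?l u) (?l v)"
      unfolding block_kernel_def
      by (intro step_fn_eq dJ) (simp_all only: finite_lessThan lessThan_iff greedy_label_less)
    also have "\<dots> = step_fn (\<lambda>v. cell q (?r v)) {1..n} (block_matrix n A m) (x, y)"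
      using uv by (intro step_fn_eq[symmetric] disj) auto
    finally show ?thesis by (simp add: Pair)
  next
    case False
    have "x \<in> (\<Union>v\<in>{1..n}. cell q (?r v))" if "x \<in> ?J c" for x c
    proof -
      have "x \<in> {0<..real n * q}"
        using that block_bound_nonneg[of q n A m c] block_bound_le[of q n A m "Suc c"] q by auto
      then obtain j where "j \<in> {1..n}" "x \<in> cell q j" by (rule in_cellE[OF q])
      moreover from \<open>j \<in> {1..n}\<close> have "j \<in> ?r ` {1..n}"
        using bij_betw_imp_surj_on[OF vertex_order_bij, of n A k] by simp
      then obtain v where "v \<in> {1..n}" "?r v = j" by auto
      ultimately show ?thesis by auto
    qed
    then have "x \<notin> (\<Union>c\<in>{..<4 ^ m}. ?J c) \<or> y \<notin> (\<Union>c\<in>{..<4 ^ m}. ?J c)" using False by blast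
    then have L: "block_kernel q n A m (x, y) = 0"
      unfolding block_kernel_def by (rule step_fn_eq_0)
    have "x \<notin> (\<Union>v\<in>{1..n}. cell q (?r v)) \<or> y \<notin> (\<Union>v\<in>{1..n}. cell q (?r v))" using False by blast
    then have R: "step_fn (\<lambda>v. cell q (?r v)) {1..n} (block_matrix n A m) (x, y) = 0"
      by (rule step_fn_eq_0)
    show ?thesis unfolding Pair L R ..
  qed
qed

lemma step_fn_sym:
  assumes "\<And>u v. u \<in> V \<Longrightarrow> v \<in> V \<Longrightarrow> c u v = c v u"
  shows "step_fn I V c (x, y) = step_fn I V c (y, x)"
proof -
  have "step_fn I V c (x, y) = (\<Sum>v\<in>V. \<Sum>u\<in>V. c u v * indicator (I u \<times> I v) (x, y))"
    unfolding step_fn_def by (rule sum.swap)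
  also have "\<dots> = step_fn I V c (y, x)"
    unfolding step_fn_def using assms by (intro sum.cong refl) (auto simp: indicator_def)
  finally show ?thesis .
qed

text \<open>Away from the limiting endpoints membership in each interval is eventually constant; the
  excluded points lie on finitely many lines.\<close>

lemma step_fn_tendsto:
  fixes S :: "nat \<Rightarrow> nat \<Rightarrow> real" and T :: "nat \<Rightarrow> real"
  assumes S: "\<And>c. (\<lambda>k. S k c) \<longlonglongrightarrow> T c" and D: "\<And>c d. (\<lambda>k. D k c d) \<longlonglongrightarrow> D' c d"
    and w: "fst w \<notin> T ` {..M}" "snd w \<notin> T ` {..M}"
  shows "(\<lambda>k. step_fn (\<lambda>c. {S k c<..S k (Suc c)}) {..<M} (D k) w)
    \<longlonglongrightarrow> step_fn (\<lambda>c. {T c<..T (Suc c)}) {..<M} D' w"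
proof -
  have ind: "\<forall>\<^sub>F k in sequentially. (x \<in> {S k c<..S k (Suc c)}) = (x \<in> {T c<..T (Suc c)})"
    if "x \<notin> T ` {..M}" "c < M" for x c
  proof -
    have cmp: "\<forall>\<^sub>F k in sequentially. (S k c < x) = (T c < x) \<and> (x \<le> S k c) = (x \<le> T c)" if "x \<noteq> T c" for c
    proof (cases "T c < x")
      case True
      have "\<forall>\<^sub>F k in sequentially. S k c < x" using order_tendstoD(2)[OF S True] .
      then show ?thesis by eventually_elim (use True in auto)
    next
      case False
      then have "x < T c" using that by simp
      then have "\<forall>\<^sub>F k in sequentially. x < S k c" using order_tendstoD(1)[OF S] by blast
      then show ?thesis by eventually_elim (use \<open>x < T c\<close> in auto)
    qed
    have "x \<noteq> T c" "x \<noteq> T (Suc c)" using that by auto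
    from cmp[OF this(1)] cmp[OF this(2)] show ?thesis by eventually_elim auto
  qed
  show ?thesis
    unfolding step_fn_def
  proof (intro tendsto_sum tendsto_mult D)
    fix c d assume cd: "c \<in> {..<M}" "d \<in> {..<M}"
    have "\<forall>\<^sub>F k in sequentially. indicator ({S k c<..S k (Suc c)} \<times> {S k d<..S k (Suc d)}) w
        = (indicator ({T c<..T (Suc c)} \<times> {T d<..T (Suc d)}) w :: real)"
    proof -
      have "\<forall>\<^sub>F k in sequentially. (fst w \<in> {S k c<..S k (Suc c)}) = (fst w \<in> {T c<..T (Suc c)})"
        "\<forall>\<^sub>F k in sequentially. (snd w \<in> {S k d<..S k (Suc d)}) = (snd w \<in> {T d<..T (Suc d)})"
        using ind w cd by (simp_all only: lessThan_iff)
      then show ?thesis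
        by eventually_elim (simp only: indicator_def mem_Times_iff)
    qed
    then show "(\<lambda>k. indicator ({S k c<..S k (Suc c)} \<times> {S k d<..S k (Suc d)}) w)
        \<longlonglongrightarrow> (indicator ({T c<..T (Suc c)} \<times> {T d<..T (Suc d)}) w :: real)"
      by (rule tendsto_eventually)
  qed
qed

text \<open>For a given accuracy one first fixes a level m with small limiting bound \<beta> m and
  then lets k grow.\<close>

lemma tendsto_0_of_bounds:
  fixes x :: "nat \<Rightarrow> real" and b :: "nat \<Rightarrow> nat \<Rightarrow> real"
  assumes x: "\<And>k. 0 \<le> x k" and le: "\<And>m. \<forall>\<^sub>F k in sequentially. x k \<le> b m k"
    and b: "\<And>m. b m \<longlonglongrightarrow> \<beta> m" and \<beta>: "\<beta> \<longlonglongrightarrow> 0"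
  shows "x \<longlonglongrightarrow> 0"
proof (rule LIMSEQ_I)
  fix e :: real assume "0 < e"
  then obtain m where m: "\<beta> m < e"
    using order_tendstoD(2)[OF \<beta>, of e] by (auto simp: eventually_sequentially)
  have "\<forall>\<^sub>F k in sequentially. x k < e"
    using le[of m] order_tendstoD(2)[OF b m] by eventually_elim simp
  then show "\<exists>N. \<forall>k\<ge>N. norm (x k - 0) < e"
    using x by (auto simp: eventually_sequentially)
qed

lemma integral_abs_step_fn_le:
  fixes c :: "nat \<Rightarrow> nat \<Rightarrow> real"
  assumes fin: "finite V" and I: "\<And>v. v \<in> V \<Longrightarrow> I v \<in> sets borel" and q: "\<And>v. v \<in> V \<Longrightarrow> emeasure lborel (I v) = ennreal q" "0 \<le> q"
  shows "integrable lborel (\<lambda>w. \<bar>step_fn I V c w\<bar>)"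
    and "(LINT w|lborel. \<bar>step_fn I V c w\<bar>) \<le> q\<^sup>2 * (\<Sum>u\<in>V. \<Sum>v\<in>V. \<bar>c u v\<bar>)"
proof -
  have sets: "I u \<times> I v \<in> sets borel" if "u \<in> V" "v \<in> V" for u v
    using that I unfolding borel_prod[symmetric] by auto
  have em: "emeasure lborel (I u \<times> I v) = ennreal (q\<^sup>2)" if "u \<in> V" "v \<in> V" for u v
    using that I q by (simp add: emeasure_lborel_Times ennreal_mult[symmetric] power2_eq_square)
  have int: "integrable lborel (indicator (I u \<times> I v) :: _ \<Rightarrow> real)" if "u \<in> V" "v \<in> V" for u v
    using sets[OF that] em[OF that] by (simp add: integrable_indicator_iff)
  have "integrable lborel (step_fn I V c)"
    unfolding step_fn_def[abs_def] using int by (intro Bochner_Integration.integrable_sum integrable_mult_right) auto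
  then show i: "integrable lborel (\<lambda>w. \<bar>step_fn I V c w\<bar>)" by simp
  have "(LINT w|lborel. \<bar>step_fn I V c w\<bar>) \<le> (LINT w|lborel. (\<Sum>u\<in>V. \<Sum>v\<in>V. \<bar>c u v\<bar> * indicator (I u \<times> I v) w))"
  proof (rule integral_mono[OF i])
    show "integrable lborel (\<lambda>w. \<Sum>u\<in>V. \<Sum>v\<in>V. \<bar>c u v\<bar> * indicator (I u \<times> I v) w)"
      using int by (intro Bochner_Integration.integrable_sum integrable_mult_right) auto
    show "\<bar>step_fn I V c w\<bar> \<le> (\<Sum>u\<in>V. \<Sum>v\<in>V. \<bar>c u v\<bar> * indicator (I u \<times> I v) w)" for w
      unfolding step_fn_def by (intro order.trans[OF sum_abs] sum_mono) (simp add: abs_mult)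
  qed
  also have "\<dots> = (\<Sum>u\<in>V. \<Sum>v\<in>V. \<bar>c u v\<bar> * measure lborel (I u \<times> I v))"
    using int by (subst Bochner_Integration.integral_sum)
      (auto intro!: Bochner_Integration.integrable_sum sum.cong simp: Bochner_Integration.integral_sum)
  also have "\<dots> = q\<^sup>2 * (\<Sum>u\<in>V. \<Sum>v\<in>V. \<bar>c u v\<bar>)"
    unfolding sum_distrib_left using em by (intro sum.cong refl) (simp add: measure_def mult.commute)
  finally show "(LINT w|lborel. \<bar>step_fn I V c w\<bar>) \<le> q\<^sup>2 * (\<Sum>u\<in>V. \<Sum>v\<in>V. \<bar>c u v\<bar>)" .
qed

section \<open>Estimates for the block averages of a single graph\<close>

context
  fixes a q :: real and n :: nat and A :: "nat \<Rightarrow> nat \<Rightarrow> real"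
  assumes q: "0 < q" "q < 1" and nq: "real n * q \<le> a"
    and Asym: "\<And>u v. u \<in> {1..n} \<Longrightarrow> v \<in> {1..n} \<Longrightarrow> A u v = A v u"
    and A01: "\<And>u v. u \<in> {1..n} \<Longrightarrow> v \<in> {1..n} \<Longrightarrow> 0 \<le> A u v \<and> A u v \<le> 1"
begin

lemma block_avg_bounds: "0 \<le> block_avg n A m c d \<and> block_avg n A m c d \<le> 1"
  unfolding block_avg_def using block_density_bounds[of "{1..n}" A] A01 by auto

lemma block_avg_sym: "block_avg n A m c d = block_avg n A m d c"
  unfolding block_avg_def using Asym by (intro block_density_sym) auto

lemma scaled_energy_mono:
  assumes "m \<le> l"
  shows "scaled_energy q n A m \<le> scaled_energy q n A l"
  unfolding scaled_energy_def using greedy_label_div[of "{1..n}" A m _ "l - m"] assms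
  by (intro mult_left_mono energy_mono[where h = "\<lambda>x. x div 4 ^ (l - m)"]) auto

lemma scaled_energy_bounds: "0 \<le> scaled_energy q n A m" "scaled_energy q n A m \<le> a\<^sup>2"
proof -
  show "0 \<le> scaled_energy q n A m" by (simp add: scaled_energy_def energy_nonneg)
  have "scaled_energy q n A m \<le> q\<^sup>2 * (real (card {1..n}))\<^sup>2"
    unfolding scaled_energy_def using A01 by (intro mult_left_mono energy_le) auto
  also have "\<dots> = (real n * q)\<^sup>2" by (simp add: power_mult_distrib)
  also have "\<dots> \<le> a\<^sup>2" using nq q by (intro power_mono) auto
  finally show "scaled_energy q n A m \<le> a\<^sup>2" .
qed

lemma scaled_sqrt:
  assumes "0 \<le> x"
  shows "q\<^sup>2 * (real (card {1..n}) * sqrt x) \<le> a * sqrt (q\<^sup>2 * x)"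
proof -
  have "q\<^sup>2 * (real (card {1..n}) * sqrt x) = (real n * q) * sqrt (q\<^sup>2 * x)"
    using q by (simp add: real_sqrt_mult power2_eq_square)
  also have "\<dots> \<le> a * sqrt (q\<^sup>2 * x)" using nq assms by (intro mult_right_mono) auto
  finally show ?thesis .
qed

text \<open>The greedy step supplies a cut bound n sqrt(x), with x the energy increment; the weight
  q^2 turns it into (n q) sqrt(q^2 x), which involves only quantities that stay bounded as the
  graphs grow.\<close>

lemma norm_edge_gf_block_diff:
  assumes z: "norm z \<le> 1"
  shows "norm (edge_gf q z {1..n} A - edge_gf q z {1..n} (block_matrix n A m))
    \<le> (1 / (1 - q))\<^sup>2 * (4 * (a * sqrt (scaled_energy q n A (Suc m) - scaled_energy q n A m)) + a * q)"
proof -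
  let ?E = "\<lambda>m. energy {1..n} A (greedy_label {1..n} A m)"
  define \<kappa> where "\<kappa> = real (card {1..n}) * sqrt (?E (Suc m) - ?E m)"
  have E: "?E m \<le> ?E (Suc m)"
    using scaled_energy_mono[of m "Suc m"] q by (simp add: scaled_energy_def)
  have "norm (edge_gf q z {1..n} A - edge_gf q z {1..n} (block_matrix n A m))
      \<le> (q / (1 - q))\<^sup>2 * (4 * \<kappa> + real (card {1..n}))"
  proof (rule norm_edge_gf_diff_cut)
    fix f g :: "nat \<Rightarrow> real"
    assume "\<And>v. v \<in> {1..n} \<Longrightarrow> \<bar>f v\<bar> \<le> 1" "\<And>v. v \<in> {1..n} \<Longrightarrow> \<bar>g v\<bar> \<le> 1"
    then show "\<bar>\<Sum>u\<in>{1..n}. \<Sum>v\<in>{1..n}. (A u v - block_matrix n A m u v) * f u * g v\<bar> \<le> \<kappa>"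
      unfolding \<kappa>_def block_avg_def by (intro greedy_label_cut) auto
  qed (use q z Asym A01 block_avg_sym block_avg_bounds in auto)
  also have "\<dots> = (1 / (1 - q))\<^sup>2 * (4 * (q\<^sup>2 * \<kappa>) + real n * q * q)"
    by (simp add: power_divide power2_eq_square distrib_left add_divide_distrib mult_ac)
  also have "\<dots> \<le> (1 / (1 - q))\<^sup>2 * (4 * (a * sqrt (q\<^sup>2 * (?E (Suc m) - ?E m))) + a * q)"
    using scaled_sqrt[of "?E (Suc m) - ?E m"] E nq q unfolding \<kappa>_def
    by (intro mult_left_mono add_mono mult_right_mono) auto
  finally show ?thesis by (simp add: scaled_energy_def right_diff_distrib)
qed

lemma block_kernel_bounds: "0 \<le> block_kernel q n A m w \<and> block_kernel q n A m w \<le> 1"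
  unfolding block_kernel_def using disjoint_block_intervals[of q n A m] q block_avg_bounds
  by (intro step_fn_bounds) (auto intro: disjoint_family_on_mono[of _ UNIV])

lemma block_kernel_measurable: "block_kernel q n A m \<in> borel_measurable borel"
  unfolding block_kernel_def by (intro measurable_step_fn) auto

text \<open>On the common cells of level \<open>l\<close> the two kernels differ by nested block
  averages, whose l1 distance the energy increment controls.\<close>

lemma block_kernel_L1_diff:
  assumes "m \<le> l"
  shows "integrable lborel (\<lambda>w. \<bar>block_kernel q n A l w - block_kernel q n A m w\<bar>)"
    and "(LINT w|lborel. \<bar>block_kernel q n A l w - block_kernel q n A m w\<bar>)
      \<le> a * sqrt (scaled_energy q n A l - scaled_energy q n A m)"
proof -
  let ?I = "\<lambda>v. cell q (vertex_order n A l v)" and ?V = "{1..n}"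
  let ?c = "\<lambda>u v. block_matrix n A l u v - block_matrix n A m u v"
  let ?E = "\<lambda>m. energy {1..n} A (greedy_label {1..n} A m)"
  have eq: "block_kernel q n A l w - block_kernel q n A m w = step_fn ?I ?V ?c w" for w
    unfolding block_kernel_eq_step_fn[OF q(1) order.refl, of n A l w] block_kernel_eq_step_fn[OF q(1) assms, of n A w]
    unfolding step_fn_def by (simp add: sum_subtractf left_diff_distrib)
  have *: "integrable lborel (\<lambda>w. \<bar>step_fn ?I ?V ?c w\<bar>)"
    "(LINT w|lborel. \<bar>step_fn ?I ?V ?c w\<bar>) \<le> q\<^sup>2 * (\<Sum>u\<in>?V. \<Sum>v\<in>?V. \<bar>?c u v\<bar>)"
    using q by (auto intro!: integral_abs_step_fn_le emeasure_cell)
  show "integrable lborel (\<lambda>w. \<bar>block_kernel q n A l w - block_kernel q n A m w\<bar>)" unfolding eq by (rule *)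
  have E: "?E m \<le> ?E l" using scaled_energy_mono[OF assms] q by (simp add: scaled_energy_def)
  have "(\<Sum>u\<in>?V. \<Sum>v\<in>?V. \<bar>?c u v\<bar>) \<le> real (card ?V) * sqrt (?E l - ?E m)"
    unfolding block_avg_def using greedy_label_div[of ?V A m _ "l - m"] assms
    by (intro sum_abs_block_density_diff_le[where h = "\<lambda>x. x div 4 ^ (l - m)"]) auto
  then have "q\<^sup>2 * (\<Sum>u\<in>?V. \<Sum>v\<in>?V. \<bar>?c u v\<bar>) \<le> q\<^sup>2 * (real (card ?V) * sqrt (?E l - ?E m))"
    by (intro mult_left_mono) auto
  also have "\<dots> \<le> a * sqrt (q\<^sup>2 * (?E l - ?E m))" using E by (intro scaled_sqrt) simp
  finally show "(LINT w|lborel. \<bar>block_kernel q n A l w - block_kernel q n A m w\<bar>)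
      \<le> a * sqrt (scaled_energy q n A l - scaled_energy q n A m)"
    unfolding eq using *(2) by (simp add: scaled_energy_def right_diff_distrib)
qed

end

lemma (in rate1_process) norm_Psi_block_kernel_diff:
  assumes q: "0 < q" "q < 1" and nq: "real n * q \<le> a"
    and Asym: "\<And>u v. u \<in> {1..n} \<Longrightarrow> v \<in> {1..n} \<Longrightarrow> A u v = A v u"
    and A01: "\<And>u v. u \<in> {1..n} \<Longrightarrow> v \<in> {1..n} \<Longrightarrow> 0 \<le> A u v \<and> A u v \<le> 1"
    and z: "norm z \<le> 1"
  shows "norm (Psi a z (block_kernel q n A m) - edge_gf q z {1..n} (block_matrix n A m)) \<le> 4 * (a * q)"
proof -
  let ?I = "\<lambda>v. cell q (vertex_order n A m v)"
  have order: "vertex_order n A m v \<in> {1..n}" if "v \<in> {1..n}" for v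
    using vertex_order_bij[of n A m] that by (auto simp: bij_betw_def)
  have E: "block_kernel q n A m = step_fn ?I {1..n} (block_matrix n A m)"
    using block_kernel_eq_step_fn[OF q(1) order.refl, of n A m] by auto
  have N: "norm (Psi a z (step_fn ?I {1..n} (block_matrix n A m)) - edge_gf q z {1..n} (block_matrix n A m))
      \<le> 4 * real (card {1..n}) * q\<^sup>2"
  proof (rule norm_Psi_step_fn_diff)
    show "?I v \<subseteq> {0..a}" if "v \<in> {1..n}" for v
    proof -
      have "?I v \<subseteq> {0<..real n * q}" using order[OF that] by (intro cell_subset q) auto
      then show ?thesis using nq by force
    qed
    show "disjoint_family_on ?I {1..n}"
      unfolding disjoint_family_on_def
    proof (intro ballI impI)
      fix u v assume "u \<in> {1..n}" "v \<in> {1..n}" "u \<noteq> v"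
      then have "vertex_order n A m u \<noteq> vertex_order n A m v"
        using vertex_order_bij[of n A m] by (meson bij_betw_imp_inj_on inj_onD)
      then show "?I u \<inter> ?I v = {}"
        using disjoint_family_cell[OF q(1)] by (simp add: disjoint_family_on_def)
    qed
    show "measure lborel (?I v) = q" for v using q by (intro measure_cell) auto
  qed (use q z block_avg_sym[OF q nq Asym A01] block_avg_bounds[OF q nq Asym A01] in auto)
  have L: "4 * real (card {1..n}) * q\<^sup>2 \<le> 4 * (a * q)"
    using mult_right_mono[OF nq, of q] q by (simp add: power2_eq_square)
  show ?thesis unfolding E by (rule order.trans[OF N L])
qed

text \<open>Two limits are taken. At a fixed level m the graphs grow and their block kernels
  \<open>V m k\<close> converge to \<open>U m\<close>; then the levels grow and \<open>U m\<close>
  tends to \<open>W\<close> along a subsequence. The error between a graph and its averages of level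
  m is governed by an energy increment, which becomes small in the second limit.\<close>

proposition (in rate1_process) kernel_compactness:
  fixes n :: "nat \<Rightarrow> nat" and q :: "nat \<Rightarrow> real" and A :: "nat \<Rightarrow> nat \<Rightarrow> nat \<Rightarrow> real"
  assumes a: "0 < a"
    and q: "\<And>k. 0 < q k" "\<And>k. q k < 1" "q \<longlonglongrightarrow> 0" and nq: "\<And>k. real (n k) * q k \<le> a"
    and Asym: "\<And>k u v. u \<in> {1..n k} \<Longrightarrow> v \<in> {1..n k} \<Longrightarrow> A k u v = A k v u"
    and A01: "\<And>k u v. u \<in> {1..n k} \<Longrightarrow> v \<in> {1..n k} \<Longrightarrow> 0 \<le> A k u v \<and> A k u v \<le> 1"
  obtains W r where "strict_mono r" "kernel_on a W"
    "\<forall>z. norm z \<le> 1 \<longrightarrow> (\<lambda>k. edge_gf (q (r k)) z {1..n (r k)} (A (r k))) \<longlonglongrightarrow> Psi a z W"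
proof -
  let ?Q = "{0..a} \<times> {0..a}"
  \<comment> \<open>Densities, interval endpoints and energies are packed under one countable index,
    so that a single diagonal argument treats them all.\<close>
  define F where "F = (\<lambda>(j::nat, m, c, d) k. if j = 0 then block_avg (n k) (A k) m c d
     else if j = 1 then block_bound (q k) (n k) (A k) m c else scaled_energy (q k) (n k) (A k) m)"
  have bnd: "bounded (range (F i))" for i
  proof -
    obtain j m c d where i: "i = (j, m, c, d)" by (cases i) auto
    have "\<bar>F i k\<bar> \<le> 1 + a + a\<^sup>2" for k
    proof -
      have "0 \<le> block_avg (n k) (A k) m c d" "block_avg (n k) (A k) m c d \<le> 1"
        using block_avg_bounds[OF q(1,2) nq Asym A01] by auto
      moreover have "0 \<le> block_bound (q k) (n k) (A k) m c" "block_bound (q k) (n k) (A k) m c \<le> a"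
        using block_bound_nonneg[of "q k"] block_bound_le[of "q k" "n k" "A k" m c] nq[of k] q(1)[of k] by auto
      moreover have "0 \<le> scaled_energy (q k) (n k) (A k) m" "scaled_energy (q k) (n k) (A k) m \<le> a\<^sup>2"
        using scaled_energy_bounds[OF q(1,2) nq Asym A01] by auto
      moreover have "0 \<le> a\<^sup>2" by simp
      ultimately show ?thesis using a unfolding F_def i prod.case by (auto simp: abs_le_iff)
    qed
    then show ?thesis by (auto simp: bounded_iff)
  qed
  obtain r where r: "strict_mono r" and conv: "\<And>i. convergent (\<lambda>k. F i (r k))"
    using diagonal_subsequence[of F, OF bnd] by blast
  define q' n' A' where "q' = q \<circ> r" and "n' = n \<circ> r" and "A' = A \<circ> r"
  note defs = q'_def n'_def A'_def o_def
  have q': "0 < q' k" "q' k < 1" for k using q by (auto simp: defs)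
  have q'0: "q' \<longlonglongrightarrow> 0" unfolding q'_def by (rule LIMSEQ_subseq_LIMSEQ[OF q(3) r])
  have nq': "real (n' k) * q' k \<le> a" for k using nq by (simp add: defs)
  have sym': "A' k u v = A' k v u" if "u \<in> {1..n' k}" "v \<in> {1..n' k}" for k u v using that Asym by (simp add: defs)
  have A'01: "0 \<le> A' k u v \<and> A' k u v \<le> 1" if "u \<in> {1..n' k}" "v \<in> {1..n' k}" for k u v using that A01 by (simp add: defs)
  note facts = q' nq' sym' A'01
  define D where "D m c d = lim (\<lambda>k. block_avg (n' k) (A' k) m c d)" for m c d
  define S where "S m c = lim (\<lambda>k. block_bound (q' k) (n' k) (A' k) m c)" for m c
  define e where "e m = lim (\<lambda>k. scaled_energy (q' k) (n' k) (A' k) m)" for m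
  have D: "(\<lambda>k. block_avg (n' k) (A' k) m c d) \<longlonglongrightarrow> D m c d" for m c d
    using conv[of "(0, m, c, d)"] by (simp add: F_def D_def defs convergent_LIMSEQ_iff)
  have S: "(\<lambda>k. block_bound (q' k) (n' k) (A' k) m c) \<longlonglongrightarrow> S m c" for m c
    using conv[of "(1, m, c, 0)"] by (simp add: F_def S_def defs convergent_LIMSEQ_iff)
  have e: "(\<lambda>k. scaled_energy (q' k) (n' k) (A' k) m) \<longlonglongrightarrow> e m" for m
    using conv[of "(2, m, 0, 0)"] by (simp add: F_def e_def defs convergent_LIMSEQ_iff)
  have D01: "0 \<le> D m c d \<and> D m c d \<le> 1" for m c d
    using LIMSEQ_le_const[OF D, of 0] LIMSEQ_le_const2[OF D, of m c d 1] block_avg_bounds[OF facts] by auto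
  have Dsym: "D m c d = D m d c" for m c d
    unfolding D_def using block_avg_sym[OF facts] by simp
  have S_mono: "S m c \<le> S m d" if "c \<le> d" for m c d
  proof (rule LIMSEQ_le[OF S S], intro exI[of _ 0] allI impI)
    show "block_bound (q' k) (n' k) (A' k) m c \<le> block_bound (q' k) (n' k) (A' k) m d" for k
      using block_bound_mono[OF _ that] q'(1)[of k] by (simp add: less_imp_le)
  qed
  define U where "U m = step_fn (\<lambda>c. {S m c<..S m (Suc c)}) {..<4 ^ m} (D m)" for m
  define V where "V m k = block_kernel (q' k) (n' k) (A' k) m" for m k
  have disj: "disjoint_family_on (\<lambda>c. {S m c<..S m (Suc c)}) {..<4 ^ m}" for m
    unfolding disjoint_family_on_def
  proof (intro ballI impI)
    fix c d :: nat assume "c \<noteq> d"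
    then consider "Suc c \<le> d" | "Suc d \<le> c" by linarith
    then show "{S m c<..S m (Suc c)} \<inter> {S m d<..S m (Suc d)} = {}"
      using S_mono[of "Suc c" d m] S_mono[of "Suc d" c m] by cases auto
  qed
  have U01: "0 \<le> U m w \<and> U m w \<le> 1" for m w
    unfolding U_def using D01 by (intro step_fn_bounds disj) auto
  have Um: "U m \<in> borel_measurable borel" for m unfolding U_def by (intro measurable_step_fn) auto
  have Usym: "U m (x, y) = U m (y, x)" for m x y
    unfolding U_def using Dsym by (intro step_fn_sym) auto
  have V01: "0 \<le> V m k w \<and> V m k w \<le> 1" for m k w
    unfolding V_def by (rule block_kernel_bounds[OF facts])
  have Vm: "V m k \<in> borel_measurable borel" for m k
    unfolding V_def by (rule block_kernel_measurable[OF facts])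
  define I where "I f = (LINT w|lborel. indicator ?Q w * \<bar>f w\<bar>)" for f :: "real \<times> real \<Rightarrow> real"
  have int_Q: "integrable lborel (\<lambda>w. indicator ?Q w * \<bar>f w - g w\<bar>)"
    if "f \<in> borel_measurable borel" "g \<in> borel_measurable borel"
      "\<And>w. 0 \<le> f w \<and> f w \<le> 1" "\<And>w. 0 \<le> g w \<and> g w \<le> 1" for f g :: "real \<times> real \<Rightarrow> real"
  proof (rule Bochner_Integration.integrable_bound[OF integrable_indicator_square[of a]])
    show "(\<lambda>w. indicator ?Q w * \<bar>f w - g w\<bar>) \<in> borel_measurable lborel"
      using that(1,2) indicator_square_measurable[of a] by simp
    have "\<bar>f w - g w\<bar> \<le> 1" for w using that(3)[of w] that(4)[of w] by linarith
    then show "AE w in lborel. norm (indicator ?Q w * \<bar>f w - g w\<bar>) \<le> norm (indicator ?Q w :: real)"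
      by (intro AE_I2) (simp add: indicator_def)
  qed
  have VU: "(\<lambda>k. I (\<lambda>w. V m k w - U m w)) \<longlonglongrightarrow> 0" for m
  proof -
    have "(\<lambda>k. I (\<lambda>w. V m k w - U m w)) \<longlonglongrightarrow> (LINT w|(lborel :: (real \<times> real) measure). 0)"
      unfolding I_def
    proof (rule integral_dominated_convergence[where w = "indicator ?Q"])
      show "integrable lborel (indicator ?Q :: _ \<Rightarrow> real)" by (rule integrable_indicator_square)
      show "(\<lambda>w. indicator ?Q w * \<bar>V m k w - U m w\<bar>) \<in> borel_measurable lborel" for k
        using int_Q[OF Vm Um V01 U01] by auto
      have "\<bar>V m k w - U m w\<bar> \<le> 1" for k w using V01[of m k w] U01[of m w] by linarith
      then show "AE w in lborel. norm (indicator ?Q w * \<bar>V m k w - U m w\<bar>) \<le> indicator ?Q w" for k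
        by (intro AE_I2) (simp add: indicator_def)
      have "AE w in lborel. fst w \<notin> S m ` {..4 ^ m} \<and> snd w \<notin> S m ` {..4 ^ m}"
        by (rule AE_lborel_coordinates_notin) simp
      then show "AE w in lborel. (\<lambda>k. indicator ?Q w * \<bar>V m k w - U m w\<bar>) \<longlonglongrightarrow> 0"
      proof eventually_elim
        case (elim w)
        then have "(\<lambda>k. V m k w) \<longlonglongrightarrow> U m w"
          unfolding V_def U_def block_kernel_def by (intro step_fn_tendsto S D) auto
        then have "(\<lambda>k. indicator ?Q w * \<bar>V m k w - U m w\<bar>) \<longlonglongrightarrow> indicator ?Q w * \<bar>U m w - U m w\<bar>"
          by (intro tendsto_intros)
        then show ?case by simp
      qed
    qed simp
    then show ?thesis by simp
  qed
  have e_mono: "e m \<le> e l" if "m \<le> l" for m l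
    using scaled_energy_mono[OF facts that] by (intro LIMSEQ_le[OF e e]) auto
  \<comment> \<open>The distance of two limits is inherited from the block kernels of one and the
    same graph, where the energy difference bounds it.\<close>
  have UU: "I (\<lambda>w. U l w - U m w) \<le> a * sqrt (e l - e m)" if ml: "m \<le> l" for m l
  proof -
    have le: "I (\<lambda>w. U l w - U m w) \<le> I (\<lambda>w. V l k w - U l w) + a * sqrt (scaled_energy (q' k) (n' k) (A' k) l - scaled_energy (q' k) (n' k) (A' k) m)
        + I (\<lambda>w. V m k w - U m w)" for k
    proof -
      have VV: "I (\<lambda>w. V l k w - V m k w) \<le> a * sqrt (scaled_energy (q' k) (n' k) (A' k) l - scaled_energy (q' k) (n' k) (A' k) m)"
      proof -
        have "I (\<lambda>w. V l k w - V m k w) \<le> (LINT w|lborel. \<bar>V l k w - V m k w\<bar>)"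
          unfolding I_def
        proof (rule integral_mono)
          show "integrable lborel (\<lambda>w. indicator ?Q w * \<bar>V l k w - V m k w\<bar>)" by (rule int_Q[OF Vm Vm V01 V01])
          show "integrable lborel (\<lambda>w. \<bar>V l k w - V m k w\<bar>)"
            unfolding V_def by (rule block_kernel_L1_diff(1)[OF facts ml])
        qed (simp add: indicator_def)
        also have "\<dots> \<le> a * sqrt (scaled_energy (q' k) (n' k) (A' k) l - scaled_energy (q' k) (n' k) (A' k) m)"
          unfolding V_def by (rule block_kernel_L1_diff(2)[OF facts ml])
        finally show ?thesis .
      qed
      have i: "integrable lborel (\<lambda>w. indicator ?Q w * \<bar>V l k w - U l w\<bar>)"
        "integrable lborel (\<lambda>w. indicator ?Q w * \<bar>V l k w - V m k w\<bar>)"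
        "integrable lborel (\<lambda>w. indicator ?Q w * \<bar>V m k w - U m w\<bar>)"
        "integrable lborel (\<lambda>w. indicator ?Q w * \<bar>U l w - U m w\<bar>)"
        using int_Q Vm Um V01 U01 by auto
      have "I (\<lambda>w. U l w - U m w) \<le> (LINT w|lborel. indicator ?Q w * \<bar>V l k w - U l w\<bar>
          + indicator ?Q w * \<bar>V l k w - V m k w\<bar> + indicator ?Q w * \<bar>V m k w - U m w\<bar>)"
        unfolding I_def
      proof (rule integral_mono[OF i(4)])
        show "integrable lborel (\<lambda>w. indicator ?Q w * \<bar>V l k w - U l w\<bar>
          + indicator ?Q w * \<bar>V l k w - V m k w\<bar> + indicator ?Q w * \<bar>V m k w - U m w\<bar>)" using i by simp
      qed (auto simp: indicator_def)
      also have "\<dots> = I (\<lambda>w. V l k w - U l w) + I (\<lambda>w. V l k w - V m k w) + I (\<lambda>w. V m k w - U m w)"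
        unfolding I_def using i by simp
      finally show ?thesis using VV by linarith
    qed
    have "(\<lambda>k. I (\<lambda>w. V l k w - U l w) + a * sqrt (scaled_energy (q' k) (n' k) (A' k) l - scaled_energy (q' k) (n' k) (A' k) m)
        + I (\<lambda>w. V m k w - U m w)) \<longlonglongrightarrow> 0 + a * sqrt (e l - e m) + 0"
      by (intro tendsto_intros VU e)
    then show ?thesis using le by (intro LIMSEQ_le_const) auto
  qed
  have e_le: "e m \<le> a\<^sup>2" for m
    using scaled_energy_bounds(2)[OF facts] by (intro LIMSEQ_le_const2[OF e]) auto
  have e_ge: "0 \<le> e m" for m
    using scaled_energy_bounds(1)[OF facts] by (intro LIMSEQ_le_const[OF e]) auto
  \<comment> \<open>The limiting energies increase and stay below a^2. Their convergence is what
    makes \<open>U\<close> a Cauchy sequence.\<close>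
  have "convergent e"
    using e_mono e_le e_ge by (intro Bseq_mono_convergent[of e] BseqI'[of e "a\<^sup>2"]) auto
  then obtain e' where e': "e \<longlonglongrightarrow> e'" by (auto simp: convergent_def)
  have cauchy: "\<exists>N. \<forall>i\<ge>N. \<forall>j\<ge>N. I (\<lambda>w. U i w - U j w) < \<epsilon>" if "0 < \<epsilon>" for \<epsilon>
  proof -
    \<comment> \<open>The square undoes the root in \<open>UU\<close>, and the division by
      \<open>a\<close> its factor.\<close>
    have "0 < (\<epsilon> / a)\<^sup>2" using that a by simp
    then obtain N where N: "\<And>i j. N \<le> i \<Longrightarrow> N \<le> j \<Longrightarrow> \<bar>e i - e j\<bar> < (\<epsilon> / a)\<^sup>2"
      using metric_CauchyD[OF LIMSEQ_imp_Cauchy[OF e']] by (metis dist_real_def)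
    have lt: "I (\<lambda>w. U i w - U j w) < \<epsilon>" if "N \<le> j" "j \<le> i" for i j
    proof -
      have "e i - e j < (\<epsilon> / a)\<^sup>2" using N[of i j] that by linarith
      then have "sqrt (e i - e j) < \<epsilon> / a"
        using \<open>0 < \<epsilon>\<close> a by (intro real_less_lsqrt) (auto simp: e_mono[OF that(2)])
      then have "a * sqrt (e i - e j) < \<epsilon>" using a by (simp add: field_simps)
      then show ?thesis using UU[OF that(2)] by linarith
    qed
    have sw: "I (\<lambda>w. U i w - U j w) = I (\<lambda>w. U j w - U i w)" for i j
      unfolding I_def by (simp add: abs_minus_commute)
    have "I (\<lambda>w. U i w - U j w) < \<epsilon>" if "N \<le> i" "N \<le> j" for i j
      using lt[of j i] lt[of i j] sw[of i j] that by (cases "j \<le> i") auto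
    then show ?thesis by blast
  qed
  obtain W s where s: "strict_mono s" and W: "kernel_on a W" and UW: "(\<lambda>i. I (\<lambda>w. U (s i) w - W w)) \<longlonglongrightarrow> 0"
    unfolding I_def using L1_limit_of_kernels[OF Um U01 Usym cauchy[unfolded I_def]] by blast
  have lim: "(\<lambda>k. edge_gf (q' k) z {1..n' k} (A' k)) \<longlonglongrightarrow> Psi a z W" if z: "norm z \<le> 1" for z
  proof -
    \<comment> \<open>\<open>b m k\<close> collects the four errors of level m for graph k, and
      \<beta> m is its limit in k. The latter is shown to vanish along the levels \<open>s\<close>,
      which is enough for \<open>tendsto_0_of_bounds\<close>.\<close>
    define b where "b m k = (1 / (1 - q' k))\<^sup>2 * (4 * (a * sqrt (scaled_energy (q' k) (n' k) (A' k) (Suc m) - scaled_energy (q' k) (n' k) (A' k) m)) + a * q' k)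
        + 4 * (a * q' k) + 2 * I (\<lambda>w. V m k w - U m w) + 2 * I (\<lambda>w. U m w - W w)" for m k
    define \<beta> where "\<beta> m = (1 / (1 - 0))\<^sup>2 * (4 * (a * sqrt (e (Suc m) - e m)) + a * 0) + 4 * (a * 0) + 2 * 0 + 2 * I (\<lambda>w. U m w - W w)" for m
    have bound: "norm (edge_gf (q' k) z {1..n' k} (A' k) - Psi a z W) \<le> b m k" for m k
    proof -
      let ?G = "edge_gf (q' k) z {1..n' k}" and ?P = "Psi a z"
      have "norm (?G (A' k) - ?P W) \<le> norm (?G (A' k) - ?G (block_matrix (n' k) (A' k) m))
          + norm (?P (V m k) - ?G (block_matrix (n' k) (A' k) m)) + norm (?P (V m k) - ?P (U m)) + norm (?P (U m) - ?P W)"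
      proof -
        have tri: "norm (x1 - x5) \<le> norm (x1 - x2) + norm (x3 - x2) + norm (x3 - x4) + norm (x4 - x5)" for x1 x2 x3 x4 x5 :: complex
          using norm_triangle_ineq[of "x1 - x2" "x2 - x5"] norm_triangle_ineq[of "x2 - x3" "x3 - x5"]
            norm_triangle_ineq[of "x3 - x4" "x4 - x5"] norm_minus_commute[of x2 x3] by simp
        show ?thesis by (rule tri)
      qed
      moreover have "norm (?G (A' k) - ?G (block_matrix (n' k) (A' k) m))
          \<le> (1 / (1 - q' k))\<^sup>2 * (4 * (a * sqrt (scaled_energy (q' k) (n' k) (A' k) (Suc m) - scaled_energy (q' k) (n' k) (A' k) m)) + a * q' k)"
        by (rule norm_edge_gf_block_diff[OF facts z])
      moreover have "norm (?P (V m k) - ?G (block_matrix (n' k) (A' k) m)) \<le> 4 * (a * q' k)"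
        unfolding V_def by (rule norm_Psi_block_kernel_diff[OF facts z])
      moreover have "norm (?P (V m k) - ?P (U m)) \<le> 2 * I (\<lambda>w. V m k w - U m w)"
        unfolding I_def by (rule norm_Psi_diff_le[OF Vm V01 Um U01 z a])
      moreover have "norm (?P (U m) - ?P W) \<le> 2 * I (\<lambda>w. U m w - W w)"
        unfolding I_def by (rule norm_Psi_diff_le[OF Um U01 kernel_onD(1,2)[OF W] z a])
      ultimately show ?thesis unfolding b_def by linarith
    qed
    have b_lim: "b m \<longlonglongrightarrow> \<beta> m" for m
      unfolding b_def \<beta>_def by (intro tendsto_intros VU e q'0) auto
    have "(\<lambda>m. e (Suc m) - e m) \<longlonglongrightarrow> e' - e'"
      by (intro tendsto_diff LIMSEQ_Suc e')
    then have "(\<lambda>i. e (Suc (s i)) - e (s i)) \<longlonglongrightarrow> e' - e'"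
      using LIMSEQ_subseq_LIMSEQ[OF _ s] by (fastforce simp: o_def)
    then have "(\<lambda>i. sqrt (e (Suc (s i)) - e (s i))) \<longlonglongrightarrow> sqrt (e' - e')"
      by (rule tendsto_real_sqrt)
    from tendsto_add[OF tendsto_mult_left[OF this, of "4 * a"] tendsto_mult_left[OF UW, of 2]]
    have "(\<lambda>i. 4 * a * sqrt (e (Suc (s i)) - e (s i)) + 2 * I (\<lambda>w. U (s i) w - W w)) \<longlonglongrightarrow> 0" by simp
    moreover have "\<beta> m = 4 * a * sqrt (e (Suc m) - e m) + 2 * I (\<lambda>w. U m w - W w)" for m
      by (simp add: \<beta>_def)
    ultimately have \<beta>_lim: "(\<lambda>i. \<beta> (s i)) \<longlonglongrightarrow> 0" by simp
    have "(\<lambda>k. norm (edge_gf (q' k) z {1..n' k} (A' k) - Psi a z W)) \<longlonglongrightarrow> 0"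
      by (rule tendsto_0_of_bounds[OF norm_ge_zero always_eventually[OF allI[OF bound]] b_lim \<beta>_lim])
    then show ?thesis by (simp add: tendsto_norm_zero_iff LIM_zero_iff)
  qed
  show ?thesis
    using lim by (intro that[of r W] r W) (auto simp: defs)
qed

section \<open>Identification of the limit law\<close>

text \<open>Almost surely the stochastic integral sums phi over pairs of points in both orders. The
  factor 1/2 leaves each unordered pair once, and the exponential of that sum is the product in
  \<open>Psi\<close>.\<close>

lemma (in rate1_process) Psi_eq_stoch_integral:
  assumes a: "0 < a" and W [measurable]: "W \<in> borel_measurable borel" and W01: "\<And>w. 0 \<le> W w \<and> W w \<le> 1"
    and Wsym: "\<And>x y. W (x, y) = W (y, x)" and t: "0 \<le> t"
  shows "Psi a (of_real (exp (- t))) W = of_real (LINT \<omega>|M. exp (1 / 2 *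
      stoch_integral M \<Xi> (\<lambda>w. indicator ({0..a} \<times> {0..a}) w * phi W t w) \<omega>))"
proof -
  let ?Q = "{0..a} \<times> {0..a}"
  define f where "f w = indicator ?Q w * phi W t w" for w
  have Q: "?Q \<in> sets borel" by (rule indicator_square_measurable)
  \<comment> \<open>The argument of the logarithm stays above exp (- \<open>t\<close>) > 0, so phi
    is bounded, as the representation of the integral by a sum requires.\<close>
  have lower: "exp (- t) \<le> 1 - W w + W w * exp (- t)" for w
  proof -
    have "(1 - W w) * exp (- t) \<le> (1 - W w) * 1" using W01[of w] t by (intro mult_left_mono) auto
    then show ?thesis by (simp add: algebra_simps)
  qed
  have upper: "1 - W w + W w * exp (- t) \<le> 1" for w
    using mult_left_mono[of "exp (- t)" 1 "W w"] W01[of w] t by simp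
  have pos: "0 < 1 - W w + W w * exp (- t)" for w
    using lower[of w] exp_gt_zero[of "- t"] by linarith
  have "- t \<le> phi W t w \<and> phi W t w \<le> 0" for w
  proof
    have "ln (exp (- t)) \<le> phi W t w" unfolding phi_def using lower[of w] pos[of w] by (subst ln_le_cancel_iff) auto
    then show "- t \<le> phi W t w" by simp
    show "phi W t w \<le> 0" unfolding phi_def using upper[of w] pos[of w] by simp
  qed
  then have fB: "\<bar>f w\<bar> \<le> t" for w using t by (simp add: f_def indicator_def abs_le_iff) (metis minus_le_iff order.trans)
  have fm: "f \<in> borel_measurable borel"
    unfolding f_def[abs_def] phi_def using Q by measurable
  have f0: "f w = 0" if "w \<notin> ?Q" for w using that by (simp add: f_def)
  have stoch1: "stoch_integral M \<Xi> f \<in> borel_measurable M"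
    by (rule stoch_integral_eq_off_diag(1)[OF a fm fB f0])
  have stoch2: "AE \<omega> in M. stoch_integral M \<Xi> f \<omega> = (\<Sum>w\<in>off_diag a \<omega>. f w)"
    by (rule stoch_integral_eq_off_diag(2)[OF a fm fB f0])
  have fint: "integrable lborel (\<lambda>w. indicator ?Q w * f w)"
  proof (rule Bochner_Integration.integrable_bound)
    show "integrable lborel (\<lambda>w. t * indicator ?Q w :: real)" using integrable_indicator_square[of a] by simp
    show "(\<lambda>w. indicator ?Q w * f w) \<in> borel_measurable lborel" using fm Q by simp
    show "AE w in lborel. norm (indicator ?Q w * f w) \<le> norm (t * indicator ?Q w)"
      using fB t by (intro AE_I2) (simp add: indicator_def)
  qed
  have pw: "pair_prod (\<lambda>x y. 1 - (1 - of_real (exp (- t))) * of_real (W (x, y))) (\<Xi> \<omega> \<inter> {0..a})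
      = complex_of_real (exp (1 / 2 * (\<Sum>w\<in>off_diag a \<omega>. f w)))" if \<omega>: "\<omega> \<in> space M" for \<omega>
  proof -
    let ?X = "\<Xi> \<omega> \<inter> {0..a}"
    have fin: "finite ?X" by (rule finite_points[OF \<omega>])
    define g where "g w = (if fst w = snd w then 0 else f w)" for w
    have "(\<Sum>w\<in>off_diag a \<omega>. f w) = (\<Sum>w\<in>?X \<times> ?X. g w)"
      using fin by (intro sum.mono_neutral_cong_left) (auto simp: off_diag_def g_def)
    also have "\<dots> = (\<Sum>w\<in>ordered_pairs ?X. f w) + (\<Sum>w\<in>ordered_pairs ?X. f (prod.swap w))"
      unfolding sum_square_ordered_pairs[OF fin] by (auto simp: g_def ordered_pairs_def intro!: arg_cong2[of _ _ _ _ "(+)"] sum.cong)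
    also have "(\<Sum>w\<in>ordered_pairs ?X. f (prod.swap w)) = (\<Sum>w\<in>ordered_pairs ?X. f w)"
      using Wsym by (intro sum.cong refl) (auto simp: f_def phi_def indicator_def)
    finally have "1 / 2 * (\<Sum>w\<in>off_diag a \<omega>. f w) = (\<Sum>w\<in>ordered_pairs ?X. f w)" by simp
    also have "exp \<dots> = (\<Prod>w\<in>ordered_pairs ?X. 1 - W w + W w * exp (- t))"
      unfolding exp_sum[OF finite_ordered_pairs[OF fin]]
      using pos by (intro prod.cong refl) (auto simp: f_def phi_def ordered_pairs_def)
    finally show ?thesis
      unfolding pair_prod_def by (simp add: case_prod_beta algebra_simps)
  qed
  have "Psi a (of_real (exp (- t))) W = (LINT \<omega>|M. complex_of_real (exp (1 / 2 * (\<Sum>w\<in>off_diag a \<omega>. f w))))"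
    unfolding Psi_def by (intro Bochner_Integration.integral_cong refl pw)
  also have "\<dots> = of_real (LINT \<omega>|M. exp (1 / 2 * (\<Sum>w\<in>off_diag a \<omega>. f w)))"
    by (rule integral_complex_of_real)
  also have "(LINT \<omega>|M. exp (1 / 2 * (\<Sum>w\<in>off_diag a \<omega>. f w))) = (LINT \<omega>|M. exp (1 / 2 * stoch_integral M \<Xi> f \<omega>))"
  proof (rule integral_cong_AE)
    have [measurable]: "(\<lambda>\<omega>. \<Sum>w\<in>off_diag a \<omega>. f w) \<in> borel_measurable M"
      using off_diag_integrable(1)[OF fm fint] by auto
    show "(\<lambda>\<omega>. exp (1 / 2 * (\<Sum>w\<in>off_diag a \<omega>. f w))) \<in> borel_measurable M" by measurable
    note [measurable] = stoch1
    show "(\<lambda>\<omega>. exp (1 / 2 * stoch_integral M \<Xi> f \<omega>)) \<in> borel_measurable M" by measurable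
    show "AE \<omega> in M. exp (1 / 2 * (\<Sum>w\<in>off_diag a \<omega>. f w)) = exp (1 / 2 * stoch_integral M \<Xi> f \<omega>)"
      using stoch2 by eventually_elim simp
  qed
  finally show ?thesis unfolding f_def[abs_def] .
qed

lemma Q1_law_cong:
  assumes "\<And>w. w \<in> {0..a} \<times> {0..a} \<Longrightarrow> W w = W' w"
  shows "Q1_law M \<Xi> W a \<mu> = Q1_law M \<Xi> W' a \<mu>"
proof -
  have "(\<lambda>w. indicator ({0..a} \<times> {0..a}) w * phi W t w) = (\<lambda>w. indicator ({0..a} \<times> {0..a}) w * phi W' t w)" for t
    using assms by (auto simp: fun_eq_iff indicator_def phi_def)
  then show ?thesis unfolding Q1_law_def by simp
qed

lemma (in rate1_process) Q1_lawI:
  assumes a: "0 < a" and W: "W \<in> borel_measurable borel" "\<And>w. 0 \<le> W w \<and> W w \<le> 1" "\<And>x y. W (x, y) = W (y, x)"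
    and \<mu>: "real_distribution \<mu>" and nn: "AE x in \<mu>. 0 \<le> x"
    and laplace: "\<And>t. 0 \<le> t \<Longrightarrow> of_real (LINT x|\<mu>. exp (- t * x)) = Psi a (of_real (exp (- t))) W"
  shows "Q1_law M \<Xi> W a \<mu>"
proof -
  interpret \<mu>: real_distribution \<mu> by fact
  show ?thesis
    unfolding Q1_law_def
  proof (intro conjI allI impI \<mu>)
    fix t :: real assume t: "0 \<le> t"
    show "integrable \<mu> (\<lambda>q. exp (- t * q))"
    proof (rule \<mu>.integrable_const_bound[where B = 1])
      show "AE x in \<mu>. norm (exp (- t * x)) \<le> 1" using nn by eventually_elim (simp add: t)
    qed measurable
    show "(LINT q|\<mu>. exp (- t * q)) = (LINT \<omega>|M. exp (1 / 2 *
       stoch_integral M \<Xi> (\<lambda>z. indicator ({0..a} \<times> {0..a}) z * phi W t z) \<omega>))"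
      using laplace[OF t] unfolding Psi_eq_stoch_integral[OF a W t] by (simp only: of_real_eq_iff)
  qed
qed

text \<open>For positive \<open>t\<close> the function exp (- \<open>t\<close> x) is unbounded on
  the negative half-line, so weak convergence can be applied to it only once the limit is known to
  live on the nonnegative half-line. That is found by testing with a bounded continuous function
  whose zeros are exactly the nonnegative numbers.\<close>

lemma weak_conv_m_nonneg:
  assumes \<mu>: "\<And>k. real_distribution (\<mu> k)" and \<nu>: "real_distribution \<nu>" and conv: "weak_conv_m \<mu> \<nu>"
    and nn: "\<And>k. AE x in \<mu> k. 0 \<le> x"
  shows "AE x in \<nu>. 0 \<le> x"
    and "0 \<le> t \<Longrightarrow> (\<lambda>k. LINT x|\<mu> k. exp (- t * x)) \<longlonglongrightarrow> (LINT x|\<nu>. exp (- t * x))"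
proof -
  interpret \<mu>: real_distribution "\<mu> k" for k by (rule \<mu>)
  interpret \<nu>: real_distribution \<nu> by (rule \<nu>)
  define g where "g x = min 1 (max 0 (- x))" for x :: real
  have g: "continuous_on UNIV g" unfolding g_def by (intro continuous_intros)
  have g_m [measurable]: "g \<in> borel_measurable borel" using g by (rule borel_measurable_continuous_onI)
  have "(\<lambda>k. LINT x|\<mu> k. g x) \<longlonglongrightarrow> (LINT x|\<nu>. g x)"
    using g by (intro weak_conv_imp_integral_bdd_continuous_conv[OF \<mu> \<nu> conv, where B = 1])
      (auto simp: continuous_on_eq_continuous_at g_def)
  moreover have "(LINT x|\<mu> k. g x) = 0" for k
  proof -
    have "(LINT x|\<mu> k. g x) = (LINT x|\<mu> k. 0)"
    proof (rule integral_cong_AE)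
      show "AE x in \<mu> k. g x = 0" using nn[of k] by eventually_elim (simp add: g_def)
    qed measurable
    then show ?thesis by simp
  qed
  ultimately have g0: "(LINT x|\<nu>. g x) = 0" by (simp add: LIMSEQ_const_iff)
  have "integrable \<nu> g" by (rule \<nu>.integrable_const_bound[where B = 1]) (auto simp: g_def)
  then have "AE x in \<nu>. g x = 0"
    using g0 by (subst (asm) integral_nonneg_eq_0_iff_AE) (auto simp: g_def)
  then show nn\<nu>: "AE x in \<nu>. 0 \<le> x" by eventually_elim (auto simp: g_def min_def max_def split: if_splits)
  assume t: "0 \<le> t"
  \<comment> \<open>Frozen on the negative half-line, the exponential is bounded by 1 and unchanged
    almost everywhere.\<close>
  define h where "h x = exp (- t * max 0 x)" for x :: real
  have h: "continuous_on UNIV h" unfolding h_def by (intro continuous_intros)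
  have h_m [measurable]: "h \<in> borel_measurable borel" using h by (rule borel_measurable_continuous_onI)
  have eq: "(LINT x|N. h x) = (LINT x|N. exp (- t * x))" if N: "sets N = sets borel" "AE x in N. 0 \<le> x" for N
  proof (rule integral_cong_AE)
    show "AE x in N. h x = exp (- t * x)" using N(2) by eventually_elim (simp add: h_def)
    show "h \<in> borel_measurable N" "(\<lambda>x. exp (- t * x)) \<in> borel_measurable N"
      by (simp_all add: measurable_cong_sets[OF N(1) refl])
  qed
  have "(\<lambda>k. LINT x|\<mu> k. h x) \<longlonglongrightarrow> (LINT x|\<nu>. h x)"
    using h t by (intro weak_conv_imp_integral_bdd_continuous_conv[OF \<mu> \<nu> conv, where B = 1])
      (auto simp: continuous_on_eq_continuous_at h_def)
  then show "(\<lambda>k. LINT x|\<mu> k. exp (- t * x)) \<longlonglongrightarrow> (LINT x|\<nu>. exp (- t * x))"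
    using eq[OF \<mu>.events_eq_borel nn] eq[OF \<nu>.events_eq_borel nn\<nu>] by simp
qed

text \<open>Markov's inequality bounds the upper tail, and nonnegativity removes the lower
  one.\<close>

lemma tight_of_bounded_mean:
  assumes \<mu>: "\<And>k. real_distribution (\<mu> k)" and nn: "\<And>k. AE x in \<mu> k. 0 \<le> x"
    and int: "\<And>k. integrable (\<mu> k) (\<lambda>x. x)" and mean: "\<And>k. (LINT x|\<mu> k. x) \<le> C"
  shows "tight \<mu>"
  unfolding tight_def
proof (intro conjI allI impI \<mu>)
  fix \<epsilon> :: real assume \<epsilon>: "0 < \<epsilon>"
  have C: "0 \<le> C" using integral_nonneg_AE[OF nn[of 0]] mean[of 0] by linarith
  \<comment> \<open>With \<open>C\<close> + 1 in place of \<open>C\<close>, \<open>b\<close> is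
    positive even for \<open>C\<close> = 0 and \<open>C\<close> / \<open>b\<close> < \<epsilon>
    holds strictly.\<close>
  define b where "b = (C + 1) / \<epsilon>"
  have b: "0 < b" "C / b < \<epsilon>" using C \<epsilon> by (auto simp: b_def field_simps)
  have "1 - \<epsilon> < measure (\<mu> k) {-1<..b}" for k
  proof -
    interpret real_distribution "\<mu> k" by (rule \<mu>)
    have "prob {x\<in>space (\<mu> k). b \<le> x} \<le> (LINT x|\<mu> k. x) / b"
      using int[of k] nn[of k] b by (intro integral_Markov_inequality_measure[where A = "{}"]) auto
    also have "\<dots> \<le> C / b" using mean[of k] b by (intro divide_right_mono) auto
    finally have 1: "prob {b..} < \<epsilon>" using b by (simp add: atLeast_def)
    have "prob (space (\<mu> k) - {b..}) \<le> prob {-1<..b}"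
    proof (rule finite_measure_mono_AE)
      show "AE x in \<mu> k. x \<in> space (\<mu> k) - {b..} \<longrightarrow> x \<in> {-1<..b}" using nn[of k] by eventually_elim auto
    qed simp
    moreover have "prob (space (\<mu> k) - {b..}) = 1 - prob {b..}" by (rule prob_compl) simp
    ultimately show ?thesis using 1 by linarith
  qed
  then show "\<exists>a b. a < b \<and> (\<forall>k. 1 - \<epsilon> < measure (\<mu> k) {a<..b})"
    using b by (intro exI[of _ "-1"] exI[of _ b]) auto
qed

lemma weak_conv_m_offset:
  "weak_conv_m (\<lambda>k. \<mu> (k + N)) \<nu> \<longleftrightarrow> weak_conv_m \<mu> \<nu>"
proof -
  have "(\<lambda>k. cdf (\<mu> (k + N)) x) \<longlonglongrightarrow> l \<longleftrightarrow> (\<lambda>k. cdf (\<mu> k) x) \<longlonglongrightarrow> l" for x l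
    using LIMSEQ_ignore_initial_segment[of "\<lambda>k. cdf (\<mu> k) x" l N] LIMSEQ_offset[of "\<lambda>k. cdf (\<mu> k) x" N l] by blast
  then show ?thesis unfolding weak_conv_m_def weak_conv_def by (simp only:)
qed

section \<open>The two directions of the limit theorem\<close>

theorem mainTheorem3:
  fixes p :: "nat \<Rightarrow> real"
    and G :: "nat \<Rightarrow> nat set set"
    and P :: "nat \<Rightarrow> 'a measure"
    and X :: "nat \<Rightarrow> nat \<Rightarrow> 'a \<Rightarrow> bool"
    and M :: "'b measure"
    and \<Xi> :: "'b \<Rightarrow> real set"
  assumes p_range: "\<And>n. n \<ge> 1 \<Longrightarrow> 0 < p n \<and> p n < 1"
    and p_lim: "p \<longlonglongrightarrow> 0"
    and prob: "\<And>n. n \<ge> 1 \<Longrightarrow> prob_space (P n)"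
    and indep: "\<And>n. n \<ge> 1 \<Longrightarrow>
      prob_space.indep_vars (P n) (\<lambda>_. count_space UNIV) (X n) {1..n}"
    and bernoulli: "\<And>n u. n \<ge> 1 \<Longrightarrow> u \<in> {1..n} \<Longrightarrow>
      distr (P n) (count_space UNIV) (X n u) = measure_pmf (bernoulli_pmf (p n))"
    and graph: "\<And>n. n \<ge> 1 \<Longrightarrow> G n \<subseteq> nsets {1..n} 2"
    and dense: "dense_graphs G"
    and degree_order: "\<And>n u v. n \<ge> 1 \<Longrightarrow> 1 \<le> u \<Longrightarrow> u \<le> v \<Longrightarrow> v \<le> n \<Longrightarrow>
      degree (G n) v \<le> degree (G n) u"
    and mean: "(\<lambda>n. LINT \<omega> | P n. T_stat n (G n) (X n) \<omega>) \<in> \<Theta>(\<lambda>_. 1)"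
    and poisson: "rate1_poisson_process M \<Xi>"
  shows
    "(\<forall>W\<in>kernels.
        (\<forall>\<^sub>F K in at_top.
           (\<lambda>n. cut_norm K (\<lambda>z. graph_kernel n (G n) (1 / p n) z - W z)) \<longlonglongrightarrow> 0) \<longrightarrow>
        (\<exists>a\<ge>0.
           (AE z in lborel. z \<in> quadrant - {0..a} \<times> {0..a} \<longrightarrow> W z = 0) \<and>
           (\<exists>\<mu>. Q1_law M \<Xi> W a \<mu> \<and>
              weak_conv_m (\<lambda>n. distr (P n) borel (T_stat n (G n) (X n))) \<mu>)))
     \<and>
     (\<forall>\<mu>. real_distribution \<mu> \<and>
          weak_conv_m (\<lambda>n. distr (P n) borel (T_stat n (G n) (X n))) \<mu> \<longrightarrow>
        (\<exists>W\<in>kernels. \<exists>a\<ge>0.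
           (\<forall>z \<in> quadrant - {0..a} \<times> {0..a}. W z = 0) \<and> Q1_law M \<Xi> W a \<mu>))"
proof -
  interpret rate1_process M \<Xi>
    using poisson by (auto simp: rate1_process_def rate1_process_axioms_def rate1_poisson_process_def)
  define T where "T n = T_stat n (G n) (X n)" for n
  define \<mu> where "\<mu> n = distr (P n) borel (T n)" for n
  have p01: "0 \<le> p n" "p n \<le> 1" if "1 \<le> n" for n using p_range[OF that] by auto

  have T_meas: "T n \<in> borel_measurable (P n)" if n: "1 \<le> n" for n
    unfolding T_def by (rule T_stat_measurable[OF prob p01 indep bernoulli graph]) (use n in auto)
  have T_int: "integrable (P n) (T n)" and T_mean: "(LINT \<omega>|P n. T n \<omega>) = (p n)\<^sup>2 * real (card (G n))" if n: "1 \<le> n" for n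
    unfolding T_def by (rule expectation_T_stat[OF prob p01 indep bernoulli graph]; use n in auto)+
  have T_nn: "0 \<le> T n \<omega>" if n: "1 \<le> n" for n \<omega>
    unfolding T_def by (rule T_stat_nonneg[OF prob p01 indep bernoulli graph]) (use n in auto)
  have T_exp: "(LINT \<omega>|P n. exp (w * of_real (T n \<omega>))) = edge_gf (p n) (exp w) {1..n} (adj (G n))" if n: "1 \<le> n" for n w
    unfolding T_def by (rule expectation_exp_T_stat[OF prob p01 indep bernoulli graph]) (use n in auto)
  obtain C where C: "0 < C" "\<forall>\<^sub>F n in sequentially. C * (real n)\<^sup>2 \<le> real (card (G n))"
    using dense by (auto simp: dense_graphs_def)
  obtain c where c: "0 < c" "\<forall>\<^sub>F n in sequentially. norm (LINT \<omega>|P n. T n \<omega>) \<le> c * norm (1 :: real)"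
    using landau_o.bigE[OF bigthetaD1[OF mean]] unfolding T_def by blast
  \<comment> \<open>Eventually \<open>C\<close> * (n p)^2 is at most the mean and the mean at most
    \<open>c\<close>, so n p is at most the root of \<open>c\<close> / \<open>C\<close>.\<close>
  define a where "a = sqrt (c / C) + 1"
  have a: "0 < a" using c C by (simp add: a_def add_nonneg_pos)
  have "\<forall>\<^sub>F n in sequentially. 1 \<le> n \<and> real n * p n \<le> a \<and> (LINT \<omega>|P n. T n \<omega>) \<le> c"
    using C(2) c(2) eventually_ge_at_top[of 1]
  proof eventually_elim
    case (elim n)
    have "C * (real n * p n)\<^sup>2 = (C * (real n)\<^sup>2) * (p n)\<^sup>2" by (simp add: power_mult_distrib)
    also have "\<dots> \<le> (LINT \<omega>|P n. T n \<omega>)"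
      using mult_right_mono[OF elim(1), of "(p n)\<^sup>2"] T_mean[OF elim(3)] by (simp add: mult.commute)
    also have le: "\<dots> \<le> c" using elim(2) by simp
    finally have "(real n * p n)\<^sup>2 \<le> c / C" using C by (simp add: field_simps)
    then have "real n * p n \<le> sqrt (c / C)" by (rule real_le_rsqrt)
    then show ?case using le elim(3) by (simp add: a_def)
  qed
  then obtain N where N: "1 \<le> n" "real n * p n \<le> a" "(LINT \<omega>|P n. T n \<omega>) \<le> c" if "N \<le> n" for n
    by (auto simp: eventually_sequentially)
  \<comment> \<open>Dropping the first \<open>N\<close> indices makes the bounds hold for every
    index; weak convergence is not affected.\<close>
  define n where "n k = k + N" for k
  define q where "q k = p (n k)" for k
  define E where "E k = G (n k)" for k
  define \<mu>' where "\<mu>' k = \<mu> (n k)" for k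
  have n1: "1 \<le> n k" for k by (rule N) (simp add: n_def)
  have nq: "real (n k) * q k \<le> a" for k unfolding q_def by (rule N) (simp add: n_def)
  have q: "0 < q k" "q k < 1" for k using p_range[OF n1] by (auto simp: q_def)
  have q0: "q \<longlonglongrightarrow> 0" unfolding q_def n_def by (rule LIMSEQ_ignore_initial_segment[OF p_lim])
  have E: "E k \<subseteq> nsets {1..n k} 2" for k unfolding E_def by (rule graph[OF n1])
  have \<mu>'_dist: "real_distribution (\<mu>' k)" for k
    unfolding \<mu>'_def \<mu>_def by (rule prob_space.real_distribution_distr[OF prob[OF n1] T_meas[OF n1]])
  have \<mu>'_nn: "AE x in \<mu>' k. 0 \<le> x" for k
    unfolding \<mu>'_def \<mu>_def using T_meas[OF n1, of k] T_nn[OF n1] by (subst AE_distr_iff) auto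
  have \<mu>'_int: "integrable (\<mu>' k) (\<lambda>x. x)" for k
    unfolding \<mu>'_def \<mu>_def using T_meas[OF n1, of k] T_int[OF n1] by (subst integrable_distr_eq) auto
  have \<mu>'_mean: "(LINT x|\<mu>' k. x) \<le> c" for k
    unfolding \<mu>'_def \<mu>_def using T_meas[OF n1, of k] N(3)[of "n k"] by (subst integral_distr) (auto simp: n_def)
  have \<mu>'_gf: "(LINT x|\<mu>' k. exp (w * of_real x)) = edge_gf (q k) (exp w) {1..n k} (adj (E k))" for k w
    unfolding \<mu>'_def \<mu>_def q_def E_def T_exp[OF n1, symmetric] using T_meas[OF n1, of k] by (subst integral_distr) auto
  have \<mu>'_char: "char (\<mu>' k) \<theta> = edge_gf (q k) (exp (\<i> * of_real \<theta>)) {1..n k} (adj (E k))" for k \<theta>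
    unfolding char_def \<mu>'_gf[symmetric] by (simp add: mult.assoc)
  have \<mu>'_laplace: "of_real (LINT x|\<mu>' k. exp (- t * x)) = edge_gf (q k) (of_real (exp (- t))) {1..n k} (adj (E k))" for k t
  proof -
    have "of_real (LINT x|\<mu>' k. exp (- t * x)) = (LINT x|\<mu>' k. complex_of_real (exp (- t * x)))"
      by (rule integral_complex_of_real[symmetric])
    also have "\<dots> = (LINT x|\<mu>' k. exp (complex_of_real (- t) * of_real x))"
      by (simp add: exp_of_real[symmetric])
    finally show ?thesis unfolding \<mu>'_gf by (simp add: exp_of_real[symmetric])
  qed
  have weak_iff: "weak_conv_m (\<lambda>n. distr (P n) borel (T_stat n (G n) (X n))) \<nu> \<longleftrightarrow> weak_conv_m \<mu>' \<nu>" for \<nu>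
    using weak_conv_m_offset[of \<mu> N \<nu>] unfolding \<mu>'_def n_def \<mu>_def T_def by simp
  have norm_laplace: "norm (complex_of_real (exp (- t))) \<le> 1" if "0 \<le> t" for t using that by simp
  have norm_char: "norm (exp (\<i> * complex_of_real \<theta>)) \<le> 1" for \<theta> by simp

  have part_a: "\<exists>a\<ge>0. (AE z in lborel. z \<in> quadrant - {0..a} \<times> {0..a} \<longrightarrow> W z = 0) \<and>
       (\<exists>\<mu>. Q1_law M \<Xi> W a \<mu> \<and> weak_conv_m (\<lambda>n. distr (P n) borel (T_stat n (G n) (X n))) \<mu>)"
    if W: "W \<in> kernels" and cut: "\<forall>\<^sub>F K in at_top.
           (\<lambda>n. cut_norm K (\<lambda>z. graph_kernel n (G n) (1 / p n) z - W z)) \<longlonglongrightarrow> 0" for W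
  proof -
    \<comment> \<open>A member of \<open>kernels\<close> is arbitrary off the quadrant.
      \<open>W0\<close> is 0 there and has the same cut distances, since it agrees with
      \<open>W\<close> on every square [0, K]^2.\<close>
    define W0 where "W0 w = indicator quadrant w * W w" for w
    define W' where "W' w = indicator ({0..a} \<times> {0..a}) w * W0 w" for w
    have W0m: "W0 \<in> borel_measurable borel"
      using W by (simp add: kernels_def set_borel_measurable_def W0_def[abs_def])
    have W001: "0 \<le> W0 w \<and> W0 w \<le> 1" for w
      using W by (cases w) (auto simp: kernels_def W0_def indicator_def)
    have W0sym: "W0 (x, y) = W0 (y, x)" for x y
      using W by (auto simp: kernels_def W0_def indicator_def)
    have W'm: "W' \<in> borel_measurable borel"
      unfolding W'_def using W0m indicator_square_measurable[of a] by simp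
    have W'01: "0 \<le> W' w \<and> W' w \<le> 1" for w using W001[of w] by (auto simp: W'_def indicator_def)
    have W'sym: "W' (x, y) = W' (y, x)" for x y using W0sym[of x y] by (auto simp: W'_def indicator_def)
    obtain K0 where K0: "\<And>K. K0 \<le> K \<Longrightarrow> (\<lambda>n. cut_norm K (\<lambda>z. graph_kernel n (G n) (1 / p n) z - W z)) \<longlonglongrightarrow> 0"
      using cut by (auto simp: eventually_at_top_linorder)
    have cut0: "(\<lambda>k. cut_norm K (\<lambda>w. graph_kernel (n k) (E k) (1 / q k) w - W0 w)) \<longlonglongrightarrow> 0" if "K0 \<le> K" for K
    proof -
      have "cut_norm K (\<lambda>w. graph_kernel (n k) (E k) (1 / q k) w - W0 w)
          = cut_norm K (\<lambda>w. graph_kernel (k + N) (G (k + N)) (1 / p (k + N)) w - W w)" for k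
        unfolding E_def q_def n_def by (intro cut_norm_cong) (auto simp: W0_def)
      then show ?thesis using LIMSEQ_ignore_initial_segment[OF K0[OF that], of N] by simp
    qed
    define K1 where "K1 = max K0 a"
    \<comment> \<open>The mass of \<open>W0\<close> on a strip beyond \<open>a\<close> is at most
      every cut distance in the sequence, and these tend to 0.\<close>
    have null: "AE w in lborel. w \<in> {a<..K} \<times> {0..K} \<union> {0..K} \<times> {a<..K} \<longrightarrow> W0 w = 0" if K: "K1 \<le> K" for K
    proof -
      have aK: "a \<le> K" "K0 \<le> K" using K by (auto simp: K1_def)
      have zero: "AE w in lborel. w \<in> S \<longrightarrow> W0 w = 0"
        if S: "S \<in> sets borel" "S \<subseteq> {0..K} \<times> {0..K}"
          and le: "\<And>k. (LINT w|lborel. indicator S w * W0 w) \<le> cut_norm K (\<lambda>w. graph_kernel (n k) (E k) (1 / q k) w - W0 w)" for S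
      proof -
        have int: "integrable lborel (\<lambda>w. indicator S w * W0 w)"
          using W001 W0m S(1) S(2)[THEN subsetD]
          by (intro Bochner_Integration.integrable_bound[OF integrable_indicator_square[of K]]) (auto simp: indicator_def intro!: AE_I2)
        have "(LINT w|lborel. indicator S w * W0 w) \<le> 0"
          using le by (intro LIMSEQ_le_const[OF cut0[OF aK(2)]]) auto
        moreover have "0 \<le> (LINT w|lborel. indicator S w * W0 w)"
          using W001 by (intro integral_nonneg_AE) auto
        ultimately have "(LINT w|lborel. indicator S w * W0 w) = 0" by linarith
        then have "AE w in lborel. indicator S w * W0 w = 0"
          using int W001 by (subst (asm) integral_nonneg_eq_0_iff_AE) auto
        then show ?thesis by eventually_elim (auto simp: indicator_def)
      qed
      have S: "{a<..K} \<times> {0..K} \<in> sets borel" "{0..K} \<times> {a<..K} \<in> sets borel"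
        unfolding borel_prod[symmetric] by measurable
      have "AE w in lborel. w \<in> {a<..K} \<times> {0..K} \<longrightarrow> W0 w = 0"
        using a by (intro zero S cut_norm_mass(1)[OF q(1) E nq aK(1) W0m W001 nq]) auto
      moreover have "AE w in lborel. w \<in> {0..K} \<times> {a<..K} \<longrightarrow> W0 w = 0"
        using a by (intro zero S cut_norm_mass(2)[OF q(1) E nq aK(1) W0m W001 nq]) auto
      ultimately show ?thesis by eventually_elim auto
    qed
    \<comment> \<open>Countably many squares exhaust the quadrant, so the null sets can be
      united.\<close>
    have "AE w in lborel. \<forall>j::nat. w \<in> {a<..K1 + real j} \<times> {0..K1 + real j} \<union> {0..K1 + real j} \<times> {a<..K1 + real j} \<longrightarrow> W0 w = 0"
      unfolding AE_all_countable using null by simp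
    then have vanish: "AE w in lborel. w \<in> quadrant - {0..a} \<times> {0..a} \<longrightarrow> W w = 0"
    proof eventually_elim
      case (elim w)
      show ?case
      proof
        assume w: "w \<in> quadrant - {0..a} \<times> {0..a}"
        obtain j :: nat where j: "max (fst w) (snd w) - K1 \<le> real j" using real_arch_simple by blast
        have "w \<in> {a<..K1 + real j} \<times> {0..K1 + real j} \<union> {0..K1 + real j} \<times> {a<..K1 + real j}"
          using w j by (auto simp: mem_Times_iff)
        then have "W0 w = 0" using elim by blast
        then show "W w = 0" using w by (simp add: W0_def)
      qed
    qed
    have lim: "(\<lambda>k. edge_gf (q k) z {1..n k} (adj (E k))) \<longlonglongrightarrow> Psi a z W'" if "norm z \<le> 1" for z
      unfolding W'_def[abs_def]
      by (rule edge_gf_tendsto_Psi[where K = K1, OF a _ q q0 nq E W0m W001 W0sym cut0 that]) (auto simp: K1_def)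
    \<comment> \<open>Tightness supplies one candidate law. Its characteristic function is the limit
      along the whole sequence, so Levy's theorem gives convergence without passing to a
      subsequence.\<close>
    have "tight \<mu>'" by (rule tight_of_bounded_mean[OF \<mu>'_dist \<mu>'_nn \<mu>'_int \<mu>'_mean])
    from tight_imp_convergent_subsubsequence[OF this strict_mono_id]
    obtain r \<nu> where r: "strict_mono (r :: nat \<Rightarrow> nat)" and \<nu>: "real_distribution \<nu>" and sub: "weak_conv_m (\<mu>' \<circ> id \<circ> r) \<nu>"
      by blast
    have char_\<nu>: "char \<nu> \<theta> = Psi a (exp (\<i> * of_real \<theta>)) W'" for \<theta>
    proof (rule LIMSEQ_unique)
      show "(\<lambda>k. char ((\<mu>' \<circ> id \<circ> r) k) \<theta>) \<longlonglongrightarrow> char \<nu> \<theta>"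
        using \<mu>'_dist by (intro levy_continuity1 \<nu> sub) simp
      show "(\<lambda>k. char ((\<mu>' \<circ> id \<circ> r) k) \<theta>) \<longlonglongrightarrow> Psi a (exp (\<i> * of_real \<theta>)) W'"
        using LIMSEQ_subseq_LIMSEQ[OF lim[OF norm_char] r] by (simp add: o_def \<mu>'_char)
    qed
    have conv: "weak_conv_m \<mu>' \<nu>"
      by (rule levy_continuity[OF \<mu>'_dist \<nu>]) (simp only: \<mu>'_char char_\<nu> lim[OF norm_char])
    have "Q1_law M \<Xi> W' a \<nu>"
    proof (rule Q1_lawI[OF a W'm W'01 W'sym \<nu> weak_conv_m_nonneg(1)[OF \<mu>'_dist \<nu> conv \<mu>'_nn]])
      fix t :: real assume t: "0 \<le> t"
      show "of_real (LINT x|\<nu>. exp (- t * x)) = Psi a (of_real (exp (- t))) W'"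
      proof (rule LIMSEQ_unique)
        show "(\<lambda>k. complex_of_real (LINT x|\<mu>' k. exp (- t * x))) \<longlonglongrightarrow> of_real (LINT x|\<nu>. exp (- t * x))"
          by (intro tendsto_of_real weak_conv_m_nonneg(2)[OF \<mu>'_dist \<nu> conv \<mu>'_nn t])
        show "(\<lambda>k. complex_of_real (LINT x|\<mu>' k. exp (- t * x))) \<longlonglongrightarrow> Psi a (of_real (exp (- t))) W'"
          unfolding \<mu>'_laplace by (rule lim[OF norm_laplace[OF t]])
      qed
    qed
    moreover have "Q1_law M \<Xi> W a \<nu> = Q1_law M \<Xi> W' a \<nu>"
      by (rule Q1_law_cong) (auto simp: W'_def W0_def)
    ultimately show ?thesis
      using vanish conv a unfolding weak_iff by (intro exI[of _ a]) auto
  qed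

  have part_b: "\<exists>W\<in>kernels. \<exists>a\<ge>0. (\<forall>z \<in> quadrant - {0..a} \<times> {0..a}. W z = 0) \<and> Q1_law M \<Xi> W a \<nu>"
    if \<nu>: "real_distribution \<nu>" and conv: "weak_conv_m \<mu>' \<nu>" for \<nu>
  proof -
    obtain W r where r: "strict_mono r" and "kernel_on a W"
      and lim: "\<forall>z. norm z \<le> 1 \<longrightarrow> (\<lambda>k. edge_gf (q (r k)) z {1..n (r k)} (adj (E (r k)))) \<longlonglongrightarrow> Psi a z W"
      using kernel_compactness[of a q n "\<lambda>k. adj (E k)", OF a q q0 nq adj_sym adj_bounds] by blast
    note W = kernel_onD[OF this(2)]
    have "quadrant \<in> sets (borel :: (real \<times> real) measure)" unfolding borel_prod[symmetric] by measurable
    then have "W \<in> kernels"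
      using W by (auto simp: kernels_def set_borel_measurable_def)
    moreover have "Q1_law M \<Xi> W a \<nu>"
    proof (rule Q1_lawI[OF a W(1-3) \<nu> weak_conv_m_nonneg(1)[OF \<mu>'_dist \<nu> conv \<mu>'_nn]])
      fix t :: real assume t: "0 \<le> t"
      \<comment> \<open>The Laplace transforms converge along the whole sequence, hence along the
        subsequence on which compactness has produced \<open>W\<close>; the two limits must
        agree.\<close>
      have "(\<lambda>k. complex_of_real (LINT x|\<mu>' k. exp (- t * x))) \<longlonglongrightarrow> of_real (LINT x|\<nu>. exp (- t * x))"
        by (intro tendsto_of_real weak_conv_m_nonneg(2)[OF \<mu>'_dist \<nu> conv \<mu>'_nn t])
      from LIMSEQ_subseq_LIMSEQ[OF this r]
      have "(\<lambda>k. complex_of_real (LINT x|\<mu>' (r k). exp (- t * x))) \<longlonglongrightarrow> of_real (LINT x|\<nu>. exp (- t * x))"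
        by (simp only: o_def)
      moreover have "(\<lambda>k. complex_of_real (LINT x|\<mu>' (r k). exp (- t * x))) \<longlonglongrightarrow> Psi a (of_real (exp (- t))) W"
        unfolding \<mu>'_laplace using lim norm_laplace[OF t] by blast
      ultimately show "of_real (LINT x|\<nu>. exp (- t * x)) = Psi a (of_real (exp (- t))) W"
        by (rule LIMSEQ_unique)
    qed
    ultimately show ?thesis using W(4) a by (intro bexI[of _ W] exI[of _ a]) auto
  qed
  show ?thesis
    using part_a part_b weak_iff by blast
qed

end
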